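(* Let $\tau$ be a non-vanishing function of $(q_{0,0};q_{0,1},q_{1,1},q_{2,1},\dots;\epsilon)$. Then $\tau$ is a tau-function of the Toda Lattice Hierarchy $\partial_{n,1}\mathcal L=\epsilon^{-1}\bigl[\bigl(\tfrac{\mathcal L^{n+1}}{(n+1)!}\bigr)_+,\mathcal L\bigr]$, $n\ge0$, if and only if for each $m\in\mathbb Z$ the expression $$\frac{d\lambda}{\lambda}\left\{\Bigl(\frac{\lambda}{\sqrt Q}\Bigr)^{m}\Gamma^{\beta}\otimes\Gamma^{-\beta}-\Bigl(\frac{\lambda}{\sqrt Q}\Bigr)^{-m}\Gamma^{-\beta}\otimes\Gamma^{\beta}\right\}(\tau\otimes\tau),$$ computed at $q'_{0,0}-q''_{0,0}=m\epsilon$, is regular in $\lambda$.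
   Context: **Conventions.** One works over the field $\mathbb C((\epsilon))$; $Q$ is a nonzero constant with a fixed square root $\sqrt Q$; $\partial_{n,i}=\partial/\partial q_{n,i}$. $\Lambda=e^{\epsilon\partial_x}$ is the shift operator. $\#$ is the antiinvolution on formal series in $\Lambda^{\pm1}$ with $x^\#=x$, $\Lambda^\#=Q\Lambda^{-1}$. For $B=\sum_kB_k\Lambda^k$, $B_+=\sum_{k\ge0}B_k\Lambda^k$ and $B_-=\sum_{k<0}B_k\Lambda^k$. **Toda Lattice Hierarchy.** A Lax operator is $\mathcal L=\Lambda+u+Qe^v\Lambda^{-1}$, with $u=u_0(x)+u_1(x)\epsilon+\dots$, $v=v_1(x)\epsilon+v_2(x)\epsilon^2+\dots$, coefficients infinitely differentiable in $x$. A pair of dressing operators for $\mathcal L$ is a pair $\mathcal P_L=1+w_1\Lambda^{-1}+w_2\Lambda^{-2}+\dots$, $\mathcal P_R=\tilde w_0+\Lambda^{-1}\tilde w_1+\Lambda^{-2}\tilde w_2+\dots$ such that $\mathcal L=\mathcal P_L\Lambda\mathcal P_L^{-1}=(\mathcal P_R^{-1}\Lambda\mathcal P_R)^\#$. It is a pair of wave operators of the Toda Lattice Hierarchy if for all $n\ge0$ $$\partial_{n,1}\mathcal P_L=-\Bigl(\tfrac{\mathcal L^{n+1}}{\epsilon(n+1)!}\Bigr)_-\mathcal P_L,\qquad \partial_{n,1}\mathcal P_R^\#=\Bigl(\tfrac{\mathcal L^{n+1}}{\epsilon(n+1)!}\Bigr)_+\mathcal P_R^\#.$$ **Tau-functions.**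 To a non-vanishing $\tau(q_{0,0};q_{0,1},q_{1,1},\dots;\epsilon)$ associate $\mathcal P_L=1+\sum_{k\ge1}w_k\Lambda^{-k}$, $\mathcal P_R=\sum_{k\ge0}\Lambda^{-k}\tilde w_k$ where $$1+\frac{w_1}{\lambda}+\frac{w_2}{\lambda^2}+\dots=\frac{\exp\bigl(-\sum_{n\ge0}n!\lambda^{-n-1}\epsilon\partial_{n,1}\bigr)\tau(q_{0,0}+x-\frac\epsilon2;q_{0,1},\dots;\epsilon)}{\tau(q_{0,0}+x-\frac\epsilon2;q_{0,1},\dots;\epsilon)},$$ $$\tilde w_0+\frac{\tilde w_1}{\lambda}+\frac{\tilde w_2}{\lambda^2}+\dots=\frac{\exp\bigl(\sum_{n\ge0}n!\lambda^{-n-1}\epsilon\partial_{n,1}\bigr)\tau(q_{0,0}+x+\frac\epsilon2;q_{0,1},\dots;\epsilon)}{\tau(q_{0,0}+x-\frac\epsilon2;q_{0,1},\dots;\epsilon)}.$$ $\tau$ is a tau-function of the Toda Lattice Hierarchy if these $\mathcal P_L,\mathcal P_R$ are wave operators of the Toda Lattice Hierarchy. **Vertex operators.** $$\Gamma^{\pm\beta}=\exp\Bigl\{\pm\tfrac12\sum_{n\ge0}\tfrac{\lambda^{n+1}}{(n+1)!}\tfrac{q_{n,1}}{\epsilon}\Bigr\}\exp\Bigl\{\mp\tfrac\epsilon2\partial_{0,0}\mp\sum_{n\ge0}\tfrac{n!}{\lambda^{1+n}}\epsilon\partial_{n,1}\Bigr\}.$$ $\tau\otimes\tau$ means $\tau(\mathbf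 q';\epsilon)\tau(\mathbf q'';\epsilon)$ in two copies $\mathbf q',\mathbf q''$ of the variables $\mathbf q=(q_{0,0};q_{0,1},q_{1,1},\dots)$; operators before (after) $\otimes$ act on $\mathbf q'$ (on $\mathbf q''$). **Regularity.** After the change $\mathbf x=(\mathbf q'+\mathbf q'')/2$, $\mathbf y=(\mathbf q'-\mathbf q'')/2$ the expression expands as a power series in $\mathbf y$ ($y_{0,0}$ excluded) with coefficients Laurent series in $\lambda^{-1}$. "Regular in $\lambda$" means that in the $1$-form (with the factor $d\lambda/\lambda$ included) all these Laurent series multiplying $d\lambda$ are polynomials in $\lambda$.
   Formalization: In the Lax operator, u may contain negative powers of ε, and v = O(ε) is required only at q_{n,1}=0, as the literal expansions make the equivalence false (L = Λ+1/ε+QΛ^{-1}); τ is a formal power series in the q_{n,1}, with Laurent coefficients in ε smooth in q_{0,0}. *)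

theory Defs
  imports
    "HOL-Analysis.Analysis"
    "HOL-Computational_Algebra.Formal_Laurent_Series"
    "HOL-Library.Multiset"
    "HOL-Library.Groups_Big_Fun"
begin

unbundle no vec_syntax
unbundle fps_syntax

section \<open>Infinitely differentiable functions of one real variable\<close>

definition vderiv :: "(real \<Rightarrow> complex) \<Rightarrow> real \<Rightarrow> complex" where
  "vderiv f = (\<lambda>x. vector_derivative f (at x))"

definition kdiff :: "nat \<Rightarrow> (real \<Rightarrow> complex) \<Rightarrow> bool" where
  "kdiff n f \<longleftrightarrow> (\<forall>k<n. \<forall>x. (vderiv ^^ k) f differentiable (at x))"

lemma kdiff_0 [simp]: "kdiff 0 f"
  by (simp add: kdiff_def)

lemma kdiff_Suc: "kdiff (Suc n) f \<longleftrightarrow> (\<forall>x. f differentiable (at x)) \<and> kdiff n (vderiv f)"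
proof -
  have *: "(vderiv ^^ Suc k) f = (vderiv ^^ k) (vderiv f)" for k
    by (simp add: funpow_swap1)
  show ?thesis
    unfolding kdiff_def
    by (metis (no_types, lifting) * funpow_0 less_Suc_eq_0_disj)
qed

lemma kdiff_mono: "kdiff n f \<Longrightarrow> m \<le> n \<Longrightarrow> kdiff m f"
  by (auto simp: kdiff_def)

lemma kdiff_const [simp]: "kdiff n (\<lambda>_. c)"
proof (induction n arbitrary: c)
  case (Suc n)
  have "vderiv (\<lambda>_. c) = (\<lambda>_. 0)"
    by (simp add: vderiv_def)
  then show ?case using Suc by (simp add: kdiff_Suc)
qed simp

lemma kdiff_add: "kdiff n f \<Longrightarrow> kdiff n g \<Longrightarrow> kdiff n (\<lambda>x. f x + g x)"
proof (induction n arbitrary: f g)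
  case (Suc n)
  have f: "\<And>x. f differentiable (at x)" and g: "\<And>x. g differentiable (at x)"
    using Suc.prems by (auto simp: kdiff_Suc)
  have "vderiv (\<lambda>x. f x + g x) = (\<lambda>x. vderiv f x + vderiv g x)"
    using f g by (simp add: vderiv_def vector_derivative_add_at)
  then show ?case using Suc f g by (simp add: kdiff_Suc)
qed simp

lemma kdiff_mult: "kdiff n f \<Longrightarrow> kdiff n g \<Longrightarrow> kdiff n (\<lambda>x. f x * g x)"
proof (induction n arbitrary: f g)
  case (Suc n)
  have f: "\<And>x. f differentiable (at x)" and g: "\<And>x. g differentiable (at x)"
    using Suc.prems by (auto simp: kdiff_Suc)
  have d: "vderiv (\<lambda>x. f x * g x) = (\<lambda>x. f x * vderiv g x + vderiv f x * g x)"
    using f g by (simp add: vderiv_def vector_derivative_mult_at)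
  have "kdiff n f" "kdiff n g"
    using Suc.prems by (auto intro: kdiff_mono[of "Suc n"])
  then have "kdiff n (\<lambda>x. f x * vderiv g x + vderiv f x * g x)"
    using Suc.prems by (intro kdiff_add Suc.IH) (auto simp: kdiff_Suc)
  then show ?case using f g d by (simp add: kdiff_Suc differentiable_mult)
qed simp

lemma kdiff_uminus: "kdiff n f \<Longrightarrow> kdiff n (\<lambda>x. - f x)"
  using kdiff_mult[of n "\<lambda>_. - 1" f] by simp

definition smooth :: "(real \<Rightarrow> complex) \<Rightarrow> bool" where
  "smooth f \<longleftrightarrow> (\<forall>k x. (vderiv ^^ k) f differentiable (at x))"

lemma smooth_iff_kdiff: "smooth f \<longleftrightarrow> (\<forall>n. kdiff n f)"
  by (auto simp: smooth_def kdiff_def)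

typedef smf = "{f. smooth f}"
  morphisms smf_fun Abs_smf
  by (rule exI[of _ "\<lambda>_. 0"]) (simp add: smooth_iff_kdiff)

setup_lifting type_definition_smf

instantiation smf :: comm_ring_1
begin

lift_definition zero_smf :: smf is "\<lambda>_. 0"
  unfolding smooth_iff_kdiff by simp

lift_definition one_smf :: smf is "\<lambda>_. 1"
  unfolding smooth_iff_kdiff by simp

lift_definition plus_smf :: "smf \<Rightarrow> smf \<Rightarrow> smf" is "\<lambda>f g x. f x + g x"
  unfolding smooth_iff_kdiff by (simp add: kdiff_add)

lift_definition times_smf :: "smf \<Rightarrow> smf \<Rightarrow> smf" is "\<lambda>f g x. f x * g x"
  unfolding smooth_iff_kdiff by (simp add: kdiff_mult)

lift_definition uminus_smf :: "smf \<Rightarrow> smf" is "\<lambda>f x. - f x"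
  unfolding smooth_iff_kdiff by (simp add: kdiff_uminus)

lift_definition minus_smf :: "smf \<Rightarrow> smf \<Rightarrow> smf" is "\<lambda>f g x. f x - g x"
  unfolding smooth_iff_kdiff diff_conv_add_uminus by (intro allI kdiff_add kdiff_uminus) auto

instance
proof
  show "(0::smf) \<noteq> 1"
    by transfer (metis zero_neq_one)
qed (transfer; simp add: algebra_simps)+

end

lift_definition smf_const :: "complex \<Rightarrow> smf" is "\<lambda>c _. c"
  unfolding smooth_iff_kdiff by simp

lift_definition smf_deriv :: "smf \<Rightarrow> smf" is vderiv
  unfolding smooth_iff_kdiff using kdiff_Suc by blast


section \<open>Formal power series in infinitely many variables\<close>

text \<open>Monomials are finite multisets of variables: the multiset \<open>M\<close> stands for
  the product of the variables in \<open>M\<close>, and \<open>mcoeff F M\<close> is its coefficient in \<open>F\<close>.\<close>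

typedef ('v, 'a) mps = "UNIV :: ('v multiset \<Rightarrow> 'a) set"
  morphisms mcoeff Abs_mps ..

setup_lifting type_definition_mps

lemma finite_submultisets: "finite {A. A \<subseteq># (M :: 'v multiset)}"
proof (rule finite_subset)
  show "{A. A \<subseteq># M} \<subseteq> mset ` {xs. set xs \<subseteq> set_mset M \<and> length xs \<le> size M}"
  proof
    fix A assume "A \<in> {A. A \<subseteq># M}"
    then have A: "A \<subseteq># M" by simp
    obtain xs where xs: "mset xs = A" using ex_mset by blast
    have "set xs \<subseteq> set_mset M" "length xs \<le> size M"
      using xs A set_mset_mono[OF A] size_mset_mono[OF A] by auto
    then show "A \<in> mset ` {xs. set xs \<subseteq> set_mset M \<and> length xs \<le> size M}"
      using xs by blast
  qed
  show "finite (mset ` {xs. set xs \<subseteq> set_mset M \<and> length xs \<le> size M})"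
    by (simp add: finite_lists_length_le)
qed

instantiation mps :: (type, comm_ring_1) comm_ring_1
begin

lift_definition zero_mps :: "('a, 'b) mps" is "\<lambda>_. 0" .

lift_definition one_mps :: "('a, 'b) mps" is "\<lambda>M. if M = {#} then 1 else 0" .

lift_definition plus_mps :: "('a, 'b) mps \<Rightarrow> ('a, 'b) mps \<Rightarrow> ('a, 'b) mps"
  is "\<lambda>F G M. F M + G M" .

lift_definition minus_mps :: "('a, 'b) mps \<Rightarrow> ('a, 'b) mps \<Rightarrow> ('a, 'b) mps"
  is "\<lambda>F G M. F M - G M" .

lift_definition uminus_mps :: "('a, 'b) mps \<Rightarrow> ('a, 'b) mps"
  is "\<lambda>F M. - F M" .

lift_definition times_mps :: "('a, 'b) mps \<Rightarrow> ('a, 'b) mps \<Rightarrow> ('a, 'b) mps"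
  is "\<lambda>F G M. \<Sum>A | A \<subseteq># M. F A * G (M - A)" .

instance
proof
  fix F G H :: "('a, 'b) mps"
  show "F * G * H = F * (G * H)"
  proof (transfer, rule ext)
    fix f g h :: "'a multiset \<Rightarrow> 'b" and M :: "'a multiset"
    let ?S = "SIGMA A:{A. A \<subseteq># M}. {B. B \<subseteq># A}"
    let ?T = "SIGMA B:{B. B \<subseteq># M}. {C. C \<subseteq># M - B}"
    have "(\<Sum>A | A \<subseteq># M. (\<Sum>B | B \<subseteq># A. f B * g (A - B)) * h (M - A))
        = (\<Sum>(A, B)\<in>?S. f B * g (A - B) * h (M - A))"
      by (simp add: sum_distrib_right sum.Sigma finite_submultisets)
    also have "\<dots> = (\<Sum>(B, C)\<in>?T. f B * g C * h (M - B - C))"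
    proof (rule sum.reindex_bij_witness
        [where i = "\<lambda>(B, C). (B + C, B)" and j = "\<lambda>(A, B). (B, A - B)"], goal_cases)
      case (1 a)
      then show ?case by (auto simp: subset_mset.add_diff_inverse)
    next
      case (2 a)
      then show ?case
        by (auto intro: subset_mset.order_trans)
          (metis subset_mset.diff_add subset_mset.order_trans subset_eq_diff_conv)
    next
      case (3 b)
      then show ?case by auto
    next
      case (4 b)
      then show ?case
        by (auto simp: subset_mset.le_diff_conv2 add.commute)
    next
      case (5 a)
      then show ?case
        by (auto simp flip: diff_diff_add_mset simp: subset_mset.add_diff_inverse)
          (metis diff_diff_add_mset subset_mset.add_diff_inverse)
    qed
    also have "\<dots> = (\<Sum>B | B \<subseteq># M. f B * (\<Sum>C | C \<subseteq># M - B. g C * h (M - B - C)))"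
      by (simp add: sum_distrib_left sum.Sigma finite_submultisets mult.assoc)
    finally show "(\<Sum>A | A \<subseteq># M. (\<Sum>B | B \<subseteq># A. f B * g (A - B)) * h (M - A))
        = (\<Sum>B | B \<subseteq># M. f B * (\<Sum>C | C \<subseteq># M - B. g C * h (M - B - C)))" .
  qed
  show "F * G = G * F"
  proof (transfer, rule ext)
    fix f g :: "'a multiset \<Rightarrow> 'b" and M :: "'a multiset"
    show "(\<Sum>A | A \<subseteq># M. f A * g (M - A)) = (\<Sum>A | A \<subseteq># M. g A * f (M - A))"
      by (rule sum.reindex_bij_witness[where i = "\<lambda>A. M - A" and j = "\<lambda>A. M - A"])
        (auto simp: mult.commute subset_mset.diff_diff_right)
  qed
  show "1 * F = F"
  proof (transfer, rule ext)
    fix f :: "'a multiset \<Rightarrow> 'b" and M :: "'a multiset"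
    have "(\<Sum>A | A \<subseteq># M. (if A = {#} then 1 else 0) * f (M - A))
        = (\<Sum>A | A \<subseteq># M. if A = {#} then f M else 0)"
      by (intro sum.cong) auto
    also have "\<dots> = f M"
      by (subst sum.delta[OF finite_submultisets]) simp
    finally show "(\<Sum>A | A \<subseteq># M. (if A = {#} then 1 else 0) * f (M - A)) = f M" .
  qed
  show "(F + G) * H = F * H + G * H"
    by transfer (simp add: distrib_right sum.distrib)
  show "(0::('a, 'b) mps) \<noteq> 1"
    by transfer (metis zero_neq_one)
qed (transfer; simp add: algebra_simps)+

end

definition mps_const :: "'a \<Rightarrow> ('v, 'a::zero) mps" where
  "mps_const a = Abs_mps (\<lambda>M. if M = {#} then a else 0)"

definition mps_var :: "'v \<Rightarrow> ('v, 'a::zero_neq_one) mps" where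
  "mps_var v = Abs_mps (\<lambda>M. if M = {#v#} then 1 else 0)"

definition mps_map :: "('a \<Rightarrow> 'b) \<Rightarrow> ('v, 'a) mps \<Rightarrow> ('v, 'b) mps" where
  "mps_map h F = Abs_mps (\<lambda>M. h (mcoeff F M))"

definition mps_deriv :: "'v \<Rightarrow> ('v, 'a::semiring_1) mps \<Rightarrow> ('v, 'a) mps" where
  "mps_deriv v F = Abs_mps (\<lambda>M. of_nat (count M v + 1) * mcoeff F (M + {#v#}))"


section \<open>Coefficient functions\<close>

text \<open>\<open>lcf\<close> is the ring of Laurent series in \<open>\<epsilon>\<close> whose coefficients are infinitely
  differentiable functions of \<open>q\<^sub>0\<^sub>0\<close>.  The dependence on \<open>q\<^sub>n\<^sub>,\<^sub>1\<close> (variable \<open>n\<close>) is by formal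
  power series over \<open>lcf\<close>.  The variable \<open>x\<close> only enters through \<open>q\<^sub>0\<^sub>0 + x\<close>, so coefficients of
  difference operators live in the same ring \<open>cfun\<close>, the real argument then being \<open>q\<^sub>0\<^sub>0 + x\<close> and
  \<open>\<partial>\<^sub>x\<close> being \<open>\<partial>\<^sub>0\<^sub>0\<close>.\<close>

type_synonym lcf = "smf fls"
type_synonym cfun = "(nat, lcf) mps"

definition lconst :: "complex \<Rightarrow> lcf" where
  "lconst c = fls_const (smf_const c)"

definition cconst :: "complex \<Rightarrow> cfun" where
  "cconst c = mps_const (lconst c)"

definition ceps :: cfun where
  "ceps = mps_const fls_X"

definition ceps_inv :: cfun where
  "ceps_inv = mps_const fls_X_inv"

text \<open>\<open>lshift c\<close> is \<open>exp (c \<epsilon> \<partial>\<^sub>x)\<close>, i.e. the substitution of \<open>x + c\<epsilon>\<close> for \<open>x\<close> in the sense of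
  the Taylor expansion in \<open>\<epsilon>\<close>.\<close>

definition lshift :: "complex \<Rightarrow> lcf \<Rightarrow> lcf" where
  "lshift c f = Abs_fls (\<lambda>k. Sum_any (\<lambda>j::nat.
     smf_const (c ^ j / fact j) * (smf_deriv ^^ j) (f $$ (k - int j))))"

definition cshift :: "complex \<Rightarrow> cfun \<Rightarrow> cfun" where
  "cshift c = mps_map (lshift c)"

text \<open>A series is non-vanishing if its constant term in the \<open>q\<^sub>n\<^sub>,\<^sub>1\<close> is a Laurent
  series in \<open>\<epsilon>\<close> whose leading coefficient is a nowhere vanishing function; these are exactly the
  series that one can divide by.\<close>

definition nonvanishing :: "cfun \<Rightarrow> bool" where
  "nonvanishing \<tau> \<longleftrightarrow>
     (let t = mcoeff \<tau> {#} in \<forall>x. smf_fun (t $$ fls_subdegree t) x \<noteq> 0)"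

definition ring_quot :: "'a::comm_ring_1 \<Rightarrow> 'a \<Rightarrow> 'a" where
  "ring_quot a b = a * (THE c. b * c = 1)"

text \<open>\<open>exp v = \<Sum>\<^sub>k v\<^sup>k / k!\<close>, computed coefficientwise.\<close>

definition cexp :: "cfun \<Rightarrow> cfun" where
  "cexp v = Abs_mps (\<lambda>M. Abs_fls (\<lambda>j. Sum_any (\<lambda>k::nat.
     smf_const (1 / fact k) * (mcoeff (v ^ k) M $$ j))))"


section \<open>Difference operators\<close>

text \<open>The function \<open>B\<close> stands for \<open>\<Sum>\<^sub>k B\<^sub>k \<Lambda>\<^sup>k\<close>, coefficients on the left.\<close>

type_synonym dop = "int \<Rightarrow> cfun"

definition dop_one :: dop where
  "dop_one = (\<lambda>k. if k = 0 then 1 else 0)"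

definition dop_Lambda :: dop where
  "dop_Lambda = (\<lambda>k. if k = 1 then 1 else 0)"

text \<open>\<open>\<Lambda>\<^sup>i b(x) = b(x + i\<epsilon>) \<Lambda>\<^sup>i\<close>.  In all products below the sum is finite.\<close>

definition dop_mult :: "dop \<Rightarrow> dop \<Rightarrow> dop" (infixl \<open>\<bullet>\<^sub>d\<close> 70) where
  "A \<bullet>\<^sub>d B = (\<lambda>k. Sum_any (\<lambda>i. A i * cshift (of_int i) (B (k - i))))"

definition dop_power :: "dop \<Rightarrow> nat \<Rightarrow> dop" where
  "dop_power A n = ((\<lambda>B. A \<bullet>\<^sub>d B) ^^ n) dop_one"

text \<open>Inverse in the algebra of formal power series in \<open>\<Lambda>\<^sup>-\<^sup>1\<close>.\<close>

definition dop_inv :: "dop \<Rightarrow> dop" where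
  "dop_inv A = (THE B. (\<forall>k>0. B k = 0) \<and> A \<bullet>\<^sub>d B = dop_one \<and> B \<bullet>\<^sub>d A = dop_one)"

text \<open>\<open>(B\<^sub>k \<Lambda>\<^sup>k)\<^sup># = (Q \<Lambda>\<^sup>-\<^sup>1)\<^sup>k B\<^sub>k(x) = Q\<^sup>k B\<^sub>k(x - k\<epsilon>) \<Lambda>\<^sup>-\<^sup>k\<close>\<close>

definition dop_sharp :: "complex \<Rightarrow> dop \<Rightarrow> dop" where
  "dop_sharp Q B = (\<lambda>j. cconst (Q powi (- j)) * cshift (of_int j) (B (- j)))"

definition dop_plus :: "dop \<Rightarrow> dop" where
  "dop_plus B = (\<lambda>k. if k \<ge> 0 then B k else 0)"

definition dop_minus :: "dop \<Rightarrow> dop" where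
  "dop_minus B = (\<lambda>k. if k < 0 then B k else 0)"

definition dop_deriv :: "nat \<Rightarrow> dop \<Rightarrow> dop" where
  "dop_deriv n B = (\<lambda>k. mps_deriv n (B k))"


section \<open>The Toda Lattice Hierarchy\<close>

text \<open>The scalars being Laurent series in \<open>\<epsilon>\<close>, \<open>u\<close> may contain finitely many negative powers
  of \<open>\<epsilon>\<close> in each coefficient: \<open>u = w\<^sub>1(x) - w\<^sub>1(x + \<epsilon>)\<close> does for a general tau-function.  The condition \<open>v = v\<^sub>1 \<epsilon> + v\<^sub>2 \<epsilon>\<^sup>2 + \<dots>\<close> is imposed
  at \<open>q\<^sub>n\<^sub>,\<^sub>1 = 0\<close>, which is what makes \<open>exp v\<close> well defined; it is not preserved by the flows when
  \<open>u\<close> has a non-constant term of order \<open>\<epsilon>\<^sup>0\<close>, since \<open>\<partial>\<^sub>0\<^sub>,\<^sub>1 v = (u(x) - u(x - \<epsilon>)) / \<epsilon>\<close>.\<close>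

definition lax_operator :: "complex \<Rightarrow> dop \<Rightarrow> bool" where
  "lax_operator Q L \<longleftrightarrow> (\<exists>u v. (\<forall>k\<le>0. mcoeff v {#} $$ k = 0) \<and>
     L = (\<lambda>k. if k = 1 then 1 else if k = 0 then u
              else if k = -1 then cconst Q * cexp v else 0))"

definition dressing_operators :: "complex \<Rightarrow> dop \<Rightarrow> dop \<Rightarrow> dop \<Rightarrow> bool" where
  "dressing_operators Q L PL PR \<longleftrightarrow>
     (\<forall>k>0. PL k = 0) \<and> PL 0 = 1 \<and>
     (\<forall>k>0. PR k = 0) \<and> PR 0 dvd 1 \<and>
     L = PL \<bullet>\<^sub>d dop_Lambda \<bullet>\<^sub>d dop_inv PL \<and>
     L = dop_sharp Q (dop_inv PR \<bullet>\<^sub>d dop_Lambda \<bullet>\<^sub>d PR)"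

text \<open>\<open>L\<^sup>n\<^sup>+\<^sup>1 / (\<epsilon> (n+1)!)\<close>\<close>

definition toda_ham :: "dop \<Rightarrow> nat \<Rightarrow> dop" where
  "toda_ham L n = (\<lambda>k. cconst (1 / fact (n + 1)) * ceps_inv * dop_power L (n + 1) k)"

definition wave_operators :: "complex \<Rightarrow> dop \<Rightarrow> dop \<Rightarrow> dop \<Rightarrow> bool" where
  "wave_operators Q L PL PR \<longleftrightarrow>
     lax_operator Q L \<and> dressing_operators Q L PL PR \<and>
     (\<forall>n. dop_deriv n PL = - (dop_minus (toda_ham L n) \<bullet>\<^sub>d PL)) \<and>
     (\<forall>n. dop_deriv n (dop_sharp Q PR) = dop_plus (toda_ham L n) \<bullet>\<^sub>d dop_sharp Q PR)"


section \<open>Tau-functions\<close>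

text \<open>A sequence \<open>F\<close> stands for \<open>\<Sum>\<^sub>j F\<^sub>j \<lambda>\<^sup>-\<^sup>j\<close>.  The operator below is
  \<open>\<Sum>\<^sub>n n! \<lambda>\<^sup>-\<^sup>n\<^sup>-\<^sup>1 \<epsilon> \<partial>\<^sub>n\<^sub>,\<^sub>1\<close>; it raises the order in \<open>\<lambda>\<^sup>-\<^sup>1\<close>, so that only its powers \<open>k \<le> j\<close>
  contribute to the \<open>j\<close>-th coefficient of its exponential.\<close>

definition miwa_op :: "(nat \<Rightarrow> cfun) \<Rightarrow> nat \<Rightarrow> cfun" where
  "miwa_op F = (\<lambda>j. \<Sum>n<j. cconst (fact n) * ceps * mps_deriv n (F (j - n - 1)))"

definition miwa_exp :: "complex \<Rightarrow> cfun \<Rightarrow> nat \<Rightarrow> cfun" where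
  "miwa_exp s f = (\<lambda>j. \<Sum>k\<le>j. cconst (s ^ k / fact k) *
     (miwa_op ^^ k) (\<lambda>i. if i = 0 then f else 0) j)"

definition wL :: "cfun \<Rightarrow> nat \<Rightarrow> cfun" where
  "wL \<tau> k = ring_quot (miwa_exp (- 1) (cshift (- 1/2) \<tau>) k) (cshift (- 1/2) \<tau>)"

definition wR :: "cfun \<Rightarrow> nat \<Rightarrow> cfun" where
  "wR \<tau> k = ring_quot (miwa_exp 1 (cshift (1/2) \<tau>) k) (cshift (- 1/2) \<tau>)"

definition tau_PL :: "cfun \<Rightarrow> dop" where
  "tau_PL \<tau> = (\<lambda>k. if k \<le> 0 then wL \<tau> (nat (- k)) else 0)"

text \<open>\<open>\<Lambda>\<^sup>k w = w(x + k\<epsilon>) \<Lambda>\<^sup>k\<close> brings \<open>\<Sum>\<^sub>k \<Lambda>\<^sup>-\<^sup>k w\<^sub>k\<close> to normal form.\<close>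

definition tau_PR :: "cfun \<Rightarrow> dop" where
  "tau_PR \<tau> = (\<lambda>k. if k \<le> 0 then cshift (of_int k) (wR \<tau> (nat (- k))) else 0)"

definition toda_tau_function :: "complex \<Rightarrow> cfun \<Rightarrow> bool" where
  "toda_tau_function Q \<tau> \<longleftrightarrow> (\<exists>L. wave_operators Q L (tau_PL \<tau>) (tau_PR \<tau>))"


section \<open>Vertex operators and the bilinear expression\<close>

text \<open>Elements of \<open>lcf fls\<close> are Laurent series in \<open>\<lambda>\<^sup>-\<^sup>1\<close>: the coefficient with index \<open>j\<close> belongs to
  \<open>\<lambda>\<^sup>-\<^sup>j\<close>, and \<open>fls_X = \<lambda>\<^sup>-\<^sup>1\<close>, \<open>fls_X_inv = \<lambda>\<close>.\<close>

type_synonym lam = "lcf fls"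

definition lam_const :: "complex \<Rightarrow> lam" where
  "lam_const c = fls_const (lconst c)"

text \<open>A series in \<open>\<lambda>\<^sup>-\<^sup>1\<close> over \<open>cfun\<close>, read as a power series in the \<open>q\<^sub>n\<^sub>,\<^sub>1\<close> over \<open>lam\<close>.\<close>

definition lam_series :: "(nat \<Rightarrow> cfun) \<Rightarrow> (nat, lam) mps" where
  "lam_series F = Abs_mps (\<lambda>M. Abs_fls (\<lambda>j. if j \<ge> 0 then mcoeff (F (nat j)) M else 0))"

text \<open>\<open>\<Sum>\<^sub>n \<lambda>\<^sup>n\<^sup>+\<^sup>1 / (n+1)! q\<^sub>n\<^sub>,\<^sub>1 / \<epsilon>\<close>\<close>

definition vertex_exponent :: "(nat, lam) mps" where
  "vertex_exponent = Abs_mps (\<lambda>M. Sum_any (\<lambda>n. if M = {#n#}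
     then lam_const (1 / fact (n + 1)) * fls_const fls_X_inv * fls_X_inv ^ (n + 1) else 0))"

text \<open>The exponent has no constant term, so powers \<open>k > size M\<close> do not contribute.\<close>

definition vertex_multiplier :: "complex \<Rightarrow> (nat, lam) mps" where
  "vertex_multiplier s = Abs_mps (\<lambda>M. \<Sum>k\<le>size M.
     lam_const (s ^ k / fact k) * mcoeff (vertex_exponent ^ k) M)"

text \<open>\<open>vertex 1\<close> and \<open>vertex (-1)\<close> are the vertex operators with superscripts \<open>\<beta>\<close> and \<open>-\<beta>\<close>.\<close>

definition vertex :: "complex \<Rightarrow> cfun \<Rightarrow> (nat, lam) mps" where
  "vertex s \<tau> = vertex_multiplier (s / 2) * lam_series (miwa_exp (- s) (cshift (- s / 2) \<tau>))"

definition lam_shift :: "complex \<Rightarrow> lam \<Rightarrow> lam" where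
  "lam_shift c a = Abs_fls (\<lambda>j. lshift c (a $$ j))"

text \<open>Substitution of \<open>x\<^sub>n + s y\<^sub>n\<close> for \<open>q\<^sub>n\<^sub>,\<^sub>1\<close>, where \<open>x\<^sub>n\<close>, \<open>y\<^sub>n\<close> are the variables \<open>Inl n\<close>, \<open>Inr n\<close>.\<close>

definition subst_xy :: "int \<Rightarrow> (nat, lam) mps \<Rightarrow> (nat + nat, lam) mps" where
  "subst_xy s F = Abs_mps (\<lambda>N. Sum_any (\<lambda>M.
     mcoeff F M * mcoeff (\<Prod>n\<in>#M. mps_var (Inl n) + of_int s * mps_var (Inr n)) N))"

text \<open>\<open>F(q') G(q'')\<close> for \<open>q' = x + y\<close>, \<open>q'' = x - y\<close> with \<open>y\<^sub>0\<^sub>0 = m\<epsilon>/2\<close>; the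
  remaining real variable is \<open>x\<^sub>0\<^sub>0\<close>.\<close>

definition tensor_at :: "int \<Rightarrow> (nat, lam) mps \<Rightarrow> (nat, lam) mps \<Rightarrow> (nat + nat, lam) mps" where
  "tensor_at m F G =
     subst_xy 1 (mps_map (lam_shift (of_int m / 2)) F) *
     subst_xy (- 1) (mps_map (lam_shift (- of_int m / 2)) G)"

definition lam_power :: "complex \<Rightarrow> int \<Rightarrow> lam" where
  "lam_power sqrtQ m = lam_const (sqrtQ powi (- m)) * fls_X_intpow (- m)"

text \<open>The series multiplying \<open>d\<lambda>\<close>, including the factor \<open>1/\<lambda>\<close>.\<close>

definition hirota :: "complex \<Rightarrow> int \<Rightarrow> cfun \<Rightarrow> (nat + nat, lam) mps" where
  "hirota sqrtQ m \<tau> = mps_const fls_X *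
     (mps_const (lam_power sqrtQ m) * tensor_at m (vertex 1 \<tau>) (vertex (- 1) \<tau>)
      - mps_const (lam_power sqrtQ (- m)) * tensor_at m (vertex (- 1) \<tau>) (vertex 1 \<tau>))"

text \<open>For every monomial \<open>B\<close> in \<open>y\<close> the coefficient, whose own coefficients are power series in the
  \<open>x\<^sub>n\<close> (monomials \<open>A\<close>), is a polynomial in \<open>\<lambda>\<close>.\<close>

definition regular_in_lambda :: "(nat + nat, lam) mps \<Rightarrow> bool" where
  "regular_in_lambda E \<longleftrightarrow> (\<forall>B. \<exists>d::nat. \<forall>A j.
     mcoeff E (image_mset Inl A + image_mset Inr B) $$ j \<noteq> 0 \<longrightarrow> - int d \<le> j \<and> j \<le> 0)"

end

theory Submission
  imports Defs
begin

text \<open>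
  Let \<open>P\<^sub>L\<close>, \<open>P\<^sub>R\<close> be the operators attached to \<open>\<tau>\<close>, \<open>L = P\<^sub>L \<Lambda> P\<^sub>L\<^sup>-\<^sup>1\<close>, \<open>H\<^sub>n = L\<^sup>n\<^sup>+\<^sup>1 / (\<epsilon> (n+1)!)\<close>, and
  let \<open>w\<^sub>0\<close> be the leading coefficient of \<open>P\<^sub>R\<close>.

  \<^emph>\<open>The bilinear expression consists of operator products.\<close>  Up to the factor \<open>\<tau>(x - \<epsilon>/2)\<close> the vertex
  operators turn \<open>\<tau>\<close> into the symbols of \<open>P\<^sub>L\<close> and \<open>P\<^sub>R\<close>, multiplied by exponentials of
  \<open>\<Sum>\<^sub>n \<lambda>\<^sup>n\<^sup>+\<^sup>1 q\<^sub>n\<^sub>,\<^sub>1 / (2 \<epsilon> (n+1)!)\<close>.  The product of a symbol at \<open>x\<close> with another one at \<open>x - m\<epsilon>\<close> has as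
  coefficient of \<open>\<lambda>\<^sup>-\<^sup>m\<close> the coefficient of \<open>\<Lambda>\<^sup>-\<^sup>m\<close> in the product of the two operators, and the second
  term of the expression is obtained in the same way after the antiinvolution \<open>#\<close>.  An exponential
  changes the derivative \<open>\<partial>\<^sub>n\<^sub>,\<^sub>1\<close> of a symbol into \<open>\<nabla>\<^sub>n = \<partial>\<^sub>n\<^sub>,\<^sub>1 \<plusminus> \<lambda>\<^sup>n\<^sup>+\<^sup>1 / (2 \<epsilon> (n+1)!)\<close>.  Expanding at
  \<open>y = 0\<close> one finds that regularity for all \<open>m\<close> means that
  \<open>(\<nabla>\<^sup>\<alpha> P\<^sub>L) \<Lambda>\<^sup>i (\<nabla>\<^sup>\<beta> P\<^sub>R)\<close> and \<open>(\<nabla>\<^sup>\<beta> P\<^sub>L) \<Lambda>\<^sup>i (\<nabla>\<^sup>\<alpha> P\<^sub>R)\<close>, up to that factor, are exchanged by \<open>#\<close>, for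
  all \<open>i \<ge> 0\<close> and all multi-indices \<open>\<alpha>\<close>, \<open>\<beta>\<close>.  This is the content of \<open>bilin_symb_regular_iff\<close>,
  \<open>hirota_imp_adj\<close> and \<open>adj_imp_hirota\<close>; as \<open>#\<close> commutes with \<open>\<partial>\<^sub>n\<^sub>,\<^sub>1\<close>, the relations with \<open>\<beta> = 0\<close>
  imply the others.

  \<^emph>\<open>From the bilinear equations to the hierarchy.\<close>  The operator \<open>P\<^sub>L P\<^sub>R\<close> contains no positive
  powers of \<open>\<Lambda>\<close>, its image under \<open>#\<close> no negative ones; so the relation of order zero with \<open>i = 0\<close>
  gives \<open>P\<^sub>L P\<^sub>R = w\<^sub>0\<close>, and the other ones say that all \<open>L\<^sup>i w\<^sub>0\<close> are invariant under \<open>#\<close>.  Hence \<open>L\<close> is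
  tridiagonal and \<open>P\<^sub>L\<close>, \<open>P\<^sub>R\<close> are dressing operators for it.  The negative and the nonnegative powers
  of \<open>\<Lambda>\<close> in the relation of first order are the two evolution equations (\<open>wave_L\<close>, \<open>wave_R\<close>).  The
  lowest coefficient of \<open>L\<close> is \<open>Q\<close> times a quotient of shifts of \<open>\<tau>\<close>, which is \<open>1 + O(\<epsilon>)\<close> and hence
  an exponential (\<open>exists_log\<close>).

  \<^emph>\<open>From the hierarchy to the bilinear equations.\<close>  By the evolution equations \<open>P\<^sub>L\<close> and \<open>P\<^sub>R\<^sup>#\<close> solve
  one and the same linear system \<open>\<nabla>\<^sub>n P = ((H\<^sub>n)\<^sub>+ - (H\<^sub>n)\<^sub>-) P / 2\<close>, so that \<open>\<nabla>\<^sup>\<alpha>\<close> acts on both as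
  multiplication by one finite sum \<open>Z\<close> of powers of \<open>\<Lambda>\<close> (\<open>nabs_operators\<close>).  If moreover \<open>P\<^sub>L P\<^sub>R = w\<^sub>0\<close>, the bilinear
  relations reduce to the invariance of \<open>P\<^sub>L \<Lambda>\<^sup>i P\<^sub>R = L\<^sup>i w\<^sub>0\<close>, and for this it is enough that the
  tridiagonal operator \<open>L w\<^sub>0\<close> is invariant.

  The equation \<open>P\<^sub>L P\<^sub>R = w\<^sub>0\<close> is the delicate point: the dressing and evolution equations leave room for
  a series in \<open>\<Lambda>\<^sup>-\<^sup>1\<close> with constant coefficients between \<open>P\<^sub>L P\<^sub>R\<close> and \<open>w\<^sub>0\<close>, and only the formulas
  through \<open>\<tau>\<close> exclude it.  Let \<open>M = exp (\<Sum>\<^sub>n n! \<mu>\<^sup>-\<^sup>n\<^sup>-\<^sup>1 \<epsilon> \<partial>\<^sub>n\<^sub>,\<^sub>1)\<close>.  Solving the evolution equation of \<open>P\<^sub>L\<close>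
  along this shift gives \<open>M(P\<^sub>L) (1 - \<Lambda>/\<mu>)\<^sup>-\<^sup>1 = Y P\<^sub>L\<close>, where \<open>Y\<close> contains only nonnegative powers
  of \<open>\<Lambda>\<close> and its coefficient of \<open>\<Lambda>\<^sup>0\<close>, multiplied by \<open>w\<^sub>0\<close>, is \<open>M(w\<^sub>0)\<close>.  Let \<open>w\<close> be the symbol of
  \<open>P\<^sub>L\<close> and \<open>w'\<close> that of \<open>P\<^sub>L\<^sup>-\<^sup>1 w\<^sub>0\<close>.  The coefficient of \<open>\<Lambda>\<^sup>0\<close> in
  \<open>M(P\<^sub>L) (1 - \<Lambda>/\<mu>)\<^sup>-\<^sup>1 P\<^sub>L\<^sup>-\<^sup>1 w\<^sub>0 = Y w\<^sub>0\<close> reads \<open>M(w)(\<mu>) w'(\<mu>) = M(w\<^sub>0)\<close> (\<open>miwa_relation\<close>).  Since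
  \<open>w\<close> and \<open>w\<^sub>0\<close> are quotients formed from \<open>\<tau>\<close> and \<open>M\<close> is multiplicative, this
  determines \<open>w'\<close>, and the result is the formula that defines \<open>P\<^sub>R\<close> (\<open>PR_Rt\<close>).
\<close>

section \<open>Ring morphisms, derivations and torsion\<close>

locale ring_morphism =
  fixes h :: "'a::comm_ring_1 \<Rightarrow> 'b::comm_ring_1"
  assumes add: "h (x + y) = h x + h y"
    and mult: "h (x * y) = h x * h y"
    and one: "h 1 = 1"
begin

lemma zero [simp]: "h 0 = 0"
  using add[of 0 0] by simp

lemma sum: "h (sum f A) = (\<Sum>i\<in>A. h (f i))"
  by (induction A rule: infinite_finite_induct) (auto simp: add)

lemma uminus: "h (- x) = - h x"
  using add[of x "- x"] by (simp add: add_eq_0_iff2)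

lemma diff: "h (x - y) = h x - h y"
  using add[of x "- y"] by (simp add: uminus)

lemma power: "h (x ^ n) = h x ^ n"
  by (induction n) (auto simp: one mult)

lemma of_nat: "h (of_nat n) = of_nat n"
  by (induction n) (auto simp: one add)

end

locale ring_derivation =
  fixes d :: "'a::comm_ring_1 \<Rightarrow> 'a"
  assumes add: "d (x + y) = d x + d y"
    and mult: "d (x * y) = d x * y + x * d y"
begin

lemma zero [simp]: "d 0 = 0"
  using add[of 0 0] by simp

lemma one [simp]: "d 1 = 0"
  using mult[of 1 1] by simp

lemma sum: "d (sum f A) = (\<Sum>i\<in>A. d (f i))"
  by (induction A rule: infinite_finite_induct) (auto simp: add)

lemma uminus: "d (- x) = - d x"
  using add[of x "- x"] by (simp add: add_eq_0_iff2)

lemma diff: "d (x - y) = d x - d y"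
  using add[of x "- y"] by (simp add: uminus)

lemma power: "d (x ^ Suc n) = of_nat (Suc n) * x ^ n * d x"
proof (induction n)
  case (Suc n)
  show ?case
    by (subst power_Suc) (simp only: mult Suc, simp add: algebra_simps)
qed simp

lemma iter_zero [simp]: "(d ^^ n) 0 = 0"
  by (induction n) auto

lemma iter_add: "(d ^^ n) (x + y) = (d ^^ n) x + (d ^^ n) y"
  by (induction n) (auto simp: add)

lemma iter_mult: "(d ^^ n) (x * y) = (\<Sum>k\<le>n. of_nat (n choose k) * (d ^^ k) x * (d ^^ (n - k)) y)"
proof (induction n)
  case (Suc n)
  let ?f = "\<lambda>k. (d ^^ k) x" and ?g = "\<lambda>k. (d ^^ k) y"
  have c: "d (of_nat m) = 0" for m
    by (induction m) (auto simp: add)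
  have s1: "(\<Sum>k\<le>n. of_nat (n choose k) * ?f k * ?g (Suc n - k))
      = ?f 0 * ?g (Suc n) + (\<Sum>k\<le>n. of_nat (n choose Suc k) * ?f (Suc k) * ?g (n - k))"
  proof -
    have "(\<Sum>k\<le>n. of_nat (n choose k) * ?f k * ?g (Suc n - k))
        = (\<Sum>k\<le>Suc n. of_nat (n choose k) * ?f k * ?g (Suc n - k))"
      by (simp add: binomial_eq_0)
    also have "\<dots> = ?f 0 * ?g (Suc n) + (\<Sum>k\<le>n. of_nat (n choose Suc k) * ?f (Suc k) * ?g (n - k))"
      by (subst sum.atMost_Suc_shift) simp
    finally show ?thesis .
  qed
  have "(d ^^ Suc n) (x * y) = (\<Sum>k\<le>n. d (of_nat (n choose k) * ?f k * ?g (n - k)))"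
    using Suc by (simp add: sum)
  also have "\<dots> = (\<Sum>k\<le>n. of_nat (n choose k) * ?f (Suc k) * ?g (n - k))
      + (\<Sum>k\<le>n. of_nat (n choose k) * ?f k * ?g (Suc n - k))"
    unfolding sum.distrib[symmetric]
    by (intro sum.cong) (auto simp: mult c Suc_diff_le)
  also have "\<dots> = ?f 0 * ?g (Suc n) +
      (\<Sum>k\<le>n. of_nat (Suc n choose Suc k) * ?f (Suc k) * ?g (n - k))"
    unfolding s1 by (simp add: algebra_simps sum.distrib)
  also have "\<dots> = (\<Sum>k\<le>Suc n. of_nat (Suc n choose k) * ?f k * ?g (Suc n - k))"
    by (subst sum.atMost_Suc_shift) simp
  finally show ?case .
qed simp

end

text \<open>The ring of smooth functions has zero divisors, and so have all rings of coefficients built on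
  it.  What uniqueness of solutions of formal differential equations needs is only that integers can
  be cancelled.\<close>

class torsion_free_ring = comm_ring_1 +
  assumes of_nat_mult_eq_0D: "of_nat (Suc n) * x = 0 \<Longrightarrow> x = 0"
begin

lemma of_nat_mult_cancel: "of_nat (Suc n) * x = of_nat (Suc n) * y \<Longrightarrow> x = y"
  using of_nat_mult_eq_0D[of n "x - y"] by (simp add: algebra_simps)

end

section \<open>Smooth functions\<close>

lemma smf_fun_simps [simp]:
  "smf_fun 0 x = 0" "smf_fun 1 x = 1" "smf_fun (f + g) x = smf_fun f x + smf_fun g x"
  "smf_fun (f * g) x = smf_fun f x * smf_fun g x" "smf_fun (- f) x = - smf_fun f x"
  "smf_fun (f - g) x = smf_fun f x - smf_fun g x" "smf_fun (smf_const c) x = c"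
  by (simp_all add: zero_smf.rep_eq one_smf.rep_eq plus_smf.rep_eq times_smf.rep_eq
      uminus_smf.rep_eq minus_smf.rep_eq smf_const.rep_eq)

lemma smf_eqI: "(\<And>x. smf_fun f x = smf_fun g x) \<Longrightarrow> f = g"
  by (simp add: fun_eq_iff flip: smf_fun_inject)

lemma smf_fun_of_nat [simp]: "smf_fun (of_nat n) x = of_nat n"
  by (induction n) auto

instance smf :: torsion_free_ring
proof
  fix n and x :: smf
  assume *: "of_nat (Suc n) * x = 0"
  show "x = 0"
  proof (rule smf_eqI)
    fix y
    from * have "smf_fun (of_nat (Suc n) * x) y = 0" by simp
    then show "smf_fun x y = smf_fun 0 y"
      using of_nat_neq_0[of n, where 'a = complex] by simp
  qed
qed

interpretation smf_const: ring_morphism smf_const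
  by unfold_locales (auto intro!: smf_eqI)

lemma differentiable_smf_fun: "smf_fun f differentiable (at x)"
  using smf_fun[of f] by (auto simp: smooth_def dest: spec[of _ 0])

interpretation smf_deriv: ring_derivation smf_deriv
proof
  fix f g :: smf
  show "smf_deriv (f + g) = smf_deriv f + smf_deriv g"
    by (rule smf_eqI)
       (simp add: smf_deriv.rep_eq plus_smf.rep_eq vderiv_def vector_derivative_add_at
         differentiable_smf_fun)
  show "smf_deriv (f * g) = smf_deriv f * g + f * smf_deriv g"
    by (rule smf_eqI)
       (simp add: smf_deriv.rep_eq times_smf.rep_eq vderiv_def vector_derivative_mult_at
         differentiable_smf_fun)
qed

lemma smf_deriv_const [simp]: "smf_deriv (smf_const c) = 0"
  by (rule smf_eqI) (simp add: smf_deriv.rep_eq smf_const.rep_eq vderiv_def)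

lemma smf_deriv_const_mult: "(smf_deriv ^^ n) (smf_const c * f) = smf_const c * (smf_deriv ^^ n) f"
  by (induction n) (auto simp: smf_deriv.mult)

text \<open>By induction on the order, from \<open>(1/f)' = - f' / f\<^sup>2\<close>.\<close>

lemma kdiff_inverse:
  assumes "kdiff n f" "\<And>x. f x \<noteq> 0"
  shows "kdiff n (\<lambda>x. inverse (f x))"
  using assms(1)
proof (induction n)
  case (Suc n)
  have f: "\<And>x. f differentiable (at x)"
    using Suc.prems by (simp add: kdiff_Suc)
  have i: "((\<lambda>x. inverse (f x)) has_vector_derivative - (inverse (f x) * vderiv f x * inverse (f x))) (at x)" for x
  proof -
    have fd: "(f has_derivative (\<lambda>h. h *\<^sub>R vderiv f x)) (at x)"
      using vector_derivative_works[THEN iffD1, OF f[of x]]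
      by (simp add: vderiv_def has_vector_derivative_def)
    show ?thesis
      using has_derivative_compose[OF fd has_derivative_inverse'[OF assms(2)]]
      by (simp add: has_vector_derivative_def scaleR_conv_of_real algebra_simps)
  qed
  have d: "vderiv (\<lambda>x. inverse (f x)) = (\<lambda>x. - (inverse (f x) * vderiv f x * inverse (f x)))"
    using i by (auto simp: vderiv_def intro: vector_derivative_at)
  have "kdiff n (\<lambda>x. inverse (f x))"
    using Suc by (simp add: kdiff_mono[of "Suc n"])
  then have "kdiff n (\<lambda>x. - (inverse (f x) * vderiv f x * inverse (f x)))"
    using Suc.prems by (intro kdiff_uminus kdiff_mult) (auto simp: kdiff_Suc)
  then show ?case
    unfolding kdiff_Suc d using i differentiableI_vector by blast
qed simp

lemma smf_unit:
  assumes "\<And>x. smf_fun f x \<noteq> 0"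
  obtains g where "f * g = 1"
proof -
  have "smooth (\<lambda>x. inverse (smf_fun f x))"
    using smf_fun[of f] assms by (auto simp: smooth_iff_kdiff intro!: kdiff_inverse)
  then have "f * Abs_smf (\<lambda>x. inverse (smf_fun f x)) = 1"
    using assms by (intro smf_eqI) (simp add: Abs_smf_inverse)
  then show ?thesis using that by blast
qed

section \<open>Laurent series\<close>

lemma Abs_fls_nth: "(\<And>k. k < N \<Longrightarrow> f k = 0) \<Longrightarrow> Abs_fls f $$ n = f n"
  by (rule nth_Abs_fls_lower_bound[of N]) auto

text \<open>Coefficients of products are needed with index sets that do not depend on the exact orders of
  the factors, so that several such sums can be interchanged.\<close>

lemma fls_mult_nth_set:
  fixes f g :: "'a::semiring_0 fls"
  assumes "\<And>i. i < N \<Longrightarrow> f $$ i = 0" "\<And>i. i < M \<Longrightarrow> g $$ i = 0"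
    and "finite A" "{N..n - M} \<subseteq> A"
  shows "(f * g) $$ n = (\<Sum>i\<in>A. f $$ i * g $$ (n - i))"
proof (cases "f = 0 \<or> g = 0")
  case False
  have "N \<le> fls_subdegree f" "M \<le> fls_subdegree g"
    using False assms(1,2) fls_subdegree_geI by blast+
  then have "{fls_subdegree f..n - fls_subdegree g} \<subseteq> A"
    using assms(4) by force
  then show ?thesis
    unfolding fls_times_nth(2) using assms(3)
    by (intro sum.mono_neutral_left) auto
qed auto

instance fls :: (torsion_free_ring) torsion_free_ring
proof
  fix n and x :: "'a fls"
  assume *: "of_nat (Suc n) * x = 0"
  have "of_nat (Suc n) * x $$ k = (of_nat (Suc n) * x) $$ k" for k
    by (simp only: fls_of_nat fls_mult_const_nth)
  then show "x = 0"
    using * by (intro fls_zero_eqI) (metis fls_zero_nth of_nat_mult_eq_0D)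
qed

interpretation fls_const: ring_morphism "fls_const :: 'a::comm_ring_1 \<Rightarrow> 'a fls"
  by unfold_locales (auto simp: fls_plus_const)

definition fls_map :: "('a::zero \<Rightarrow> 'b::zero) \<Rightarrow> 'a fls \<Rightarrow> 'b fls" where
  "fls_map h f = Abs_fls (\<lambda>k. h (f $$ k))"

lemma fls_map_nth: "h 0 = 0 \<Longrightarrow> fls_map h f $$ k = h (f $$ k)"
  unfolding fls_map_def by (rule Abs_fls_nth[of "fls_subdegree f"]) simp

lemma ring_morphism_fls_map:
  assumes "ring_morphism h"
  shows "ring_morphism (fls_map h)"
proof -
  interpret h: ring_morphism h by fact
  show ?thesis
  proof
    fix f g
    show "fls_map h (f + g) = fls_map h f + fls_map h g"
      by (rule fls_eqI) (simp add: fls_map_nth h.add)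
    show "fls_map h (f * g) = fls_map h f * fls_map h g"
    proof (rule fls_eqI)
      fix n
      show "fls_map h (f * g) $$ n = (fls_map h f * fls_map h g) $$ n"
        by (subst fls_mult_nth_set[of "fls_subdegree f" _ "fls_subdegree g" _
              "{fls_subdegree f..n - fls_subdegree g}"])
           (auto simp: fls_map_nth fls_times_nth(2) h.sum h.mult)
    qed
    show "fls_map h 1 = 1"
      by (rule fls_eqI) (simp add: fls_map_nth h.one)
  qed
qed

lemma ring_derivation_fls_map:
  assumes "ring_derivation d"
  shows "ring_derivation (fls_map d)"
proof -
  interpret d: ring_derivation d by fact
  show ?thesis
  proof
    fix f g
    show "fls_map d (f + g) = fls_map d f + fls_map d g"
      by (rule fls_eqI) (simp add: fls_map_nth d.add)
    show "fls_map d (f * g) = fls_map d f * g + f * fls_map d g"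
    proof (rule fls_eqI)
      fix n
      let ?A = "{fls_subdegree f..n - fls_subdegree g}"
      have 1: "(fls_map d f * g) $$ n = (\<Sum>i\<in>?A. d (f $$ i) * g $$ (n - i))"
        by (subst fls_mult_nth_set[of "fls_subdegree f" _ "fls_subdegree g" _ ?A])
           (auto simp: fls_map_nth)
      have 2: "(f * fls_map d g) $$ n = (\<Sum>i\<in>?A. f $$ i * d (g $$ (n - i)))"
        by (subst fls_mult_nth_set[of "fls_subdegree f" _ "fls_subdegree g" _ ?A])
           (auto simp: fls_map_nth)
      show "fls_map d (f * g) $$ n = (fls_map d f * g + f * fls_map d g) $$ n"
        by (simp only: fls_plus_nth 1 2 fls_map_nth[of d, OF d.zero] fls_times_nth(2)[of f g]
            d.sum d.mult sum.distrib)
    qed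
  qed
qed

lemma fls_unit:
  fixes f :: "'a::comm_ring_1 fls"
  assumes "f $$ fls_subdegree f * y = 1"
  obtains g where "f * g = 1"
proof -
  have "f * fls_right_inverse f y = 1"
    using assms by (intro fls_right_inverse) auto
  then show ?thesis using that by blast
qed

section \<open>Power series in infinitely many variables\<close>

lemma mcoeff_Abs_mps [simp]: "mcoeff (Abs_mps f) = f"
  by (simp add: Abs_mps_inverse)

lemma mps_eqI: "(\<And>M. mcoeff F M = mcoeff G M) \<Longrightarrow> F = G"
  by (simp add: fun_eq_iff flip: mcoeff_inject)

lemma mcoeff_simps [simp]:
  "mcoeff 0 M = 0" "mcoeff 1 M = (if M = {#} then 1 else 0)"
  "mcoeff (F + G) M = mcoeff F M + mcoeff G M" "mcoeff (F - G) M = mcoeff F M - mcoeff G M"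
  "mcoeff (- F) M = - mcoeff F M"
  by (simp_all add: zero_mps.rep_eq one_mps.rep_eq plus_mps.rep_eq minus_mps.rep_eq
      uminus_mps.rep_eq)

lemma mcoeff_mult: "mcoeff (F * G) M = (\<Sum>A | A \<subseteq># M. mcoeff F A * mcoeff G (M - A))"
  by (simp add: times_mps.rep_eq)

lemma mcoeff_mult_empty [simp]: "mcoeff (F * G) {#} = mcoeff F {#} * mcoeff G {#}"
  by (simp add: mcoeff_mult)

lemma mcoeff_sum: "mcoeff (sum f A) M = (\<Sum>i\<in>A. mcoeff (f i) M)"
  by (induction A rule: infinite_finite_induct) auto

lemma mcoeff_const [simp]: "mcoeff (mps_const a) M = (if M = {#} then a else 0)"
  by (simp add: mps_const_def)

lemma mcoeff_const_mult [simp]: "mcoeff (mps_const a * F) M = a * mcoeff F M"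
proof -
  have "mcoeff (mps_const a * F) M = (\<Sum>A | A \<subseteq># M. if A = {#} then a * mcoeff F M else 0)"
    unfolding mcoeff_mult by (intro sum.cong) auto
  then show ?thesis by (subst (asm) sum.delta[OF finite_submultisets]) simp
qed

interpretation mps_const: ring_morphism "mps_const :: 'a::comm_ring_1 \<Rightarrow> ('v, 'a) mps"
  by unfold_locales (auto intro!: mps_eqI)

lemma mcoeff_map [simp]: "mcoeff (mps_map h F) M = h (mcoeff F M)"
  by (simp add: mps_map_def)

lemma mps_map_const: "h 0 = 0 \<Longrightarrow> mps_map h (mps_const a) = mps_const (h a)"
  by (rule mps_eqI) simp

lemma ring_morphism_mps_map:
  assumes "ring_morphism h"
  shows "ring_morphism (mps_map h :: ('v, 'a::comm_ring_1) mps \<Rightarrow> ('v, 'b::comm_ring_1) mps)"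
proof -
  interpret h: ring_morphism h by fact
  show ?thesis
    by unfold_locales (auto intro!: mps_eqI simp: h.add h.one mcoeff_mult h.sum h.mult)
qed

instance mps :: (type, torsion_free_ring) torsion_free_ring
proof
  fix n and x :: "('a, 'b) mps"
  assume *: "of_nat (Suc n) * x = 0"
  have "of_nat (Suc n) * mcoeff x M = mcoeff (of_nat (Suc n) * x) M" for M
    by (simp only: mcoeff_const_mult flip: mps_const.of_nat)
  then show "x = 0"
    using * by (intro mps_eqI) (metis mcoeff_simps(1) of_nat_mult_eq_0D)
qed

lemma mcoeff_deriv [simp]:
  "mcoeff (mps_deriv v F) M = of_nat (count M v + 1) * mcoeff F (M + {#v#})"
  by (simp add: mps_deriv_def)

interpretation mps_deriv: ring_derivation "mps_deriv v :: ('v, 'a::comm_ring_1) mps \<Rightarrow> _"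
proof
  fix F G :: "('v, 'a) mps"
  show "mps_deriv v (F + G) = mps_deriv v F + mps_deriv v G"
    by (rule mps_eqI) (simp add: algebra_simps)
  show "mps_deriv v (F * G) = mps_deriv v F * G + F * mps_deriv v G"
  proof (rule mps_eqI)
    fix M
    let ?M = "M + {#v#}"
    let ?t = "\<lambda>A. mcoeff F A * mcoeff G (?M - A)"
    \<comment> \<open>Leibniz's rule: the multiplicity of \<open>v\<close> in \<open>M v\<close> is the sum of its multiplicities in the two factors.\<close>
    have *: "(\<Sum>A | A \<subseteq># ?M. of_nat (count A v) * f A)
        = (\<Sum>A | A \<subseteq># M. of_nat (count A v + 1) * f (A + {#v#}))" for f :: "'v multiset \<Rightarrow> 'a"
    proof -
      have "(\<Sum>A | A \<subseteq># ?M. of_nat (count A v) * f A)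
          = (\<Sum>A\<in>(\<lambda>A. A + {#v#}) ` {A. A \<subseteq># M}. of_nat (count A v) * f A)"
      proof (intro sum.mono_neutral_right finite_submultisets ballI)
        fix A assume A: "A \<in> {A. A \<subseteq># ?M} - (\<lambda>A. A + {#v#}) ` {A. A \<subseteq># M}"
        have "v \<notin># A"
        proof
          assume v: "v \<in># A"
          then have "A = (A - {#v#}) + {#v#}" by simp
          moreover have "A - {#v#} \<subseteq># M"
            using A by (simp add: subset_eq_diff_conv)
          ultimately show False using A by blast
        qed
        then show "of_nat (count A v) * f A = 0" by (simp add: not_in_iff)
      qed auto
      also have "\<dots> = (\<Sum>A | A \<subseteq># M. of_nat (count A v + 1) * f (A + {#v#}))"
        by (subst sum.reindex) (auto simp: inj_on_def)
      finally show ?thesis .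
    qed
    have "mcoeff (mps_deriv v (F * G)) M = (\<Sum>A | A \<subseteq># ?M. of_nat (count ?M v) * ?t A)"
      by (simp add: mcoeff_mult sum_distrib_left)
    also have "\<dots> = (\<Sum>A | A \<subseteq># ?M. of_nat (count A v) * ?t A + of_nat (count (?M - A) v) * ?t A)"
    proof (intro sum.cong refl)
      fix A assume "A \<in> {A. A \<subseteq># ?M}"
      then have "count ?M v = count A v + count (?M - A) v"
        using mset_subset_eq_count[of A ?M v] by simp
      then show "of_nat (count ?M v) * ?t A
          = of_nat (count A v) * ?t A + of_nat (count (?M - A) v) * ?t A"
        by (simp only: of_nat_add distrib_right)
    qed
    also have "\<dots> = (\<Sum>A | A \<subseteq># ?M. of_nat (count A v) * ?t A)
        + (\<Sum>A | A \<subseteq># ?M. of_nat (count A v) * ?t (?M - A))"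
    proof -
      have "(\<Sum>A | A \<subseteq># ?M. of_nat (count (?M - A) v) * ?t A)
          = (\<Sum>A | A \<subseteq># ?M. of_nat (count A v) * ?t (?M - A))"
        by (rule sum.reindex_bij_witness[where i = "\<lambda>A. ?M - A" and j = "\<lambda>A. ?M - A"])
           (auto simp: subset_mset.diff_diff_right)
      then show ?thesis by (simp only: sum.distrib)
    qed
    also have "\<dots> = mcoeff (mps_deriv v F * G + F * mps_deriv v G) M"
    proof -
      have "(\<Sum>A | A \<subseteq># M. of_nat (count A v + 1) * ?t (?M - (A + {#v#})))
          = (\<Sum>A | A \<subseteq># M. mcoeff F A * (of_nat (count (M - A) v + 1) * mcoeff G (M - A + {#v#})))"
      proof (rule sum.reindex_bij_witness[where i = "\<lambda>A. M - A" and j = "\<lambda>A. M - A"])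
        fix A assume "A \<in> {A. A \<subseteq># M}"
        then have "A \<subseteq># M" by simp
        then show "M - (M - A) = A" by (simp add: subset_mset.diff_diff_right)
        from \<open>A \<subseteq># M\<close> obtain B where B: "M = A + B" by (metis subset_mset.le_iff_add)
        show "mcoeff F (M - A) * (of_nat (count (M - (M - A)) v + 1) * mcoeff G (M - (M - A) + {#v#})) =
           of_nat (count A v + 1) * ?t (?M - (A + {#v#}))"
          by (simp add: B ac_simps)
      qed (auto simp: subset_mset.diff_diff_right)
      then show ?thesis
        by (simp only: * mcoeff_simps mcoeff_mult mcoeff_deriv) (simp add: algebra_simps)
    qed
    finally show "mcoeff (mps_deriv v (F * G)) M
        = mcoeff (mps_deriv v F * G + F * mps_deriv v G) M" .
  qed
qed

lemma mps_deriv_const [simp]: "mps_deriv v (mps_const a) = (0 :: ('v, 'a::comm_ring_1) mps)"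
  by (rule mps_eqI) simp

lemma mps_deriv_const_mult:
  "mps_deriv v (mps_const a * F) = mps_const a * mps_deriv v (F :: ('v, 'a::comm_ring_1) mps)"
  by (simp add: mps_deriv.mult)

lemma mps_deriv_commute:
  "mps_deriv v (mps_deriv u F) = mps_deriv u (mps_deriv v (F :: ('v, 'a::comm_ring_1) mps))"
  by (cases "u = v") (auto intro!: mps_eqI simp: algebra_simps add_mset_commute)

lemma mps_deriv_map:
  assumes "ring_morphism h"
  shows "mps_deriv v (mps_map h F) = mps_map h (mps_deriv v F)"
proof -
  interpret h: ring_morphism h by fact
  show ?thesis by (rule mps_eqI) (simp add: h.mult h.add h.one h.of_nat)
qed

text \<open>At the monomial \<open>M\<close> the equation for \<open>v\<close> expresses the coefficient of \<open>M v\<close>, up to an integer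
  factor, through that of \<open>M\<close>.\<close>

lemma mps_ode_unique:
  fixes F G :: "('v, 'a::torsion_free_ring) mps"
  assumes F: "\<And>v. mps_deriv v F = mps_const (c v) * F"
    and G: "\<And>v. mps_deriv v G = mps_const (c v) * G"
    and "mcoeff F {#} = mcoeff G {#}"
  shows "F = G"
proof (rule mps_eqI)
  fix M show "mcoeff F M = mcoeff G M"
  proof (induction M)
    case (add v M)
    have "of_nat (Suc (count M v)) * mcoeff F (add_mset v M) = c v * mcoeff F M"
      using arg_cong[OF F[of v], of "\<lambda>F. mcoeff F M"] by simp
    moreover have "of_nat (Suc (count M v)) * mcoeff G (add_mset v M) = c v * mcoeff G M"
      using arg_cong[OF G[of v], of "\<lambda>F. mcoeff F M"] by simp
    ultimately show ?case
      using add by (simp only:) (metis of_nat_mult_cancel)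
  qed (rule assms(3))
qed

text \<open>The inverse is built by recursion on the monomials, as for series in one variable.\<close>

lemma mps_unit:
  fixes F :: "('v, 'a::comm_ring_1) mps"
  assumes "mcoeff F {#} * y = 1"
  obtains G where "F * G = 1"
proof -
  let ?rel = "Wellfounded.measure size :: ('v multiset \<times> 'v multiset) set"
  define rec where "rec = (\<lambda>(r :: 'v multiset \<Rightarrow> 'a) M. if M = {#} then y
    else - y * (\<Sum>A | A \<subseteq># M \<and> A \<noteq> {#}. mcoeff F A * r (M - A)))"
  define g where "g = wfrec ?rel rec"
  have g: "g M = rec g M" for M
  proof -
    have "g M = rec (cut g ?rel M) M"
      unfolding g_def by (rule wfrec) simp
    also have "\<dots> = rec g M"
    proof -
      have "cut g ?rel M (M - A) = g (M - A)" if "A \<subseteq># M" "A \<noteq> {#}" for A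
      proof -
        have "size (M - A) < size M"
          using that size_mset_mono[OF that(1)] nonempty_has_size[of A]
          by (simp add: size_Diff_submset)
        then show ?thesis by (simp add: cut_apply)
      qed
      then show ?thesis by (auto simp: rec_def intro!: sum.cong)
    qed
    finally show ?thesis .
  qed
  have "F * Abs_mps g = 1"
  proof (rule mps_eqI)
    fix M :: "'v multiset"
    have *: "{A. A \<subseteq># M} = insert {#} {A. A \<subseteq># M \<and> A \<noteq> {#}}" by auto
    have fin: "finite {A. A \<subseteq># M \<and> A \<noteq> {#}}"
      by (rule finite_subset[OF _ finite_submultisets[of M]]) auto
    let ?s = "\<Sum>A | A \<subseteq># M \<and> A \<noteq> {#}. mcoeff F A * g (M - A)"
    have "mcoeff (F * Abs_mps g) M = mcoeff F {#} * g M + ?s"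
      unfolding mcoeff_mult * using fin by simp
    also have "\<dots> = mcoeff 1 M"
    proof (cases "M = {#}")
      case True
      then have "{A. A \<subseteq># M \<and> A \<noteq> {#}} = {}" by auto
      then show ?thesis using True g[of M] assms by (simp add: rec_def)
    next
      case False
      then have "g M = - y * ?s" using g[of M] by (simp add: rec_def)
      then have "mcoeff F {#} * g M = - (mcoeff F {#} * y) * ?s" by (simp add: mult.assoc)
      then show ?thesis using assms False by simp
    qed
    finally show "mcoeff (F * Abs_mps g) M = mcoeff 1 M" .
  qed
  then show ?thesis using that by blast
qed

lemma ring_quot_eq:
  assumes "b * c = (1 :: 'a::comm_ring_1)"
  shows "ring_quot a b = a * c"
proof -
  have "(THE c. b * c = 1) = c"
    using assms by (intro the_equality) (auto, metis mult.left_commute mult.right_neutral)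
  then show ?thesis by (simp add: ring_quot_def)
qed

section \<open>The shift operators\<close>

text \<open>The divided powers \<open>c\<^sup>j \<partial>\<^sup>j / j!\<close>, extended by zero to negative \<open>j\<close> so that sums need no
  careful bounds.\<close>

definition ddiff :: "complex \<Rightarrow> int \<Rightarrow> smf \<Rightarrow> smf" where
  "ddiff c j a = (if j < 0 then 0
     else smf_const (c ^ nat j / fact (nat j)) * (smf_deriv ^^ nat j) a)"

lemma ddiff_zero [simp]: "ddiff c j 0 = 0"
  by (simp add: ddiff_def)

lemma ddiff_neg: "j < 0 \<Longrightarrow> ddiff c j a = 0"
  by (simp add: ddiff_def)

lemma ddiff_add: "ddiff c j (a + b) = ddiff c j a + ddiff c j b"
  by (simp add: ddiff_def smf_deriv.iter_add algebra_simps)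

lemma ddiff_sum: "ddiff c j (sum f A) = (\<Sum>i\<in>A. ddiff c j (f i))"
  by (induction A rule: infinite_finite_induct) (auto simp: ddiff_add)

lemma sum_int_interval: "(\<Sum>p\<in>{0..int n}. f p) = (\<Sum>p\<le>n. f (int p))"
  by (rule sum.reindex_bij_witness[of _ int nat]) auto

lemma sum_restrict_interval:
  assumes "finite P" "{0..k} \<subseteq> P" "\<And>p. p < 0 \<or> k < p \<Longrightarrow> f p = 0"
  shows "(\<Sum>p\<in>P. f (p::int)) = (\<Sum>p\<in>{0..k}. f p)"
  using assms by (intro sum.mono_neutral_right) auto

lemma ddiff_mult:
  assumes "finite P" "{0..k} \<subseteq> P"
  shows "ddiff c k (a * b) = (\<Sum>p\<in>P. ddiff c p a * ddiff c (k - p) b)"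
proof -
  have "(\<Sum>p\<in>P. ddiff c p a * ddiff c (k - p) b) = (\<Sum>p\<in>{0..k}. ddiff c p a * ddiff c (k - p) b)"
    by (rule sum_restrict_interval) (use assms in \<open>auto simp: ddiff_neg\<close>)
  also have "\<dots> = ddiff c k (a * b)"
  proof (cases "k < 0")
    case False
    define n where "n = nat k"
    have k: "k = int n" using False by (simp add: n_def)
    \<comment> \<open>The binomial coefficients of Leibniz's rule are absorbed by the factorials.\<close>
    have coef: "smf_const (c ^ p / fact p) * smf_const (c ^ (n - p) / fact (n - p))
        = smf_const (c ^ n / fact n) * of_nat (n choose p)" if "p \<le> n" for p
    proof -
      have "c ^ p / fact p * (c ^ (n - p) / fact (n - p)) = c ^ n / fact n * of_nat (n choose p)"
        using that by (simp add: binomial_fact flip: power_add)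
      then show ?thesis by (metis smf_const.mult smf_const.of_nat)
    qed
    have "(\<Sum>p\<in>{0..k}. ddiff c p a * ddiff c (k - p) b)
        = (\<Sum>p\<le>n. smf_const (c ^ n / fact n) *
            (of_nat (n choose p) * (smf_deriv ^^ p) a * (smf_deriv ^^ (n - p)) b))"
      unfolding k sum_int_interval
    proof (intro sum.cong refl)
      fix p assume "p \<in> {..n}"
      then have p: "p \<le> n" by simp
      have "ddiff c (int p) a * ddiff c (int n - int p) b =
          (smf_const (c ^ p / fact p) * smf_const (c ^ (n - p) / fact (n - p))) *
          ((smf_deriv ^^ p) a * (smf_deriv ^^ (n - p)) b)"
        using p by (simp add: ddiff_def algebra_simps nat_diff_distrib)
      then show "ddiff c (int p) a * ddiff c (int n - int p) b = smf_const (c ^ n / fact n) *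
            (of_nat (n choose p) * (smf_deriv ^^ p) a * (smf_deriv ^^ (n - p)) b)"
        by (simp only: coef[OF p] mult.assoc)
    qed
    also have "\<dots> = ddiff c k (a * b)"
      by (simp add: k ddiff_def smf_deriv.iter_mult sum_distrib_left)
    finally show ?thesis .
  qed (simp add: ddiff_neg)
  finally show ?thesis by simp
qed

lemma ddiff_ddiff:
  assumes "finite P" "{0..k} \<subseteq> P"
  shows "(\<Sum>p\<in>P. ddiff c p (ddiff d (k - p) a)) = ddiff (c + d) k a"
proof -
  have "(\<Sum>p\<in>P. ddiff c p (ddiff d (k - p) a)) = (\<Sum>p\<in>{0..k}. ddiff c p (ddiff d (k - p) a))"
    by (rule sum_restrict_interval) (use assms in \<open>auto simp: ddiff_neg\<close>)
  also have "\<dots> = ddiff (c + d) k a"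
  proof (cases "k < 0")
    case False
    define n where "n = nat k"
    have k: "k = int n" using False by (simp add: n_def)
    have "(\<Sum>p\<in>{0..k}. ddiff c p (ddiff d (k - p) a))
        = (\<Sum>p\<le>n. smf_const (c ^ p / fact p * (d ^ (n - p) / fact (n - p))) * (smf_deriv ^^ n) a)"
      unfolding k sum_int_interval
    proof (intro sum.cong refl)
      fix p assume "p \<in> {..n}"
      then have p: "p \<le> n" by simp
      have "(smf_deriv ^^ p) ((smf_deriv ^^ (n - p)) a) = (smf_deriv ^^ n) a"
        using p by (metis comp_apply funpow_add le_add_diff_inverse)
      then show "ddiff c (int p) (ddiff d (int n - int p) a) =
          smf_const (c ^ p / fact p * (d ^ (n - p) / fact (n - p))) * (smf_deriv ^^ n) a"
        using p by (simp add: ddiff_def smf_deriv_const_mult nat_diff_distrib)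
          (simp flip: smf_const.mult mult.assoc)
    qed
    also have "\<dots> = smf_const (\<Sum>p\<le>n. c ^ p / fact p * (d ^ (n - p) / fact (n - p))) * (smf_deriv ^^ n) a"
      by (simp add: smf_const.sum sum_distrib_right)
    also have "(\<Sum>p\<le>n. c ^ p / fact p * (d ^ (n - p) / fact (n - p))) = (c + d) ^ n / fact n"
      unfolding binomial_ring sum_divide_distrib
      by (intro sum.cong) (auto simp: binomial_fact)
    finally show ?thesis by (simp add: k ddiff_def)
  qed (simp add: ddiff_neg)
  finally show ?thesis .
qed

text \<open>The substitution as a sum over the coefficients of the argument; the bounds may be enlarged at
  will because \<open>ddiff\<close> vanishes for negative orders.\<close>

lemma lshift_nth:
  assumes f: "\<And>i. i < N \<Longrightarrow> f $$ i = 0" and A: "finite A" "{N..k} \<subseteq> A"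
  shows "lshift c f $$ k = (\<Sum>a\<in>A. ddiff c (k - a) (f $$ a))"
proof -
  let ?t = "\<lambda>k j. smf_const (c ^ j / fact j) * (smf_deriv ^^ j) (f $$ (k - int j))"
  have t: "?t k j = 0" if "k - int j < N" for j k
    using f[OF that] by simp
  have "lshift c f $$ k = Sum_any (?t k)"
    unfolding lshift_def
  proof (rule Abs_fls_nth[of N])
    fix i assume "i < N"
    then have "?t i = (\<lambda>_. 0)" by (intro ext t) simp
    then show "Sum_any (?t i) = 0" by (simp only: Sum_any.neutral)
  qed
  also have "\<dots> = (\<Sum>j\<le>nat (k - N). ?t k j)"
  proof (rule Sum_any.expand_superset)
    show "{j. ?t k j \<noteq> 0} \<subseteq> {..nat (k - N)}"
    proof
      fix j assume "j \<in> {j. ?t k j \<noteq> 0}"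
      then have "\<not> k - int j < N" using t by blast
      then show "j \<in> {..nat (k - N)}" by simp
    qed
  qed simp
  also have "\<dots> = (\<Sum>a\<in>{k - int (nat (k - N))..k}. ddiff c (k - a) (f $$ a))"
    by (rule sum.reindex_bij_witness[of _ "\<lambda>a. nat (k - a)" "\<lambda>j. k - int j"])
       (auto simp: ddiff_def split: if_splits)
  also have "\<dots> = (\<Sum>a\<in>A. ddiff c (k - a) (f $$ a))"
  proof (cases "k < N")
    case True
    then have "(\<Sum>a\<in>A. ddiff c (k - a) (f $$ a)) = 0"
      using f by (intro sum.neutral) (metis ddiff_neg ddiff_zero diff_less_0_iff_less order_less_le_trans not_less)
    then show ?thesis using True f by simp
  next
    case False
    then show ?thesis
      using A f by (intro sum.mono_neutral_left) (auto simp: ddiff_neg not_le)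
  qed
  finally show ?thesis .
qed

lemma lshift_eq_0:
  assumes "\<And>i. i < N \<Longrightarrow> f $$ i = 0" "i < N"
  shows "lshift c f $$ i = 0"
  using lshift_nth[of N f "{}" i c] assms by simp

lemma lshift_leading:
  assumes "\<And>i. i < N \<Longrightarrow> f $$ i = 0"
  shows "lshift c f $$ N = f $$ N"
  using lshift_nth[of N f "{N}" N c] assms by (simp add: ddiff_def smf_const.one)

lemma lshift_const:
  assumes "\<And>k. smf_deriv (f $$ k) = 0"
  shows "lshift c f = f"
proof (rule fls_eqI)
  fix k
  have 0: "ddiff c j (f $$ a) = (if j = 0 then f $$ a else 0)" for j a
  proof (cases "j > 0")
    case True
    then obtain i where i: "nat j = Suc i"
      by (metis gr0_conv_Suc zero_less_nat_eq)
    have "(smf_deriv ^^ Suc i) (f $$ a) = 0"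
      by (simp only: funpow_Suc_right comp_apply assms smf_deriv.iter_zero)
    then show ?thesis using True by (simp add: ddiff_def i)
  qed (auto simp: ddiff_def smf_const.one)
  have "lshift c f $$ k = (\<Sum>a\<in>insert k {fls_subdegree f..k}. ddiff c (k - a) (f $$ a))"
    by (rule lshift_nth) auto
  also have "\<dots> = (\<Sum>a\<in>insert k {fls_subdegree f..k}. if a = k then f $$ k else 0)"
    by (intro sum.cong) (auto simp: 0)
  also have "\<dots> = f $$ k" by (subst sum.delta) auto
  finally show "lshift c f $$ k = f $$ k" .
qed

text \<open>Multiplicativity is Leibniz's rule for the divided powers: both sides are the sum over all
  \<open>a\<close>, \<open>b\<close> of \<open>ddiff c (n - a - b) (f\<^sub>a g\<^sub>b)\<close>, once all sums are extended to rectangles.\<close>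

interpretation lshift: ring_morphism "lshift c"
proof
  fix f g :: lcf
  let ?N = "fls_subdegree f" and ?M = "fls_subdegree g"
  show "lshift c 1 = 1"
    by (rule lshift_const) simp
  show "lshift c (f + g) = lshift c f + lshift c g"
  proof (rule fls_eqI)
    fix n
    let ?K = "min ?N ?M"
    have *: "lshift c h $$ n = (\<Sum>a\<in>{?K..n}. ddiff c (n - a) (h $$ a))"
      if "\<And>i. i < ?K \<Longrightarrow> h $$ i = 0" for h
      by (rule lshift_nth[of ?K]) (use that in auto)
    show "lshift c (f + g) $$ n = (lshift c f + lshift c g) $$ n"
      by (simp add: * ddiff_add sum.distrib)
  qed
  show "lshift c (f * g) = lshift c f * lshift c g"
  proof (rule fls_eqI)
    fix n
    let ?P = "{?N..n - ?M}" and ?B = "{?M..n - ?N}"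
    have "(lshift c f * lshift c g) $$ n = (\<Sum>p\<in>?P. lshift c f $$ p * lshift c g $$ (n - p))"
      by (rule fls_mult_nth_set[of ?N _ ?M])
         (auto intro: lshift_eq_0[of ?N] lshift_eq_0[of ?M])
    also have "\<dots> = (\<Sum>p\<in>?P. \<Sum>a\<in>?P. \<Sum>b\<in>?B.
        ddiff c (p - a) (f $$ a) * ddiff c (n - p - b) (g $$ b))"
    proof (intro sum.cong refl)
      fix p assume p: "p \<in> ?P"
      have "lshift c f $$ p = (\<Sum>a\<in>?P. ddiff c (p - a) (f $$ a))"
        by (rule lshift_nth[of ?N]) (use p in auto)
      moreover have "lshift c g $$ (n - p) = (\<Sum>b\<in>?B. ddiff c (n - p - b) (g $$ b))"
        by (rule lshift_nth[of ?M]) (use p in auto)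
      ultimately show "lshift c f $$ p * lshift c g $$ (n - p) = (\<Sum>a\<in>?P. \<Sum>b\<in>?B.
          ddiff c (p - a) (f $$ a) * ddiff c (n - p - b) (g $$ b))"
        by (simp add: sum_product)
    qed
    also have "\<dots> = (\<Sum>a\<in>?P. \<Sum>p\<in>?P. \<Sum>b\<in>?B.
        ddiff c (p - a) (f $$ a) * ddiff c (n - p - b) (g $$ b))"
      by (rule sum.swap)
    also have "\<dots> = (\<Sum>a\<in>?P. \<Sum>b\<in>?B. \<Sum>p\<in>?P.
        ddiff c (p - a) (f $$ a) * ddiff c (n - p - b) (g $$ b))"
      by (intro sum.cong refl sum.swap)
    also have "\<dots> = (\<Sum>a\<in>?P. \<Sum>b\<in>?B. ddiff c (n - a - b) (f $$ a * g $$ b))"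
    proof (intro sum.cong refl)
      fix a b assume a: "a \<in> ?P" and b: "b \<in> ?B"
      have "(\<Sum>p\<in>?P. ddiff c (p - a) (f $$ a) * ddiff c (n - p - b) (g $$ b))
          = (\<Sum>q\<in>{?N - a..n - ?M - a}. ddiff c q (f $$ a) * ddiff c (n - a - b - q) (g $$ b))"
        by (rule sum.reindex_bij_witness[of _ "\<lambda>q. q + a" "\<lambda>p. p - a"]) (auto simp: algebra_simps)
      also have "\<dots> = ddiff c (n - a - b) (f $$ a * g $$ b)"
        by (rule ddiff_mult[symmetric]) (use a b in auto)
      finally show "(\<Sum>p\<in>?P. ddiff c (p - a) (f $$ a) * ddiff c (n - p - b) (g $$ b))
          = ddiff c (n - a - b) (f $$ a * g $$ b)" .
    qed
    also have "\<dots> = (\<Sum>a\<in>?P. \<Sum>r\<in>{?N + ?M..n}. ddiff c (n - r) (f $$ a * g $$ (r - a)))"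
    proof (rule sum.cong[OF refl])
      fix a assume a: "a \<in> ?P"
      have "(\<Sum>r\<in>{?N + ?M..n}. ddiff c (n - r) (f $$ a * g $$ (r - a)))
          = (\<Sum>b\<in>{?N + ?M - a..n - a}. ddiff c (n - a - b) (f $$ a * g $$ b))"
        by (rule sum.reindex_bij_witness[of _ "\<lambda>b. b + a" "\<lambda>r. r - a"]) (auto simp: algebra_simps)
      also have "\<dots> = (\<Sum>b\<in>{?M..n - a}. ddiff c (n - a - b) (f $$ a * g $$ b))"
        by (rule sum.mono_neutral_right) (use a in auto)
      also have "\<dots> = (\<Sum>b\<in>?B. ddiff c (n - a - b) (f $$ a * g $$ b))"
        by (rule sum.mono_neutral_left) (use a in \<open>auto intro: ddiff_neg\<close>)
      finally show "(\<Sum>b\<in>?B. ddiff c (n - a - b) (f $$ a * g $$ b))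
          = (\<Sum>r\<in>{?N + ?M..n}. ddiff c (n - r) (f $$ a * g $$ (r - a)))" by simp
    qed
    also have "\<dots> = (\<Sum>r\<in>{?N + ?M..n}. ddiff c (n - r) (\<Sum>a\<in>?P. f $$ a * g $$ (r - a)))"
      unfolding ddiff_sum by (rule sum.swap)
    also have "\<dots> = (\<Sum>r\<in>{?N + ?M..n}. ddiff c (n - r) ((f * g) $$ r))"
    proof (intro sum.cong refl arg_cong[of _ _ "ddiff c _"])
      fix r assume "r \<in> {?N + ?M..n}"
      then show "(\<Sum>a\<in>?P. f $$ a * g $$ (r - a)) = (f * g) $$ r"
        by (intro fls_mult_nth_set[symmetric, of ?N _ ?M]) auto
    qed
    also have "\<dots> = lshift c (f * g) $$ n"
      by (rule lshift_nth[symmetric]) (auto simp: fls_times_nth_eq0)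
    finally show "lshift c (f * g) $$ n = (lshift c f * lshift c g) $$ n" by simp
  qed
qed

text \<open>By the binomial theorem for the divided powers.\<close>

lemma lshift_lshift: "lshift c (lshift d f) = lshift (c + d) f"
proof (rule fls_eqI)
  fix n
  let ?A = "{fls_subdegree f..n}"
  have "lshift c (lshift d f) $$ n = (\<Sum>a\<in>?A. ddiff c (n - a) (lshift d f $$ a))"
    by (rule lshift_nth) (auto intro: lshift_eq_0[of "fls_subdegree f"])
  also have "\<dots> = (\<Sum>a\<in>?A. ddiff c (n - a) (\<Sum>b\<in>?A. ddiff d (a - b) (f $$ b)))"
    by (intro sum.cong refl arg_cong[of _ _ "ddiff c _"] lshift_nth[of "fls_subdegree f"]) auto
  also have "\<dots> = (\<Sum>b\<in>?A. \<Sum>a\<in>?A. ddiff c (n - a) (ddiff d (a - b) (f $$ b)))"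
    unfolding ddiff_sum by (rule sum.swap)
  also have "\<dots> = (\<Sum>b\<in>?A. ddiff (c + d) (n - b) (f $$ b))"
  proof (intro sum.cong refl)
    fix b assume b: "b \<in> ?A"
    have "(\<Sum>a\<in>?A. ddiff c (n - a) (ddiff d (a - b) (f $$ b)))
        = (\<Sum>p\<in>{0..n - fls_subdegree f}. ddiff c p (ddiff d (n - b - p) (f $$ b)))"
      by (rule sum.reindex_bij_witness[of _ "\<lambda>p. n - p" "\<lambda>a. n - a"]) (auto simp: algebra_simps)
    also have "\<dots> = ddiff (c + d) (n - b) (f $$ b)"
      by (rule ddiff_ddiff) (use b in auto)
    finally show "(\<Sum>a\<in>?A. ddiff c (n - a) (ddiff d (a - b) (f $$ b)))
        = ddiff (c + d) (n - b) (f $$ b)" .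
  qed
  also have "\<dots> = lshift (c + d) f $$ n"
    by (rule lshift_nth[symmetric]) auto
  finally show "lshift c (lshift d f) $$ n = lshift (c + d) f $$ n" .
qed

lemma lshift_0: "lshift 0 f = f"
proof (rule fls_eqI)
  fix n
  have "lshift 0 f $$ n = (\<Sum>a\<in>insert n {fls_subdegree f..n}. ddiff 0 (n - a) (f $$ a))"
    by (rule lshift_nth) auto
  also have "\<dots> = (\<Sum>a\<in>insert n {fls_subdegree f..n}. if a = n then f $$ n else 0)"
    by (intro sum.cong) (auto simp: ddiff_def power_0_left smf_const.one)
  also have "\<dots> = f $$ n" by (subst sum.delta) auto
  finally show "lshift 0 f $$ n = f $$ n" .
qed

interpretation cshift: ring_morphism "cshift c"
  unfolding cshift_def by (rule ring_morphism_mps_map) (rule lshift.ring_morphism_axioms)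

lemma cshift_cshift [simp]: "cshift c (cshift d f) = cshift (c + d) f"
  by (rule mps_eqI) (simp add: cshift_def lshift_lshift)

lemma cshift_0 [simp]: "cshift 0 f = f"
  by (rule mps_eqI) (simp add: cshift_def lshift_0)

lemma cshift_cconst [simp]: "cshift c (cconst a) = cconst a"
  by (simp add: cshift_def cconst_def mps_map_const lconst_def lshift_const)

lemma cshift_ceps [simp]: "cshift c ceps = ceps" "cshift c ceps_inv = ceps_inv"
  by (simp_all add: cshift_def ceps_def ceps_inv_def mps_map_const lshift_const)

lemma cshift_deriv: "mps_deriv n (cshift c f) = cshift c (mps_deriv n f)"
  unfolding cshift_def by (rule mps_deriv_map) (rule lshift.ring_morphism_axioms)

interpretation cconst: ring_morphism cconst
  by unfold_locales
     (simp_all only: cconst_def lconst_def smf_const.add smf_const.mult smf_const.one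
       fls_const.add fls_const.mult fls_const.one mps_const.add mps_const.mult mps_const.one)

lemma ceps_mult_inv [simp]: "ceps * ceps_inv = 1" "ceps_inv * ceps = 1"
  by (simp_all add: ceps_def ceps_inv_def fls_X_times_conv_shift fls_X_inv_times_conv_shift
      flip: mps_const.mult mps_const.one)

lemma mps_deriv_cconst [simp]: "mps_deriv n (cconst a) = 0"
  by (simp add: cconst_def)

lemma mps_deriv_ceps [simp]: "mps_deriv n ceps = 0" "mps_deriv n ceps_inv = 0"
  by (simp_all add: ceps_def ceps_inv_def)

lemma mps_deriv_of_nat [simp]: "mps_deriv n (of_nat k) = (0 :: cfun)"
  by (simp flip: cconst.of_nat)

section \<open>The operator generating the Miwa shifts\<close>

text \<open>The factor \<open>(n+1)!\<close>, in place of the \<open>n!\<close> of the Miwa operator, arises from differentiation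
  with respect to \<open>\<lambda>\<close>.\<close>

definition miwa_coeff :: "nat \<Rightarrow> cfun" where
  "miwa_coeff n = cconst (fact (n + 1)) * ceps"

lemma mps_deriv_miwa_coeff [simp]: "mps_deriv m (miwa_coeff n) = 0"
  by (simp add: miwa_coeff_def mps_deriv.mult)

text \<open>The Miwa operator and its commutator with the grading by powers of \<open>\<lambda>\<^sup>-\<^sup>1\<close> have this form, with
  different constants \<open>c\<close>.\<close>

definition miwa_gen :: "(nat \<Rightarrow> cfun) \<Rightarrow> (nat \<Rightarrow> cfun) \<Rightarrow> nat \<Rightarrow> cfun" where
  "miwa_gen c F = (\<lambda>j. \<Sum>n<j. c n * mps_deriv n (F (j - n - 1)))"

lemma miwa_op_gen: "miwa_op = miwa_gen (\<lambda>n. cconst (fact n) * ceps)"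
  by (simp add: fun_eq_iff miwa_op_def miwa_gen_def)

lemma miwa_gen_commute:
  assumes c: "\<And>m n. mps_deriv m (c n) = 0" and d: "\<And>m n. mps_deriv m (d n) = 0"
  shows "miwa_gen c (miwa_gen d F) = miwa_gen d (miwa_gen c F)"
proof
  fix j
  have *: "miwa_gen c (miwa_gen d F) j = (\<Sum>n<j. \<Sum>m<j. if n + m + 2 \<le> j
      then c n * d m * mps_deriv n (mps_deriv m (F (j - n - m - 2))) else 0)"
    if c: "\<And>m n. mps_deriv m (c n) = 0" and d: "\<And>m n. mps_deriv m (d n) = 0" for c d
    unfolding miwa_gen_def
  proof (intro sum.cong refl)
    fix n assume n: "n \<in> {..<j}"
    have "c n * mps_deriv n (\<Sum>m<j - n - 1. d m * mps_deriv m (F (j - n - 1 - m - 1)))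
        = (\<Sum>m<j - n - 1. c n * d m * mps_deriv n (mps_deriv m (F (j - n - m - 2))))"
      by (simp add: mps_deriv.sum mps_deriv.mult d sum_distrib_left mult.assoc add.commute)
    also have "\<dots> = (\<Sum>m<j. if n + m + 2 \<le> j
      then c n * d m * mps_deriv n (mps_deriv m (F (j - n - m - 2))) else 0)"
      using n by (intro sum.mono_neutral_cong_left) auto
    finally show "c n * mps_deriv n (\<Sum>m<j - n - 1. d m * mps_deriv m (F (j - n - 1 - m - 1)))
        = (\<Sum>m<j. if n + m + 2 \<le> j
      then c n * d m * mps_deriv n (mps_deriv m (F (j - n - m - 2))) else 0)" .
  qed
  show "miwa_gen c (miwa_gen d F) j = miwa_gen d (miwa_gen c F) j"
    unfolding *[OF c d] *[OF d c]
    by (subst sum.swap) (intro sum.cong refl if_cong,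
      auto simp: mps_deriv_commute[of _ _ "F _"] ac_simps diff_diff_eq)
qed

lemma miwa_gen_scale: "miwa_gen c (\<lambda>j. of_nat k * F j) = (\<lambda>j. of_nat k * miwa_gen c F j)"
  by (simp add: fun_eq_iff miwa_gen_def mps_deriv.mult sum_distrib_left ac_simps)

text \<open>Multiplying the \<open>j\<close>-th coefficient by \<open>j\<close> is \<open>-\<lambda> \<partial>\<^sub>\<lambda>\<close>, so this is the commutator of the
  Miwa operator with the grading.\<close>

lemma miwa_op_grading:
  "of_nat j * miwa_op F j = miwa_gen miwa_coeff F j + miwa_op (\<lambda>j. of_nat j * F j) j"
  unfolding miwa_op_def miwa_gen_def sum.distrib[symmetric] sum_distrib_left
proof (intro sum.cong refl)
  fix n assume "n \<in> {..<j}"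
  then have "of_nat j = (of_nat (n + 1) + of_nat (j - n - 1) :: cfun)"
    by (simp flip: of_nat_add)
  moreover have "cconst (fact (n + 1)) = of_nat (n + 1) * cconst (fact n)"
    by (simp add: cconst.mult cconst.add cconst.one cconst.of_nat algebra_simps)
  ultimately show "of_nat j * (cconst (fact n) * ceps * mps_deriv n (F (j - n - 1))) =
      miwa_coeff n * mps_deriv n (F (j - n - 1)) +
      cconst (fact n) * ceps * mps_deriv n (of_nat (j - n - 1) * F (j - n - 1))"
    by (simp only: mps_deriv.mult miwa_coeff_def mps_deriv_of_nat) (simp add: algebra_simps)
qed

context
  fixes f :: cfun
begin

private definition "E k = (miwa_op ^^ k) (\<lambda>i. if i = 0 then f else 0)"

lemma miwa_power_vanish: "j < k \<Longrightarrow> E k j = 0"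
proof (induction k arbitrary: j)
  case (Suc k)
  have "miwa_op (E k) j = 0"
    unfolding miwa_op_def using Suc by (intro sum.neutral) auto
  then show ?case by (simp add: E_def)
qed simp

text \<open>Since the grading has commutator \<open>miwa_gen miwa_coeff\<close> with the Miwa operator and kills its
  argument \<open>f\<close>, and since the two operators commute, this is the derivative of a power.\<close>

lemma miwa_power_grading: "of_nat j * E (Suc k) j = of_nat (Suc k) * miwa_gen miwa_coeff (E k) j"
proof (induction k arbitrary: j)
  case 0
  have "(\<lambda>j. of_nat j * E 0 j) = (\<lambda>_. 0)" by (auto simp: E_def)
  then show ?case
    using miwa_op_grading[of j "E 0"] by (simp add: E_def) (simp add: miwa_op_def)
next
  case (Suc k)
  have c: "miwa_op (miwa_gen miwa_coeff (E k)) = miwa_gen miwa_coeff (E (Suc k))"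
    unfolding miwa_op_gen
    by (subst miwa_gen_commute) (auto simp: mps_deriv.mult E_def miwa_op_gen)
  have "of_nat j * E (Suc (Suc k)) j =
      miwa_gen miwa_coeff (E (Suc k)) j + miwa_op (\<lambda>j. of_nat j * E (Suc k) j) j"
    using miwa_op_grading[of j "E (Suc k)"] by (simp add: E_def)
  also have "miwa_op (\<lambda>j. of_nat j * E (Suc k) j)
      = (\<lambda>j. of_nat (Suc k) * miwa_gen miwa_coeff (E (Suc k)) j)"
    unfolding Suc by (simp only: c[symmetric]) (simp only: miwa_op_gen miwa_gen_scale)
  finally show ?case by (simp add: algebra_simps)
qed

lemma miwa_exp_0 [simp]: "miwa_exp s f 0 = f"
  by (simp add: miwa_exp_def cconst.one)

text \<open>This recursion determines the Miwa shifts; everything below is deduced from it rather than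
  from the exponential series.\<close>

lemma miwa_exp_Suc:
  "of_nat (Suc j) * miwa_exp s f (Suc j) =
     cconst s * (\<Sum>n\<le>j. miwa_coeff n * mps_deriv n (miwa_exp s f (j - n)))"
proof -
  let ?c = "\<lambda>k. cconst (s ^ k / fact k)"
  have trunc: "miwa_exp s f i = (\<Sum>k\<le>j. ?c k * E k i)" if "i \<le> j" for i
    unfolding miwa_exp_def E_def[symmetric]
    using that by (intro sum.mono_neutral_left) (auto simp: miwa_power_vanish)
  have "of_nat (Suc j) * miwa_exp s f (Suc j) = (\<Sum>k\<le>Suc j. ?c k * (of_nat (Suc j) * E k (Suc j)))"
    unfolding miwa_exp_def E_def[symmetric] sum_distrib_left by (intro sum.cong) (auto simp: algebra_simps)
  also have "\<dots> = (\<Sum>k\<le>j. ?c (Suc k) * (of_nat (Suc j) * E (Suc k) (Suc j)))"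
    by (subst sum.atMost_Suc_shift) (simp add: E_def)
  also have "\<dots> = (\<Sum>k\<le>j. cconst s * (?c k * miwa_gen miwa_coeff (E k) (Suc j)))"
  proof (intro sum.cong refl)
    fix k
    have "?c (Suc k) * of_nat (Suc k) = cconst s * ?c k"
    proof -
      have "s ^ Suc k / fact (Suc k) * of_nat (Suc k) = s * (s ^ k / fact k)"
        using of_nat_neq_0[of k, where 'a = complex] by (simp add: divide_simps del: of_nat_Suc)
      then show ?thesis by (simp only: cconst.mult[symmetric] cconst.of_nat[symmetric])
    qed
    then show "?c (Suc k) * (of_nat (Suc j) * E (Suc k) (Suc j))
        = cconst s * (?c k * miwa_gen miwa_coeff (E k) (Suc j))"
      unfolding miwa_power_grading by (simp only: mult.assoc[symmetric])
  qed
  also have "\<dots> = cconst s * (\<Sum>n\<le>j. miwa_coeff n * mps_deriv n (\<Sum>k\<le>j. ?c k * E k (j - n)))"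
    unfolding miwa_gen_def lessThan_Suc_atMost sum_distrib_left mps_deriv.sum
    by (subst sum.swap) (intro sum.cong refl, simp add: mps_deriv.mult algebra_simps)
  finally show ?thesis by (simp add: trunc)
qed

end

text \<open>The derivative with respect to \<open>\<lambda>\<^sup>-\<^sup>1\<close> of \<open>\<Sum>\<^sub>n n! \<lambda>\<^sup>-\<^sup>n\<^sup>-\<^sup>1 \<epsilon> \<partial>\<^sub>n\<^sub>,\<^sub>1\<close>; the Miwa shift is the solution
  of the corresponding differential equation.\<close>

definition miwa_diff :: "cfun fps \<Rightarrow> cfun fps" where
  "miwa_diff F = Abs_fps (\<lambda>j. \<Sum>n\<le>j. miwa_coeff n * mps_deriv n (F $ (j - n)))"

lemma miwa_diff_nth: "miwa_diff F $ j = (\<Sum>n\<le>j. miwa_coeff n * mps_deriv n (F $ (j - n)))"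
  by (simp add: miwa_diff_def)

interpretation miwa_diff: ring_derivation miwa_diff
proof
  fix F G :: "cfun fps"
  show "miwa_diff (F + G) = miwa_diff F + miwa_diff G"
    by (rule fps_ext) (simp add: miwa_diff_nth mps_deriv.add distrib_left sum.distrib)
  define D where "D n F = Abs_fps (\<lambda>i. mps_deriv n (F $ i))" for n and F :: "cfun fps"
  have *: "(\<Sum>n\<le>j. miwa_coeff n * (D n F * G) $ (j - n)) = (miwa_diff F * G) $ j" for j F G
  proof -
    have "(miwa_diff F * G) $ j
        = (\<Sum>p=0..j. \<Sum>n=0..p. miwa_coeff n * mps_deriv n (F $ (p - n)) * G $ (j - p))"
      by (simp add: fps_mult_nth miwa_diff_nth sum_distrib_right atLeast0AtMost)
    also have "\<dots> = (\<Sum>n=0..j. \<Sum>i=0..j - n. miwa_coeff n * mps_deriv n (F $ i) * G $ (j - n - i))"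
      by (rule fps_mult_assoc_lemma)
    finally show ?thesis
      by (simp add: fps_mult_nth D_def sum_distrib_left atLeast0AtMost mult.assoc)
  qed
  show "miwa_diff (F * G) = miwa_diff F * G + F * miwa_diff G"
  proof (rule fps_ext)
    fix j
    have "mps_deriv n ((F * G) $ i) = (D n F * G) $ i + (D n G * F) $ i" for n i
      unfolding mult.commute[of "D n G"]
      by (simp add: fps_mult_nth mps_deriv.sum mps_deriv.mult sum.distrib D_def)
    then have "miwa_diff (F * G) $ j
        = (\<Sum>n\<le>j. miwa_coeff n * (D n F * G) $ (j - n)) + (\<Sum>n\<le>j. miwa_coeff n * (D n G * F) $ (j - n))"
      by (simp add: miwa_diff_nth distrib_left sum.distrib)
    then show "miwa_diff (F * G) $ j = (miwa_diff F * G + F * miwa_diff G) $ j"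
      by (simp only: * fps_add_nth mult.commute[of F])
  qed
qed

definition miwa_series :: "complex \<Rightarrow> cfun \<Rightarrow> cfun fps" where
  "miwa_series s f = Abs_fps (miwa_exp s f)"

lemma miwa_series_nth [simp]: "miwa_series s f $ j = miwa_exp s f j"
  by (simp add: miwa_series_def)

lemma miwa_series_deriv:
  "fps_deriv (miwa_series s f) = fps_const (cconst s) * miwa_diff (miwa_series s f)"
  by (rule fps_ext) (simp only: fps_deriv_nth miwa_series_nth fps_mult_left_const_nth
      miwa_diff_nth Suc_eq_plus1[symmetric] miwa_exp_Suc)

lemma miwa_series_unique:
  assumes F: "fps_deriv F = fps_const (cconst s) * miwa_diff F" and 0: "F $ 0 = f"
  shows "F = miwa_series s f"
proof (rule fps_ext)
  fix j show "F $ j = miwa_series s f $ j"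
  proof (induction j rule: less_induct)
    case (less j)
    show ?case
    proof (cases j)
      case (Suc i)
      have "of_nat (Suc i) * F $ Suc i = cconst s * miwa_diff F $ i"
        using arg_cong[OF F, of "\<lambda>F. F $ i"] by (simp del: of_nat_Suc)
      also have "miwa_diff F $ i = miwa_diff (miwa_series s f) $ i"
        unfolding miwa_diff_nth using less Suc by (intro sum.cong) auto
      also have "cconst s * miwa_diff (miwa_series s f) $ i = of_nat (Suc i) * miwa_series s f $ Suc i"
        by (simp add: miwa_exp_Suc miwa_diff_nth del: of_nat_Suc)
      finally show ?thesis unfolding Suc by (rule of_nat_mult_cancel)
    qed (simp add: 0)
  qed
qed

text \<open>Both sides solve the same differential equation, as \<open>miwa_diff\<close> is a derivation.\<close>

lemma miwa_series_mult: "miwa_series s (f * g) = miwa_series s f * miwa_series s g"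
  by (rule miwa_series_unique[symmetric])
     (simp_all add: miwa_series_deriv miwa_diff.mult algebra_simps)

lemma miwa_series_add: "miwa_series s (f + g) = miwa_series s f + miwa_series s g"
  by (rule miwa_series_unique[symmetric])
     (simp_all add: miwa_series_deriv miwa_diff.add algebra_simps)

lemma miwa_series_const:
  assumes "\<And>n. mps_deriv n c = 0"
  shows "miwa_series s c = fps_const c"
proof (rule miwa_series_unique[symmetric])
  have "miwa_diff (fps_const c) = 0"
    by (rule fps_ext) (auto simp: miwa_diff_nth assms intro!: sum.neutral)
  then show "fps_deriv (fps_const c) = fps_const (cconst s) * miwa_diff (fps_const c)" by simp
qed simp

interpretation miwa_series: ring_morphism "miwa_series s"
  by unfold_locales (auto simp: miwa_series_add miwa_series_mult miwa_series_const)

text \<open>Again by uniqueness, the partial derivatives commuting with each other.\<close>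

lemma miwa_series_mps_deriv: "miwa_exp s (mps_deriv n f) j = mps_deriv n (miwa_exp s f j)"
proof -
  define D where "D = Abs_fps (\<lambda>j. mps_deriv n (miwa_exp s f j))"
  have "D = miwa_series s (mps_deriv n f)"
  proof (rule miwa_series_unique)
    show "fps_deriv D = fps_const (cconst s) * miwa_diff D"
    proof (rule fps_ext)
      fix j
      have "fps_deriv D $ j = mps_deriv n (of_nat (Suc j) * miwa_exp s f (Suc j))"
        by (simp add: D_def mps_deriv.mult del: of_nat_Suc)
      also have "\<dots> = (fps_const (cconst s) * miwa_diff D) $ j"
        by (simp add: miwa_exp_Suc miwa_diff_nth D_def mps_deriv.mult mps_deriv.sum
            mps_deriv_commute[of n] del: of_nat_Suc)
      finally show "fps_deriv D $ j = (fps_const (cconst s) * miwa_diff D) $ j" .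
    qed
  qed (simp add: D_def)
  then have "D $ j = miwa_series s (mps_deriv n f) $ j" by simp
  then show ?thesis by (simp add: D_def)
qed

lemma miwa_exp_simps:
  "miwa_exp s (f + g) j = miwa_exp s f j + miwa_exp s g j"
  "miwa_exp s (sum h A) j = (\<Sum>i\<in>A. miwa_exp s (h i) j)"
  using arg_cong[OF miwa_series.add[of s f g], of "\<lambda>F. F $ j"]
    arg_cong[OF miwa_series.sum[of s h A], of "\<lambda>F. F $ j"]
  by (simp_all add: fps_sum_nth)

lemma miwa_exp_const_mult:
  assumes "\<And>n. mps_deriv n c = 0"
  shows "miwa_exp s (c * f) j = c * miwa_exp s f j"
  using arg_cong[OF miwa_series.mult[of s c f], of "\<lambda>F. F $ j"]
  by (simp add: miwa_series_const[OF assms])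

text \<open>The Miwa shift of a series in \<open>\<lambda>\<^sup>-\<^sup>1\<close>, with the same \<open>\<lambda>\<close> in the shift and in the series.\<close>

definition miwa_total :: "cfun fps \<Rightarrow> cfun fps" where
  "miwa_total F = Abs_fps (\<lambda>j. \<Sum>k\<le>j. miwa_exp 1 (F $ k) (j - k))"

lemma sum_triangle_swap:
  "(\<Sum>k\<le>j. \<Sum>n\<le>j - k. f k n) = (\<Sum>n\<le>j. \<Sum>k\<le>j - n. f k (n::nat))"
  unfolding sum.Sigma[OF finite_atMost, OF ballI, OF finite_atMost]
  by (rule sum.reindex_bij_witness[of _ prod.swap prod.swap]) auto

lemma miwa_total_const_mult: "miwa_total (fps_const g * F) = miwa_series 1 g * miwa_total F"
proof (rule fps_ext)
  fix j
  have "miwa_exp 1 (g * f) i = (\<Sum>n\<le>i. miwa_exp 1 g n * miwa_exp 1 f (i - n))" for f i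
    using arg_cong[OF miwa_series_mult[of 1 g f], of "\<lambda>F. F $ i"]
    by (simp add: fps_mult_nth atLeast0AtMost)
  then have "miwa_total (fps_const g * F) $ j
      = (\<Sum>k\<le>j. \<Sum>n\<le>j - k. miwa_exp 1 g n * miwa_exp 1 (F $ k) (j - k - n))"
    by (simp add: miwa_total_def)
  also have "\<dots> = (miwa_series 1 g * miwa_total F) $ j"
    by (subst sum_triangle_swap)
       (simp add: fps_mult_nth miwa_total_def sum_distrib_left atLeast0AtMost add.commute)
  finally show "miwa_total (fps_const g * F) $ j = (miwa_series 1 g * miwa_total F) $ j" .
qed

text \<open>The series variable occurs in the shift, which contributes the first term, and in the
  argument, which contributes the second one.\<close>

lemma miwa_total_deriv: "fps_deriv (miwa_total F) = miwa_diff (miwa_total F) + miwa_total (fps_deriv F)"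
proof (rule fps_ext)
  fix j
  let ?M = "\<lambda>k i. miwa_exp 1 (F $ k) i"
  have "fps_deriv (miwa_total F) $ j = (\<Sum>k\<le>Suc j. of_nat (Suc j) * ?M k (Suc j - k))"
    by (simp add: miwa_total_def sum_distrib_left del: of_nat_Suc sum.atMost_Suc)
  also have "\<dots> = (\<Sum>k\<le>Suc j. of_nat (Suc j - k) * ?M k (Suc j - k)) + (\<Sum>k\<le>Suc j. of_nat k * ?M k (Suc j - k))"
    unfolding sum.distrib[symmetric]
    by (intro sum.cong refl) (simp only: distrib_right[symmetric] of_nat_add[symmetric] atMost_iff le_add_diff_inverse2)
  also have "(\<Sum>k\<le>Suc j. of_nat (Suc j - k) * ?M k (Suc j - k)) = miwa_diff (miwa_total F) $ j"
  proof -
    have "(\<Sum>k\<le>Suc j. of_nat (Suc j - k) * ?M k (Suc j - k)) = (\<Sum>k\<le>j. of_nat (Suc (j - k)) * ?M k (Suc (j - k)))"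
      by (simp add: Suc_diff_le del: of_nat_Suc of_nat_diff)
    also have "\<dots> = (\<Sum>k\<le>j. \<Sum>n\<le>j - k. miwa_coeff n * mps_deriv n (?M k (j - k - n)))"
      by (simp only: miwa_exp_Suc cconst.one mult_1)
    also have "\<dots> = miwa_diff (miwa_total F) $ j"
      by (subst sum_triangle_swap)
         (simp add: miwa_diff_nth miwa_total_def mps_deriv.sum sum_distrib_left add.commute)
    finally show ?thesis .
  qed
  also have "(\<Sum>k\<le>Suc j. of_nat k * ?M k (Suc j - k)) = miwa_total (fps_deriv F) $ j"
    by (subst sum.atMost_Suc_shift)
       (simp add: miwa_total_def miwa_exp_const_mult flip: of_nat_Suc del: of_nat_Suc)
  finally show "fps_deriv (miwa_total F) $ j = (miwa_diff (miwa_total F) + miwa_total (fps_deriv F)) $ j"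
    by simp
qed

lemma miwa_total_diff: "miwa_total (miwa_diff F) = miwa_diff (miwa_total F)"
proof (rule fps_ext)
  fix j
  have "miwa_total (miwa_diff F) $ j
      = (\<Sum>k=0..j. \<Sum>n=0..k. miwa_coeff n * mps_deriv n (miwa_exp 1 (F $ (k - n)) (j - k)))"
    by (simp add: miwa_total_def miwa_diff_nth miwa_exp_simps miwa_exp_const_mult
        miwa_series_mps_deriv atLeast0AtMost)
  also have "\<dots> = (\<Sum>n=0..j. \<Sum>i=0..j - n. miwa_coeff n * mps_deriv n (miwa_exp 1 (F $ i) (j - n - i)))"
    by (rule fps_mult_assoc_lemma)
  also have "\<dots> = miwa_diff (miwa_total F) $ j"
    by (simp add: miwa_diff_nth miwa_total_def mps_deriv.sum sum_distrib_left atLeast0AtMost)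
  finally show "miwa_total (miwa_diff F) $ j = miwa_diff (miwa_total F) $ j" .
qed

text \<open>The left hand side does not depend on \<open>\<lambda>\<close>: the two terms of \<open>miwa_total_deriv\<close> cancel because
  the inner shift satisfies the differential equation with the opposite sign.\<close>

lemma miwa_total_inverse: "miwa_total (miwa_series (- 1) f) = fps_const f"
proof -
  let ?G = "miwa_total (miwa_series (- 1) f)"
  have neg: "miwa_total (fps_const (cconst (- 1)) * F) = fps_const (cconst (- 1)) * miwa_total F" for F
    by (rule fps_ext) (simp add: miwa_total_def miwa_exp_const_mult sum_distrib_left)
  have "fps_deriv ?G = miwa_diff ?G + fps_const (cconst (- 1)) * miwa_diff ?G"
    unfolding miwa_total_deriv miwa_series_deriv neg miwa_total_diff ..
  also have "\<dots> = 0" by (simp add: cconst.uminus cconst.one flip: fps_const_neg)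
  finally have d: "fps_deriv ?G = 0" .
  show ?thesis
  proof (rule fps_ext)
    fix j
    show "?G $ j = fps_const f $ j"
    proof (cases j)
      case (Suc i)
      have "of_nat (Suc i) * ?G $ Suc i = 0"
        using arg_cong[OF d, of "\<lambda>F. F $ i"] by (simp del: of_nat_Suc)
      then show ?thesis using Suc of_nat_mult_eq_0D by simp
    qed (simp add: miwa_total_def)
  qed
qed

section \<open>Exponentials and logarithms\<close>

text \<open>Series whose powers tend to zero coefficientwise.\<close>

definition small :: "cfun \<Rightarrow> bool" where
  "small z \<longleftrightarrow> (\<forall>k\<le>0. mcoeff z {#} $$ k = 0)"

text \<open>The powers of a small series \<open>z\<close> have poles in \<open>\<epsilon>\<close> of order bounded only in terms of the
  monomial.  The filtration below, in which \<open>z\<close> has degree \<open>1\<close>, absorbs that bound into a weight of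
  the monomials, so that estimates reduce to multiplicativity.\<close>

definition filt :: "(nat multiset \<Rightarrow> int) \<Rightarrow> int \<Rightarrow> cfun set" where
  "filt w n = {f. \<forall>M j. j < n - w M \<longrightarrow> mcoeff f M $$ j = 0}"

definition filt_weight :: "(nat multiset \<Rightarrow> int) \<Rightarrow> bool" where
  "filt_weight w \<longleftrightarrow> w {#} = 0 \<and> (\<forall>A B. w A + w B \<le> w (A + B))"

lemma filt_add: "f \<in> filt w n \<Longrightarrow> g \<in> filt w n \<Longrightarrow> f + g \<in> filt w n"
  by (simp add: filt_def)

lemma filt_diff: "f \<in> filt w n \<Longrightarrow> g \<in> filt w n \<Longrightarrow> f - g \<in> filt w n"
  by (simp add: filt_def)

lemma filt_0 [simp]: "0 \<in> filt w n"
  by (simp add: filt_def)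

lemma filt_sum: "(\<And>i. i \<in> A \<Longrightarrow> f i \<in> filt w n) \<Longrightarrow> sum f A \<in> filt w n"
  by (induction A rule: infinite_finite_induct) (auto intro: filt_add)

lemma filt_mono: "f \<in> filt w n \<Longrightarrow> m \<le> n \<Longrightarrow> f \<in> filt w m"
  by (auto simp: filt_def)

text \<open>Superadditivity of the weight is what makes the filtration multiplicative.\<close>

lemma filt_mult:
  assumes w: "filt_weight w" and f: "f \<in> filt w m" and g: "g \<in> filt w n"
  shows "f * g \<in> filt w (m + n)"
  unfolding filt_def
proof (intro CollectI allI impI)
  fix M j assume j: "j < m + n - w M"
  have "(mcoeff f A * mcoeff g (M - A)) $$ j = 0" if "A \<subseteq># M" for A
  proof -
    have "w A + w (M - A) \<le> w M"
      using w that unfolding filt_weight_def by (metis subset_mset.add_diff_inverse)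
    then have "(mcoeff f A * mcoeff g (M - A)) $$ j
        = (\<Sum>i\<in>{}. mcoeff f A $$ i * mcoeff g (M - A) $$ (j - i))"
      using f g j by (intro fls_mult_nth_set[of "m - w A" _ "n - w (M - A)"]) (auto simp: filt_def)
    then show ?thesis by simp
  qed
  then show "mcoeff (f * g) M $$ j = 0"
    by (simp add: mcoeff_mult fls_nth_sum)
qed

lemma filt_cconst_mult: "f \<in> filt w n \<Longrightarrow> cconst c * f \<in> filt w n"
  by (simp add: filt_def cconst_def lconst_def)

lemma filt_1: "filt_weight w \<Longrightarrow> 1 \<in> filt w 0"
  by (simp add: filt_def filt_weight_def)

lemma filt_power: "filt_weight w \<Longrightarrow> z \<in> filt w 1 \<Longrightarrow> z ^ k \<in> filt w (int k)"
proof (induction k)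
  case (Suc k)
  then show ?case using filt_mult[of w z 1 "z ^ k" "int k"] by (simp add: add.commute)
qed (simp add: filt_1)

lemma filt_eq_0: "(\<And>n::nat. f \<in> filt w (int n)) \<Longrightarrow> f = 0"
proof (intro mps_eqI fls_eqI)
  fix M j
  assume f: "\<And>n::nat. f \<in> filt w (int n)"
  have "j < int (nat (j + w M + 1)) - w M" by simp
  then show "mcoeff f M $$ j = mcoeff 0 M $$ j"
    using f[of "nat (j + w M + 1)"] by (simp add: filt_def del: int_nat_eq)
qed

lemma small_filt:
  assumes "small z"
  obtains w where "filt_weight w" "z \<in> filt w 1"
proof -
  \<comment> \<open>Taking into account all submonomials makes \<open>d\<close> monotone, and thus \<open>w\<close> superadditive.\<close>
  define d where "d M = (\<Sum>A | A \<subseteq># M. \<bar>fls_subdegree (mcoeff z A)\<bar>)" for M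
  define w where "w M = (d M + 1) * int (size M)" for M
  have d: "\<bar>fls_subdegree (mcoeff z A)\<bar> \<le> d M" if "A \<subseteq># M" for A M
    unfolding d_def using that by (intro member_le_sum finite_submultisets) auto
  have mono: "d A \<le> d M" if "A \<subseteq># M" for A M
    unfolding d_def using that
    by (intro sum_mono2 finite_submultisets) (auto intro: subset_mset.order_trans)
  have "filt_weight w"
    unfolding filt_weight_def
  proof (intro conjI allI)
    fix A B
    have "w A \<le> (d (A + B) + 1) * int (size A)" "w B \<le> (d (A + B) + 1) * int (size B)"
      unfolding w_def by (intro mult_right_mono; simp add: mono)+
    then show "w A + w B \<le> w (A + B)" by (simp add: w_def algebra_simps)
  qed (simp add: w_def)
  moreover have "z \<in> filt w 1"
    unfolding filt_def
  proof (intro CollectI allI impI)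
    fix M j assume j: "j < 1 - w M"
    show "mcoeff z M $$ j = 0"
    proof (cases "M = {#}")
      case True
      then show ?thesis using assms j by (simp add: small_def w_def)
    next
      case False
      have d0: "0 \<le> d M" using d[of M M] by simp
      have "1 \<le> int (size M)" using False by (simp add: Suc_le_eq nonempty_has_size)
      then have "(d M + 1) * 1 \<le> w M"
        unfolding w_def using d0 by (intro mult_left_mono) auto
      then have "j < fls_subdegree (mcoeff z M)" using j d[of M M] by simp
      then show ?thesis by simp
    qed
  qed
  ultimately show ?thesis using that by blast
qed

definition eval_trunc :: "complex fps \<Rightarrow> cfun \<Rightarrow> nat \<Rightarrow> cfun" where
  "eval_trunc p z K = (\<Sum>k\<le>K. cconst (p $ k) * z ^ k)"

text \<open>\<open>f\<close> is the value at \<open>z\<close> of the power series \<open>p\<close>, in the topology of the filtration.\<close>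

definition evaluates_to :: "(nat multiset \<Rightarrow> int) \<Rightarrow> complex fps \<Rightarrow> cfun \<Rightarrow> cfun \<Rightarrow> bool" where
  "evaluates_to w p z f \<longleftrightarrow> (\<forall>K. f - eval_trunc p z K \<in> filt w (int K + 1))"

lemma evaluates_to_unique:
  assumes "evaluates_to w p z f" "evaluates_to w p z g"
  shows "f = g"
proof -
  have "f - g \<in> filt w (int n)" for n
  proof -
    have "(f - eval_trunc p z n) - (g - eval_trunc p z n) \<in> filt w (int n + 1)"
      using assms unfolding evaluates_to_def by (intro filt_diff[of "f - _"]) auto
    then show ?thesis by (simp add: filt_mono)
  qed
  then show ?thesis using filt_eq_0[of "f - g" w] by simp
qed

text \<open>The formula for the value has the form of the definition of \<open>cexp\<close>.\<close>

lemma evaluates_to_exists: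
  assumes w: "filt_weight w" and z: "z \<in> filt w 1"
  shows "evaluates_to w p z (Abs_mps (\<lambda>M. Abs_fls (\<lambda>j. Sum_any (\<lambda>k::nat.
     smf_const (p $ k) * (mcoeff (z ^ k) M $$ j)))))" (is "evaluates_to w p z ?f")
  unfolding evaluates_to_def
proof
  fix K
  let ?t = "\<lambda>M j k. smf_const (p $ k) * (mcoeff (z ^ k) M $$ j)"
  have z0: "mcoeff (z ^ k) M $$ j = 0" if "j < int k - w M" for k M j
    using filt_power[OF w z, of k] that by (simp add: filt_def)
  have f: "mcoeff ?f M $$ j = Sum_any (?t M j)" for M j
    unfolding mcoeff_Abs_mps
  proof (rule Abs_fls_nth[of "- w M"])
    fix i assume "i < - w M"
    then have "?t M i = (\<lambda>_. 0)" by (intro ext) (simp add: z0)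
    then show "Sum_any (?t M i) = 0" by (simp only: Sum_any.neutral)
  qed
  show "?f - eval_trunc p z K \<in> filt w (int K + 1)"
    unfolding filt_def
  proof (intro CollectI allI impI)
    fix M j assume j: "j < int K + 1 - w M"
    have "Sum_any (?t M j) = (\<Sum>k\<le>K. ?t M j k)"
    proof (rule Sum_any.expand_superset)
      show "{k. ?t M j k \<noteq> 0} \<subseteq> {..K}"
      proof
        fix k assume "k \<in> {k. ?t M j k \<noteq> 0}"
        then have "\<not> j < int k - w M" using z0 by force
        then show "k \<in> {..K}" using j by simp
      qed
    qed simp
    then show "mcoeff (?f - eval_trunc p z K) M $$ j = 0"
      by (simp add: f eval_trunc_def mcoeff_sum fls_nth_sum cconst_def lconst_def del: mcoeff_Abs_mps)
  qed
qed

lemma eval_trunc_filt: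
  assumes "filt_weight w" "z \<in> filt w 1"
  shows "eval_trunc p z K \<in> filt w 0"
  unfolding eval_trunc_def
  using assms by (intro filt_sum filt_cconst_mult filt_mono[OF filt_power]) auto

lemma evaluates_to_mult:
  assumes w: "filt_weight w" and z: "z \<in> filt w 1"
    and f: "evaluates_to w p z f" and g: "evaluates_to w q z g"
  shows "evaluates_to w (p * q) z (f * g)"
  unfolding evaluates_to_def
proof
  fix K
  let ?P = "eval_trunc p z K" and ?Q = "eval_trunc q z K"
  have P: "f - ?P \<in> filt w (int K + 1)" and Q: "g - ?Q \<in> filt w (int K + 1)"
    using f g by (auto simp: evaluates_to_def)
  have g0: "g \<in> filt w 0"
    using filt_add[OF filt_mono[OF Q, of 0] eval_trunc_filt[OF w z, of q K]] by simp
  have "(f - ?P) * g \<in> filt w (int K + 1)" "?P * (g - ?Q) \<in> filt w (int K + 1)"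
    using filt_mult[OF w P g0] filt_mult[OF w eval_trunc_filt[OF w z, of p K] Q] by auto
  moreover have "?P * ?Q - eval_trunc (p * q) z K \<in> filt w (int K + 1)"
  proof -
    let ?t = "\<lambda>(i, j). cconst (p $ i) * cconst (q $ j) * z ^ (i + j)"
    have "?P * ?Q = (\<Sum>x\<in>{..K} \<times> {..K}. ?t x)"
      unfolding eval_trunc_def sum_product sum.cartesian_product
      by (intro sum.cong) (auto simp: power_add algebra_simps)
    also have "\<dots> = (\<Sum>x\<in>{x \<in> {..K} \<times> {..K}. fst x + snd x \<le> K}. ?t x)
        + (\<Sum>x\<in>{x \<in> {..K} \<times> {..K}. \<not> fst x + snd x \<le> K}. ?t x)"
      by (subst sum.union_disjoint[symmetric]) (auto intro!: sum.cong)
    also have "(\<Sum>x\<in>{x \<in> {..K} \<times> {..K}. fst x + snd x \<le> K}. ?t x) = eval_trunc (p * q) z K"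
    proof -
      have s: "{x \<in> {..K} \<times> {..K}. fst x + snd x \<le> K} = {(i, j). i + j \<le> K}" by auto
      have "eval_trunc (p * q) z K
          = (\<Sum>k\<le>K. \<Sum>i\<le>k. ?t (i, k - i))"
        unfolding eval_trunc_def
        by (intro sum.cong refl)
           (simp add: fps_mult_nth cconst.sum cconst.mult sum_distrib_right atLeast0AtMost)
      also have "\<dots> = (\<Sum>(i, j)\<in>{(i, j). i + j \<le> K}. ?t (i, j))"
        by (rule sum.triangle_reindex_eq[symmetric])
      finally show ?thesis unfolding s by (simp add: case_prod_unfold)
    qed
    finally have "?P * ?Q - eval_trunc (p * q) z K
        = (\<Sum>x\<in>{x \<in> {..K} \<times> {..K}. \<not> fst x + snd x \<le> K}. ?t x)" by simp
    also have "\<dots> \<in> filt w (int K + 1)"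
    proof (rule filt_sum)
      fix x assume x: "x \<in> {x \<in> {..K} \<times> {..K}. \<not> fst x + snd x \<le> K}"
      have "z ^ (fst x + snd x) \<in> filt w (int K + 1)"
        using x by (intro filt_mono[OF filt_power[OF w z]]) auto
      then have "cconst (p $ fst x) * (cconst (q $ snd x) * z ^ (fst x + snd x)) \<in> filt w (int K + 1)"
        by (intro filt_cconst_mult)
      then show "?t x \<in> filt w (int K + 1)" by (simp add: case_prod_unfold mult.assoc)
    qed
    finally show ?thesis .
  qed
  ultimately have "(f - ?P) * g + ?P * (g - ?Q) + (?P * ?Q - eval_trunc (p * q) z K) \<in> filt w (int K + 1)"
    by (intro filt_add)
  then show "f * g - eval_trunc (p * q) z K \<in> filt w (int K + 1)"
    by (simp add: algebra_simps)
qed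

lemma evaluates_to_power:
  assumes w: "filt_weight w" and z: "z \<in> filt w 1" and f: "evaluates_to w p z f"
  shows "evaluates_to w (p ^ k) z (f ^ k)"
proof (induction k)
  case 0
  have "eval_trunc 1 z K = 1" for K
  proof -
    have "eval_trunc 1 z K = (\<Sum>k\<le>K. if k = 0 then 1 else 0)"
      unfolding eval_trunc_def by (intro sum.cong) (auto simp: cconst.one)
    then show ?thesis by simp
  qed
  then show ?case by (simp add: evaluates_to_def)
qed (use evaluates_to_mult[OF w z f] in simp)

lemma evaluates_to_compose:
  assumes w: "filt_weight w" and z: "z \<in> filt w 1"
    and f: "evaluates_to w p z f" and p0: "p $ 0 = 0" and g: "evaluates_to w q f g"
  shows "evaluates_to w (q oo p) z g"
  unfolding evaluates_to_def
proof
  fix K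
  have "(\<Sum>k\<le>K. cconst (q $ k) * (f ^ k - eval_trunc (p ^ k) z K)) \<in> filt w (int K + 1)"
    using evaluates_to_power[OF w z f]
    by (intro filt_sum filt_cconst_mult) (auto simp: evaluates_to_def)
  moreover have "(\<Sum>k\<le>K. cconst (q $ k) * eval_trunc (p ^ k) z K) = eval_trunc (q oo p) z K"
  proof -
    have "(\<Sum>k\<le>K. cconst (q $ k) * eval_trunc (p ^ k) z K)
        = (\<Sum>l\<le>K. cconst (\<Sum>k\<le>K. q $ k * (p ^ k) $ l) * z ^ l)"
      unfolding eval_trunc_def sum_distrib_left
      by (subst sum.swap) (simp add: cconst.sum cconst.mult sum_distrib_right mult.assoc)
    also have "\<dots> = eval_trunc (q oo p) z K"
      unfolding eval_trunc_def
    proof (intro sum.cong refl)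
      fix l assume "l \<in> {..K}"
      then have "(\<Sum>k\<le>K. q $ k * (p ^ k) $ l) = (q oo p) $ l"
        unfolding fps_compose_nth using startsby_zero_power_prefix[OF p0]
        by (intro sum.mono_neutral_right) auto
      then show "cconst (\<Sum>k\<le>K. q $ k * (p ^ k) $ l) * z ^ l = cconst ((q oo p) $ l) * z ^ l"
        by simp
    qed
    finally show ?thesis .
  qed
  ultimately have "eval_trunc q f K - eval_trunc (q oo p) z K \<in> filt w (int K + 1)"
    by (simp add: eval_trunc_def[of q f] right_diff_distrib sum_subtractf)
  moreover have "g - eval_trunc q f K \<in> filt w (int K + 1)"
    using g by (simp add: evaluates_to_def)
  ultimately show "g - eval_trunc (q oo p) z K \<in> filt w (int K + 1)"
    using filt_add by fastforce
qed

text \<open>The logarithm is the value at \<open>E - 1\<close> of the power series inverse to \<open>exp - 1\<close> under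
  composition.\<close>

lemma exists_log:
  assumes "small (E - 1)"
  obtains v where "small v" "cexp v = E"
proof -
  let ?e = "fps_exp 1 :: complex fps"
  let ?l = "fps_inv (?e - 1)"
  define z where "z = E - 1"
  obtain w where w: "filt_weight w" and z: "z \<in> filt w 1"
    using small_filt assms unfolding z_def by blast
  obtain v where v: "evaluates_to w ?l z v"
    using evaluates_to_exists[OF w z] by blast
  have l0: "?l $ 0 = 0" by (simp add: fps_inv_def)
  have "v - eval_trunc ?l z 0 \<in> filt w 1"
    using v unfolding evaluates_to_def by (metis add_0 of_nat_0)
  then have v1: "v \<in> filt w 1" by (simp add: eval_trunc_def l0)
  have "evaluates_to w ?e v (cexp v)"
    using evaluates_to_exists[OF w v1, of ?e] by (simp add: cexp_def)
  then have "evaluates_to w (?e oo ?l) z (cexp v)"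
    using evaluates_to_compose[OF w z v l0] by blast
  moreover have "?e oo ?l = 1 + fps_X"
    using fps_inv_fps_exp_compose(2)[of "1 :: complex"]
    by (simp add: fps_compose_sub_distrib diff_eq_eq add.commute)
  moreover have "evaluates_to w (1 + fps_X) z (1 + z)"
    unfolding evaluates_to_def
  proof
    fix K
    have "eval_trunc (1 + fps_X) z K = (if K = 0 then 1 else 1 + z)"
    proof -
      have "eval_trunc (1 + fps_X) z K = (\<Sum>k\<le>K. if k = 0 then 1 else if k = 1 then z else 0)"
        unfolding eval_trunc_def by (intro sum.cong) (auto simp: cconst.one)
      also have "\<dots> = (if K = 0 then 1 else 1 + z)"
        by (cases K) (simp_all add: sum.atMost_Suc_shift del: sum.atMost_Suc)
      finally show ?thesis .
    qed
    then show "1 + z - eval_trunc (1 + fps_X) z K \<in> filt w (int K + 1)"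
      using z by simp
  qed
  ultimately have "cexp v = 1 + z" using evaluates_to_unique by metis
  moreover have "small v"
    using v1 w by (simp add: small_def filt_def filt_weight_def)
  ultimately show ?thesis using that by (simp add: z_def)
qed

section \<open>Non-vanishing series\<close>

lemma nonvanishing_unit:
  assumes "nonvanishing \<tau>"
  obtains \<sigma> where "\<tau> * \<sigma> = 1"
proof -
  let ?t = "mcoeff \<tau> {#}"
  obtain y where "?t $$ fls_subdegree ?t * y = 1"
    using assms smf_unit unfolding nonvanishing_def Let_def by blast
  then obtain s where "?t * s = 1" using fls_unit by blast
  then show ?thesis using mps_unit that by blast
qed

text \<open>A shift by \<open>c \<epsilon>\<close> does not change the leading coefficient in \<open>\<epsilon>\<close>.\<close>

lemma small_shift_quotient:
  assumes "nonvanishing \<tau>" and "\<tau> * \<sigma> = 1"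
  shows "small (cshift c \<tau> * \<sigma> - 1)"
proof -
  let ?t = "mcoeff \<tau> {#}" and ?s = "mcoeff \<sigma> {#}"
  let ?N = "fls_subdegree ?t"
  obtain y where y: "?t $$ ?N * y = 1"
    using assms smf_unit unfolding nonvanishing_def Let_def by blast
  have ts: "?t * ?s = 1"
    using arg_cong[OF assms(2), of "\<lambda>F. mcoeff F {#}"] by simp
  have s: "?s $$ j = 0" if "j < - ?N" for j
  proof -
    let ?M = "fls_subdegree ?s"
    have "?s \<noteq> 0" using ts by auto
    then have "?s $$ ?M \<noteq> 0" by simp
    have "?t $$ ?N * ?s $$ ?M \<noteq> 0"
    proof
      assume "?t $$ ?N * ?s $$ ?M = 0"
      then have "(?t $$ ?N * y) * ?s $$ ?M = 0" by (metis mult.assoc mult.commute mult_zero_left)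
      then show False using y \<open>?s $$ ?M \<noteq> 0\<close> by simp
    qed
    then have "(1 :: lcf) $$ (?N + ?M) \<noteq> 0"
      using fls_times_base[of ?t ?s] ts by simp
    then have "?M = - ?N" by (simp split: if_splits)
    then show ?thesis using that by simp
  qed
  have d: "(lshift c ?t - ?t) $$ j = 0" if "j < ?N + 1" for j
  proof (cases "j = ?N")
    case True
    then show ?thesis by (simp add: lshift_leading)
  next
    case False
    then have "j < ?N" using that by simp
    then show ?thesis using lshift_eq_0[of ?N ?t j c] by simp
  qed
  have "mcoeff (cshift c \<tau> * \<sigma> - 1) {#} = (lshift c ?t - ?t) * ?s"
    by (simp add: cshift_def left_diff_distrib ts)
  moreover have "((lshift c ?t - ?t) * ?s) $$ k = 0" if "k \<le> 0" for k
  proof -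
    have "((lshift c ?t - ?t) * ?s) $$ k = (\<Sum>i\<in>{}. (lshift c ?t - ?t) $$ i * ?s $$ (k - i))"
      using that by (intro fls_mult_nth_set[of "?N + 1" _ "- ?N"] d s) auto
    then show ?thesis by simp
  qed
  ultimately show ?thesis by (simp add: small_def)
qed

lemma small_cshift: "small z \<Longrightarrow> small (cshift c z)"
  using lshift_eq_0[of 1 "mcoeff z {#}" _ c] by (simp add: small_def cshift_def)

lemma small_mult_minus_1:
  assumes "small (a - 1)" "small (b - 1)"
  shows "small (a * b - 1)"
proof -
  let ?a = "mcoeff (a - 1) {#}" and ?b = "mcoeff (b - 1) {#}"
  have "a * b - 1 = (a - 1) * (b - 1) + (a - 1) + (b - 1)" by (simp add: algebra_simps)
  moreover have "(?a * ?b) $$ k = 0" if "k \<le> 0" for k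
  proof -
    have "(?a * ?b) $$ k = (\<Sum>i\<in>{}. ?a $$ i * ?b $$ (k - i))"
      using that assms by (intro fls_mult_nth_set[of 1 _ 1]) (auto simp: small_def)
    then show ?thesis by simp
  qed
  then have "small ((a - 1) * (b - 1))" by (simp add: small_def)
  ultimately show ?thesis using assms by (simp only: small_def mcoeff_simps(3) fls_plus_nth) simp
qed

section \<open>The ring of difference operators bounded above\<close>

lemma dop_mult_nth:
  assumes A: "\<And>k. k > N \<Longrightarrow> A k = 0" and B: "\<And>k. k > M \<Longrightarrow> B k = 0"
    and I: "finite I" "{n - M..N} \<subseteq> I"
  shows "(A \<bullet>\<^sub>d B) n = (\<Sum>i\<in>I. A i * cshift (of_int i) (B (n - i)))"
proof -
  have "(\<lambda>i. A i * cshift (of_int i) (B (n - i))) i = 0" if "i \<notin> I" for i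
  proof -
    have "i \<notin> {n - M..N}" using that I by blast
    then have "i < n - M \<or> i > N" by auto
    then show ?thesis using A[of i] B[of "n - i"] by auto
  qed
  then show ?thesis
    unfolding dop_mult_def using I(1) by (intro Sum_any.expand_superset) auto
qed

text \<open>Operators with finitely many positive powers of \<open>\<Lambda>\<close> form a ring, which makes ring reasoning
  available for products of arbitrary length.\<close>

typedef pdo = "{A :: dop. \<exists>N. \<forall>k>N. A k = 0}"
  morphisms pcoef Abs_pdo
  by (rule exI[of _ "\<lambda>_. 0"]) simp

setup_lifting type_definition_pdo

lemma pcoef_bound: obtains N where "\<And>k. k > N \<Longrightarrow> pcoef A k = 0"
  using pcoef[of A] by auto

lemma pcoef_Abs_pdo: "(\<And>k. k > N \<Longrightarrow> A k = 0) \<Longrightarrow> pcoef (Abs_pdo A) = A"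
  by (rule Abs_pdo_inverse) auto

lemma pdo_eqI: "(\<And>k. pcoef A k = pcoef B k) \<Longrightarrow> A = B"
  by (simp add: fun_eq_iff flip: pcoef_inject)

lemma dop_mult_bound:
  assumes A: "\<And>k. k > N \<Longrightarrow> A k = 0" and B: "\<And>k. k > M \<Longrightarrow> B k = 0" and k: "k > N + M"
  shows "(A \<bullet>\<^sub>d B) k = 0"
  by (subst dop_mult_nth[of N A M B "{}"]) (use A B k in auto)

instantiation pdo :: ring_1
begin

lift_definition zero_pdo :: pdo is "\<lambda>_. 0" by simp

lift_definition one_pdo :: pdo is dop_one
  by (rule exI[of _ 0]) (simp add: dop_one_def)

lift_definition plus_pdo :: "pdo \<Rightarrow> pdo \<Rightarrow> pdo" is "\<lambda>A B k. A k + B k"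
proof -
  fix A B :: dop
  assume "\<exists>N. \<forall>k>N. A k = 0" "\<exists>N. \<forall>k>N. B k = 0"
  then obtain N M where "\<forall>k>N. A k = 0" "\<forall>k>M. B k = 0" by blast
  then show "\<exists>N. \<forall>k>N. A k + B k = 0" by (intro exI[of _ "max N M"]) auto
qed

lift_definition uminus_pdo :: "pdo \<Rightarrow> pdo" is "\<lambda>A k. - A k" by auto

lift_definition minus_pdo :: "pdo \<Rightarrow> pdo \<Rightarrow> pdo" is "\<lambda>A B k. A k - B k"
proof -
  fix A B :: dop
  assume "\<exists>N. \<forall>k>N. A k = 0" "\<exists>N. \<forall>k>N. B k = 0"
  then obtain N M where "\<forall>k>N. A k = 0" "\<forall>k>M. B k = 0" by blast
  then show "\<exists>N. \<forall>k>N. A k - B k = 0" by (intro exI[of _ "max N M"]) auto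
qed

lift_definition times_pdo :: "pdo \<Rightarrow> pdo \<Rightarrow> pdo" is dop_mult
  using dop_mult_bound by blast

instance
proof
  fix A B C :: pdo
  obtain a where a: "\<And>k. k > a \<Longrightarrow> pcoef A k = 0" using pcoef_bound by blast
  obtain b where b: "\<And>k. k > b \<Longrightarrow> pcoef B k = 0" using pcoef_bound by blast
  obtain c where c: "\<And>k. k > c \<Longrightarrow> pcoef C k = 0" using pcoef_bound by blast
  note rep = times_pdo.rep_eq plus_pdo.rep_eq one_pdo.rep_eq
  show "A * B * C = A * (B * C)"
  proof (rule pdo_eqI)
    fix k
    \<comment> \<open>The ranges are chosen such that the substitution \<open>i = j + l\<close> maps one rectangle onto the other.\<close>
    let ?I = "{k - c..a + b}" and ?J = "{k - b - c..a}"
    let ?t = "\<lambda>i j. pcoef A j * cshift (of_int j) (pcoef B (i - j)) * cshift (of_int i) (pcoef C (k - i))"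
    have "pcoef (A * B * C) k = (\<Sum>i\<in>?I. (pcoef A \<bullet>\<^sub>d pcoef B) i * cshift (of_int i) (pcoef C (k - i)))"
      unfolding rep
      by (rule dop_mult_nth[of "a + b" _ c]) (auto intro: dop_mult_bound a b c)
    also have "\<dots> = (\<Sum>i\<in>?I. \<Sum>j\<in>?J. ?t i j)"
    proof (intro sum.cong refl)
      fix i assume "i \<in> ?I"
      then have "(pcoef A \<bullet>\<^sub>d pcoef B) i = (\<Sum>j\<in>?J. pcoef A j * cshift (of_int j) (pcoef B (i - j)))"
        by (intro dop_mult_nth[of a _ b]) (auto intro: a b)
      then show "(pcoef A \<bullet>\<^sub>d pcoef B) i * cshift (of_int i) (pcoef C (k - i)) = (\<Sum>j\<in>?J. ?t i j)"
        by (simp add: sum_distrib_right)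
    qed
    also have "\<dots> = (\<Sum>j\<in>?J. \<Sum>i\<in>?I. ?t i j)" by (rule sum.swap)
    also have "\<dots> = (\<Sum>j\<in>?J. pcoef A j * cshift (of_int j) ((pcoef B \<bullet>\<^sub>d pcoef C) (k - j)))"
    proof (rule sum.cong[OF refl])
      fix j assume j: "j \<in> ?J"
      let ?L = "{k - c - j..a + b - j}"
      have "(pcoef B \<bullet>\<^sub>d pcoef C) (k - j) = (\<Sum>l\<in>?L. pcoef B l * cshift (of_int l) (pcoef C (k - j - l)))"
        using j by (intro dop_mult_nth[of b _ c]) (auto intro: b c)
      then have "pcoef A j * cshift (of_int j) ((pcoef B \<bullet>\<^sub>d pcoef C) (k - j)) = (\<Sum>l\<in>?L. ?t (j + l) j)"
        by (simp add: cshift.sum cshift.mult sum_distrib_left mult.assoc diff_diff_eq)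
      also have "\<dots> = (\<Sum>i\<in>?I. ?t i j)"
        by (rule sum.reindex_bij_witness[of _ "\<lambda>i. i - j" "\<lambda>l. j + l"]) auto
      finally show "(\<Sum>i\<in>?I. ?t i j)
          = pcoef A j * cshift (of_int j) ((pcoef B \<bullet>\<^sub>d pcoef C) (k - j))" by simp
    qed
    also have "\<dots> = pcoef (A * (B * C)) k"
      unfolding rep
      by (rule dop_mult_nth[symmetric, of a _ "b + c"]) (auto intro: dop_mult_bound a b c)
    finally show "pcoef (A * B * C) k = pcoef (A * (B * C)) k" .
  qed
  have one: "dop_one k = 0" if "k > 0" for k using that by (simp add: dop_one_def)
  show "1 * A = A"
  proof (rule pdo_eqI)
    fix k
    have "pcoef (1 * A) k = (\<Sum>i\<in>insert 0 {k - a..0}. dop_one i * cshift (of_int i) (pcoef A (k - i)))"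
      unfolding rep by (rule dop_mult_nth[of 0 _ a]) (auto intro: a one)
    also have "\<dots> = (\<Sum>i\<in>insert 0 {k - a..0}. if i = 0 then pcoef A k else 0)"
      by (intro sum.cong) (auto simp: dop_one_def)
    also have "\<dots> = pcoef A k" by (subst sum.delta) auto
    finally show "pcoef (1 * A) k = pcoef A k" .
  qed
  show "A * 1 = A"
  proof (rule pdo_eqI)
    fix k
    have "pcoef (A * 1) k = (\<Sum>i\<in>insert k {k - 0..a}. pcoef A i * cshift (of_int i) (dop_one (k - i)))"
      unfolding rep by (rule dop_mult_nth[of a _ 0]) (auto intro: a one)
    also have "\<dots> = (\<Sum>i\<in>insert k {k - 0..a}. if i = k then pcoef A k else 0)"
      by (intro sum.cong) (auto simp: dop_one_def cshift.one)
    also have "\<dots> = pcoef A k" by (subst sum.delta) auto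
    finally show "pcoef (A * 1) k = pcoef A k" .
  qed
  show "(A + B) * C = A * C + B * C"
  proof (rule pdo_eqI)
    fix k
    let ?I = "{k - c..max a b}"
    have ab: "pcoef A k + pcoef B k = 0" if "k > max a b" for k using that a b by simp
    have "pcoef ((A + B) * C) k = (\<Sum>i\<in>?I. (pcoef A i + pcoef B i) * cshift (of_int i) (pcoef C (k - i)))"
      unfolding rep by (rule dop_mult_nth[of "max a b" _ c]) (auto intro: c ab)
    moreover have "pcoef (A * C) k = (\<Sum>i\<in>?I. pcoef A i * cshift (of_int i) (pcoef C (k - i)))"
      unfolding rep by (rule dop_mult_nth[of a _ c]) (auto intro: a c)
    moreover have "pcoef (B * C) k = (\<Sum>i\<in>?I. pcoef B i * cshift (of_int i) (pcoef C (k - i)))"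
      unfolding rep by (rule dop_mult_nth[of b _ c]) (auto intro: b c)
    ultimately show "pcoef ((A + B) * C) k = pcoef (A * C + B * C) k"
      by (simp add: plus_pdo.rep_eq distrib_right sum.distrib)
  qed
  show "A * (B + C) = A * B + A * C"
  proof (rule pdo_eqI)
    fix k
    let ?I = "{k - max b c..a}"
    have bc: "pcoef B k + pcoef C k = 0" if "k > max b c" for k using that b c by simp
    have "pcoef (A * (B + C)) k = (\<Sum>i\<in>?I. pcoef A i * cshift (of_int i) (pcoef B (k - i) + pcoef C (k - i)))"
      unfolding rep by (rule dop_mult_nth[of a _ "max b c"]) (auto intro: a bc)
    moreover have "pcoef (A * B) k = (\<Sum>i\<in>?I. pcoef A i * cshift (of_int i) (pcoef B (k - i)))"
      unfolding rep by (rule dop_mult_nth[of a _ b]) (auto intro: a b)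
    moreover have "pcoef (A * C) k = (\<Sum>i\<in>?I. pcoef A i * cshift (of_int i) (pcoef C (k - i)))"
      unfolding rep by (rule dop_mult_nth[of a _ c]) (auto intro: a c)
    ultimately show "pcoef (A * (B + C)) k = pcoef (A * B + A * C) k"
      by (simp add: plus_pdo.rep_eq cshift.add distrib_left sum.distrib)
  qed
  show "(0::pdo) \<noteq> 1"
    by transfer (auto simp: dop_one_def fun_eq_iff intro!: exI[of _ 0])
  show "0 + A = A" "- A + A = 0" "A - B = A + - B" "A + B = B + A" "A + B + C = A + (B + C)"
    by (auto intro!: pdo_eqI simp: plus_pdo.rep_eq minus_pdo.rep_eq uminus_pdo.rep_eq zero_pdo.rep_eq)
qed

end

lemma pcoef_simps [simp]:
  "pcoef 0 k = 0" "pcoef 1 k = (if k = 0 then 1 else 0)" "pcoef (A + B) k = pcoef A k + pcoef B k"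
  "pcoef (A - B) k = pcoef A k - pcoef B k" "pcoef (- A) k = - pcoef A k"
  by (simp_all add: zero_pdo.rep_eq one_pdo.rep_eq dop_one_def plus_pdo.rep_eq minus_pdo.rep_eq
      uminus_pdo.rep_eq)

lemma pcoef_sum: "pcoef (sum f I) k = (\<Sum>i\<in>I. pcoef (f i) k)"
  by (induction I rule: infinite_finite_induct) auto

lemma pcoef_mult_set:
  assumes "\<And>k. k > N \<Longrightarrow> pcoef A k = 0" "\<And>k. k > M \<Longrightarrow> pcoef B k = 0"
    and "finite I" "{n - M..N} \<subseteq> I"
  shows "pcoef (A * B) n = (\<Sum>i\<in>I. pcoef A i * cshift (of_int i) (pcoef B (n - i)))"
  unfolding times_pdo.rep_eq using assms by (rule dop_mult_nth)

lemma pcoef_mult_bound: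
  assumes "\<And>k. k > N \<Longrightarrow> pcoef A k = 0" "\<And>k. k > M \<Longrightarrow> pcoef B k = 0" "k > N + M"
  shows "pcoef (A * B) k = 0"
  unfolding times_pdo.rep_eq using assms by (rule dop_mult_bound)

lemma pcoef_mult_top:
  assumes "\<And>k. k > N \<Longrightarrow> pcoef A k = 0" "\<And>k. k > M \<Longrightarrow> pcoef B k = 0"
  shows "pcoef (A * B) (N + M) = pcoef A N * cshift (of_int N) (pcoef B M)"
  by (subst pcoef_mult_set[of N A M B "{N}"]) (use assms in auto)

definition pconst :: "cfun \<Rightarrow> pdo" where
  "pconst a = Abs_pdo (\<lambda>k. if k = 0 then a else 0)"

definition pLam :: "int \<Rightarrow> pdo" where
  "pLam n = Abs_pdo (\<lambda>k. if k = n then 1 else 0)"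

lemma pcoef_pconst [simp]: "pcoef (pconst a) k = (if k = 0 then a else 0)"
  unfolding pconst_def by (subst pcoef_Abs_pdo[of 0]) auto

lemma pcoef_pLam [simp]: "pcoef (pLam n) k = (if k = n then 1 else 0)"
  unfolding pLam_def by (subst pcoef_Abs_pdo[of n]) auto

lemma pcoef_pconst_mult [simp]: "pcoef (pconst a * A) k = a * pcoef A k"
proof -
  obtain N where N: "\<And>k. k > N \<Longrightarrow> pcoef A k = 0" using pcoef_bound by blast
  have "pcoef (pconst a * A) k = (\<Sum>i\<in>insert 0 {k - N..0}. pcoef (pconst a) i * cshift (of_int i) (pcoef A (k - i)))"
    by (rule pcoef_mult_set[of 0 _ N]) (auto intro: N)
  also have "\<dots> = (\<Sum>i\<in>insert 0 {k - N..0}. if i = 0 then a * pcoef A k else 0)"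
    by (intro sum.cong) auto
  also have "\<dots> = a * pcoef A k" by (subst sum.delta) auto
  finally show ?thesis .
qed

lemma pcoef_mult_pconst [simp]: "pcoef (A * pconst a) k = pcoef A k * cshift (of_int k) a"
proof -
  obtain N where N: "\<And>k. k > N \<Longrightarrow> pcoef A k = 0" using pcoef_bound by blast
  have "pcoef (A * pconst a) k = (\<Sum>i\<in>insert k {k - 0..N}. pcoef A i * cshift (of_int i) (pcoef (pconst a) (k - i)))"
    by (rule pcoef_mult_set[of N _ 0]) (auto intro: N)
  also have "\<dots> = (\<Sum>i\<in>insert k {k - 0..N}. if i = k then pcoef A k * cshift (of_int k) a else 0)"
    by (intro sum.cong) auto
  also have "\<dots> = pcoef A k * cshift (of_int k) a" by (subst sum.delta) auto
  finally show ?thesis .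
qed

lemma pcoef_pLam_mult [simp]: "pcoef (pLam n * A) k = cshift (of_int n) (pcoef A (k - n))"
proof -
  obtain N where N: "\<And>k. k > N \<Longrightarrow> pcoef A k = 0" using pcoef_bound by blast
  have "pcoef (pLam n * A) k = (\<Sum>i\<in>insert n {k - N..n}. pcoef (pLam n) i * cshift (of_int i) (pcoef A (k - i)))"
    by (rule pcoef_mult_set[of n _ N]) (auto intro: N)
  also have "\<dots> = (\<Sum>i\<in>insert n {k - N..n}. if i = n then cshift (of_int n) (pcoef A (k - n)) else 0)"
    by (intro sum.cong) auto
  also have "\<dots> = cshift (of_int n) (pcoef A (k - n))" by (subst sum.delta) auto
  finally show ?thesis .
qed

lemma pcoef_mult_pLam [simp]: "pcoef (A * pLam n) k = pcoef A (k - n)"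
proof -
  obtain N where N: "\<And>k. k > N \<Longrightarrow> pcoef A k = 0" using pcoef_bound by blast
  have "pcoef (A * pLam n) k = (\<Sum>i\<in>insert (k - n) {k - n..N}. pcoef A i * cshift (of_int i) (pcoef (pLam n) (k - i)))"
    by (rule pcoef_mult_set[of N _ n]) (auto intro: N)
  also have "\<dots> = (\<Sum>i\<in>insert (k - n) {k - n..N}. if i = k - n then pcoef A (k - n) else 0)"
    by (intro sum.cong) (auto simp: cshift.one)
  also have "\<dots> = pcoef A (k - n)" by (subst sum.delta) auto
  finally show ?thesis .
qed

lemma pconst_mult: "pconst (a * b) = pconst a * pconst b"
  by (rule pdo_eqI) simp

lemma pconst_1: "pconst 1 = 1"
  by (rule pdo_eqI) simp

lemma pconst_add: "pconst (a + b) = pconst a + pconst b"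
  by (rule pdo_eqI) simp

lemma pLam_add: "pLam (m + n) = pLam m * pLam n"
  by (rule pdo_eqI) simp

lemma pLam_0 [simp]: "pLam 0 = 1"
  by (rule pdo_eqI) simp

lemma pconst_central:
  assumes "\<And>k. cshift k a = a"
  shows "A * pconst a = pconst a * A"
  by (rule pdo_eqI) (simp add: assms mult.commute)

definition pdiff :: "nat \<Rightarrow> pdo \<Rightarrow> pdo" where
  "pdiff n A = Abs_pdo (\<lambda>k. mps_deriv n (pcoef A k))"

lemma pcoef_pdiff [simp]: "pcoef (pdiff n A) k = mps_deriv n (pcoef A k)"
proof -
  obtain N where N: "\<And>k. k > N \<Longrightarrow> pcoef A k = 0" using pcoef_bound by blast
  then show ?thesis unfolding pdiff_def by (subst pcoef_Abs_pdo[of N]) auto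
qed

lemma pdiff_mult: "pdiff n (A * B) = pdiff n A * B + A * pdiff n B"
proof (rule pdo_eqI)
  fix k
  obtain a where a: "\<And>k. k > a \<Longrightarrow> pcoef A k = 0" using pcoef_bound by blast
  obtain b where b: "\<And>k. k > b \<Longrightarrow> pcoef B k = 0" using pcoef_bound by blast
  have *: "pcoef (X * Y) k = (\<Sum>i\<in>{k - b..a}. pcoef X i * cshift (of_int i) (pcoef Y (k - i)))"
    if "\<And>k. k > a \<Longrightarrow> pcoef X k = 0" "\<And>k. k > b \<Longrightarrow> pcoef Y k = 0" for X Y
    using that by (intro pcoef_mult_set[of a _ b]) auto
  have "pcoef (pdiff n (A * B)) k
      = (\<Sum>i\<in>{k - b..a}. mps_deriv n (pcoef A i * cshift (of_int i) (pcoef B (k - i))))"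
    by (simp add: *[OF a b] mps_deriv.sum)
  also have "\<dots> = pcoef (pdiff n A * B + A * pdiff n B) k"
    by (simp add: *[of "pdiff n A" B] *[of A "pdiff n B"] a b mps_deriv.mult cshift_deriv sum.distrib)
  finally show "pcoef (pdiff n (A * B)) k = pcoef (pdiff n A * B + A * pdiff n B) k" .
qed

lemma pdiff_add: "pdiff n (A + B) = pdiff n A + pdiff n B"
  by (rule pdo_eqI) (simp add: mps_deriv.add)

lemma pdiff_uminus: "pdiff n (- A) = - pdiff n A"
  by (rule pdo_eqI) (simp add: mps_deriv.uminus)

lemma pdiff_pconst: "pdiff n (pconst a) = pconst (mps_deriv n a)"
  by (rule pdo_eqI) simp

lemma pdiff_pLam [simp]: "pdiff n (pLam m) = 0"
  by (rule pdo_eqI) simp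

lemma pdiff_0 [simp]: "pdiff n 0 = 0" "pdiff n 1 = 0"
  by (rule pdo_eqI; simp)+

subsection \<open>Inverses\<close>

text \<open>The coefficient of \<open>\<Lambda>\<^sup>-\<^sup>n\<close> in the right inverse of \<open>\<Sum>\<^sub>n a\<^sub>n \<Lambda>\<^sup>-\<^sup>n\<close>, where \<open>y\<close> is the inverse of \<open>a\<^sub>0\<close>.\<close>

fun inv_coeff :: "(nat \<Rightarrow> cfun) \<Rightarrow> cfun \<Rightarrow> nat \<Rightarrow> cfun" where
  "inv_coeff a y n = (if n = 0 then y
     else - y * (\<Sum>i\<in>{1..n}. a i * cshift (- of_nat i) (inv_coeff a y (n - i))))"

declare inv_coeff.simps [simp del]

lemma pdo_right_inverse:
  assumes A: "\<And>k. k > 0 \<Longrightarrow> pcoef A k = 0" and y: "pcoef A 0 * y = 1"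
  obtains B where "\<And>k. k > 0 \<Longrightarrow> pcoef B k = 0" "pcoef B 0 = y" "A * B = 1"
proof -
  define a where "a n = pcoef A (- int n)" for n
  define B where "B = Abs_pdo (\<lambda>k. if k \<le> 0 then inv_coeff a y (nat (- k)) else 0)"
  have B: "pcoef B k = (if k \<le> 0 then inv_coeff a y (nat (- k)) else 0)" for k
    unfolding B_def by (subst pcoef_Abs_pdo[of 0]) auto
  have "A * B = 1"
  proof (rule pdo_eqI)
    fix k
    show "pcoef (A * B) k = pcoef 1 k"
    proof (cases "k > 0")
      case True
      then show ?thesis using pcoef_mult_bound[of 0 A 0 B k] A B by simp
    next
      case False
      define n where "n = nat (- k)"
      have k: "k = - int n" using False by (simp add: n_def)
      have "pcoef (A * B) k = (\<Sum>i\<in>{k..0}. pcoef A i * cshift (of_int i) (pcoef B (k - i)))"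
        by (rule pcoef_mult_set[of 0 _ 0]) (auto simp: A B)
      also have "\<dots> = (\<Sum>i\<le>n. a i * cshift (- of_nat i) (inv_coeff a y (n - i)))"
      proof (rule sum.reindex_bij_witness[of _ "\<lambda>i. - int i" "\<lambda>i. nat (- i)"])
        fix i assume "i \<in> {k..0}"
        then have "n - nat (- i) = nat (- (k - i))" "i \<le> 0" "k - i \<le> 0" by (auto simp: k)
        then show "a (nat (- i)) * cshift (- of_nat (nat (- i))) (inv_coeff a y (n - nat (- i)))
            = pcoef A i * cshift (of_int i) (pcoef B (k - i))"
          by (simp add: a_def B)
      qed (auto simp: k)
      also have "\<dots> = a 0 * inv_coeff a y n + (\<Sum>i\<in>{1..n}. a i * cshift (- of_nat i) (inv_coeff a y (n - i)))"
      proof -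
        have "{..n} = insert 0 {1..n}" by auto
        then show ?thesis by simp
      qed
      also have "\<dots> = pcoef 1 k"
      proof (cases "n = 0")
        case True
        then show ?thesis using y by (simp add: a_def k inv_coeff.simps)
      next
        case n: False
        let ?s = "\<Sum>i\<in>{1..n}. a i * cshift (- of_nat i) (inv_coeff a y (n - i))"
        have "inv_coeff a y n = - y * ?s" using n by (simp add: inv_coeff.simps[of a y n])
        then have "a 0 * inv_coeff a y n = - (a 0 * y) * ?s" by (simp add: mult.assoc)
        then show ?thesis using n y by (simp add: a_def k)
      qed
      finally show ?thesis .
    qed
  qed
  then show ?thesis using that[of B] by (simp add: B inv_coeff.simps)
qed

text \<open>A right inverse has itself a right inverse, which must be the given operator.\<close>

lemma pdo_inverse:
  assumes A: "\<And>k. k > 0 \<Longrightarrow> pcoef A k = 0" and y: "pcoef A 0 * y = 1"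
  obtains B where "\<And>k. k > 0 \<Longrightarrow> pcoef B k = 0" "pcoef B 0 = y" "A * B = 1" "B * A = 1"
proof -
  obtain B where B: "\<And>k. k > 0 \<Longrightarrow> pcoef B k = 0" "pcoef B 0 = y" and AB: "A * B = 1"
    using pdo_right_inverse[OF A y] by blast
  have "pcoef B 0 * pcoef A 0 = 1" using B y by (simp add: mult.commute)
  then obtain C where BC: "B * C = 1" using pdo_right_inverse[OF B(1)] by blast
  have "A = C" using AB BC by (metis mult.assoc mult.left_neutral mult.right_neutral)
  then show ?thesis using that B AB BC by blast
qed

subsection \<open>Comparison with the operations on coefficient functions\<close>

lemma pcoef_mult: "pcoef A \<bullet>\<^sub>d pcoef B = pcoef (A * B)"
  by (simp add: times_pdo.rep_eq)

lemma dop_Lambda_pcoef: "dop_Lambda = pcoef (pLam 1)"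
  by (simp add: fun_eq_iff dop_Lambda_def)

lemma dop_one_pcoef: "dop_one = pcoef 1"
  by (simp add: one_pdo.rep_eq)

lemma dop_power_pcoef: "dop_power (pcoef A) n = pcoef (A ^ n)"
  by (induction n) (simp_all add: dop_power_def dop_one_pcoef pcoef_mult)

lemma dop_inv_pcoef:
  assumes "\<And>k. k > 0 \<Longrightarrow> pcoef B k = 0" and "A * B = 1" "B * A = 1"
  shows "dop_inv (pcoef A) = pcoef B"
  unfolding dop_inv_def
proof (rule the_equality)
  show "(\<forall>k>0. pcoef B k = 0) \<and> pcoef A \<bullet>\<^sub>d pcoef B = dop_one \<and> pcoef B \<bullet>\<^sub>d pcoef A = dop_one"
    using assms by (simp add: pcoef_mult dop_one_pcoef)
  fix C assume C: "(\<forall>k>0. C k = 0) \<and> pcoef A \<bullet>\<^sub>d C = dop_one \<and> C \<bullet>\<^sub>d pcoef A = dop_one"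
  then have c: "C = pcoef (Abs_pdo C)" by (subst pcoef_Abs_pdo[of 0]) auto
  then have "A * Abs_pdo C = 1"
    using C by (metis pcoef_mult dop_one_pcoef pcoef_inject)
  then have "Abs_pdo C = B" using assms(3) by (metis mult.assoc mult.left_neutral mult.right_neutral)
  then show "C = pcoef B" using c by simp
qed

subsection \<open>Adjoints\<close>

text \<open>The antiinvolution leaves the ring unless the operator is a finite sum, so it is treated as
  a relation between elements of the ring.\<close>

definition adj :: "complex \<Rightarrow> pdo \<Rightarrow> pdo \<Rightarrow> bool" where
  "adj Q A B \<longleftrightarrow> pcoef B = dop_sharp Q (pcoef A)"

lemma adj_iff: "adj Q A B \<longleftrightarrow> (\<forall>k. pcoef B k = cconst (Q powi (- k)) * cshift (of_int k) (pcoef A (- k)))"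
  by (simp add: adj_def dop_sharp_def fun_eq_iff)

text \<open>Stated for coefficient functions, because the factors on the right hand side may contain
  infinitely many positive powers of \<open>\<Lambda>\<close>.\<close>

lemma dop_sharp_mult:
  assumes "Q \<noteq> 0"
  shows "dop_sharp Q (pcoef (A * B)) = dop_sharp Q (pcoef B) \<bullet>\<^sub>d dop_sharp Q (pcoef A)"
proof
  fix k
  obtain a where a: "\<And>k. k > a \<Longrightarrow> pcoef A k = 0" using pcoef_bound by blast
  obtain b where b: "\<And>k. k > b \<Longrightarrow> pcoef B k = 0" using pcoef_bound by blast
  let ?t = "\<lambda>i. dop_sharp Q (pcoef B) i * cshift (of_int i) (dop_sharp Q (pcoef A) (k - i))"
  have "(dop_sharp Q (pcoef B) \<bullet>\<^sub>d dop_sharp Q (pcoef A)) k = (\<Sum>i\<in>{- b..a + k}. ?t i)"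
    unfolding dop_mult_def
  proof (rule Sum_any.expand_superset)
    show "{i. ?t i \<noteq> 0} \<subseteq> {- b..a + k}"
    proof
      fix i assume "i \<in> {i. ?t i \<noteq> 0}"
      then have "pcoef B (- i) \<noteq> 0" "pcoef A (i - k) \<noteq> 0" by (auto simp: dop_sharp_def)
      then have "\<not> - i > b" "\<not> i - k > a" using a b by blast+
      then show "i \<in> {- b..a + k}" by auto
    qed
  qed simp
  also have "\<dots> = (\<Sum>i\<in>{- k - b..a}. cconst (Q powi (- k)) *
      cshift (of_int k) (pcoef A i * cshift (of_int i) (pcoef B (- k - i))))"
  proof (rule sum.reindex_bij_witness[of _ "\<lambda>i. i + k" "\<lambda>i. i - k"])
    fix i
    have q: "cconst (Q powi - i) * cconst (Q powi (i - k)) = cconst (Q powi - k)"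
      using assms by (simp flip: cconst.mult power_int_add)
    have "?t i = (cconst (Q powi - i) * cconst (Q powi (i - k))) *
        (cshift (of_int i) (pcoef B (- i)) * cshift (of_int k) (pcoef A (i - k)))"
      by (simp add: dop_sharp_def cshift.mult ac_simps)
    then have "?t i = cconst (Q powi - k) * (cshift (of_int i) (pcoef B (- i)) * cshift (of_int k) (pcoef A (i - k)))"
      unfolding q .
    then show "cconst (Q powi (- k)) * cshift (of_int k)
        (pcoef A (i - k) * cshift (of_int (i - k)) (pcoef B (- k - (i - k)))) = ?t i"
      by (simp add: cshift.mult mult.commute)
  qed auto
  also have "\<dots> = cconst (Q powi (- k)) * cshift (of_int k) (pcoef (A * B) (- k))"
    using a b by (subst pcoef_mult_set[of a A b B "{- k - b..a}"])
      (auto simp: cshift.sum sum_distrib_left)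
  finally show "dop_sharp Q (pcoef (A * B)) k = (dop_sharp Q (pcoef B) \<bullet>\<^sub>d dop_sharp Q (pcoef A)) k"
    by (simp add: dop_sharp_def)
qed

lemma adj_mult: "Q \<noteq> 0 \<Longrightarrow> adj Q A A' \<Longrightarrow> adj Q B B' \<Longrightarrow> adj Q (A * B) (B' * A')"
  by (simp add: adj_def dop_sharp_mult times_pdo.rep_eq[of B' A'])

lemma adj_sym: "Q \<noteq> 0 \<Longrightarrow> adj Q A B \<Longrightarrow> adj Q B A"
  by (simp add: adj_iff cshift.mult cconst.one power_int_minus flip: cconst.mult mult.assoc)

lemma adj_add: "adj Q A A' \<Longrightarrow> adj Q B B' \<Longrightarrow> adj Q (A + B) (A' + B')"
  by (simp add: adj_iff cshift.add distrib_left)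

lemma adj_diff: "adj Q A A' \<Longrightarrow> adj Q B B' \<Longrightarrow> adj Q (A - B) (A' - B')"
  by (simp add: adj_iff cshift.diff right_diff_distrib)

lemma adj_pconst: "adj Q (pconst a) (pconst a)"
  by (simp add: adj_iff cconst.one)

lemma adj_pdiff: "adj Q A A' \<Longrightarrow> adj Q (pdiff n A) (pdiff n A')"
  by (simp add: adj_iff mps_deriv.mult cshift_deriv)

section \<open>Symbols\<close>

text \<open>A symbol is a Laurent series in \<open>\<lambda>\<^sup>-\<^sup>1\<close>, the coefficient of \<open>\<lambda>\<^sup>-\<^sup>j\<close> having index \<open>j\<close>.  It
  defines two operators, with \<open>\<lambda>\<close> replaced by \<open>\<Lambda>\<close> and coefficients written on the left, or on the
  right.\<close>

type_synonym symb = "cfun fls"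

definition opL :: "symb \<Rightarrow> pdo" where
  "opL F = Abs_pdo (\<lambda>k. F $$ (- k))"

definition opR :: "symb \<Rightarrow> pdo" where
  "opR F = Abs_pdo (\<lambda>k. cshift (of_int k) (F $$ (- k)))"

lemma pcoef_opL [simp]: "pcoef (opL F) k = F $$ (- k)"
  unfolding opL_def by (subst pcoef_Abs_pdo[of "- fls_subdegree F"]) auto

lemma pcoef_opR [simp]: "pcoef (opR F) k = cshift (of_int k) (F $$ (- k))"
  unfolding opR_def by (subst pcoef_Abs_pdo[of "- fls_subdegree F"]) auto

abbreviation sshift :: "complex \<Rightarrow> symb \<Rightarrow> symb" where
  "sshift c \<equiv> fls_map (cshift c)"

interpretation sshift: ring_morphism "sshift c"
  by (rule ring_morphism_fls_map) (rule cshift.ring_morphism_axioms)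

lemma sshift_nth [simp]: "sshift c F $$ k = cshift c (F $$ k)"
  by (simp add: fls_map_nth)

lemma sshift_sshift [simp]: "sshift c (sshift d F) = sshift (c + d) F"
  by (rule fls_eqI) simp

lemma sshift_0 [simp]: "sshift 0 F = F"
  by (rule fls_eqI) simp

text \<open>All powers of \<open>\<Lambda>\<close> stand between the two coefficients, so that only one overall shift occurs.\<close>

lemma pcoef_opL_opR: "pcoef (opL F * opR G) (- p) = (F * sshift (- of_int p) G) $$ p"
proof -
  let ?N = "fls_subdegree F" and ?M = "fls_subdegree G"
  have "pcoef (opL F * opR G) (- p)
      = (\<Sum>i\<in>{- p + ?M..- ?N}. F $$ (- i) * cshift (- of_int p) (G $$ (p + i)))"
    by (subst pcoef_mult_set[of "- ?N" _ "- ?M" _ "{- p + ?M..- ?N}"]) (auto simp: add.commute)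
  also have "\<dots> = (\<Sum>j\<in>{?N..p - ?M}. F $$ j * cshift (- of_int p) (G $$ (p - j)))"
    by (rule sum.reindex_bij_witness[of _ uminus uminus]) auto
  also have "\<dots> = (F * sshift (- of_int p) G) $$ p"
    by (subst fls_mult_nth_set[of ?N _ ?M]) auto
  finally show ?thesis .
qed

lemma opL_shift: "opL (fls_shift i F) = opL F * pLam i"
  by (rule pdo_eqI) (simp add: add.commute)

lemma pcoef_opL_pLam_opR:
  "pcoef (opL F * pLam i * opR G) (- p) = (F * sshift (- of_int p) G) $$ (p + i)"
  by (simp add: fls_shifted_times_simps(2) pcoef_opL_opR flip: opL_shift)

abbreviation sdiff :: "nat \<Rightarrow> symb \<Rightarrow> symb" where
  "sdiff n \<equiv> fls_map (mps_deriv n)"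

interpretation sdiff: ring_derivation "sdiff n"
  by (rule ring_derivation_fls_map) (rule mps_deriv.ring_derivation_axioms)

lemma sdiff_nth [simp]: "sdiff n F $$ k = mps_deriv n (F $$ k)"
  by (simp add: fls_map_nth)

definition ham_const :: "nat \<Rightarrow> cfun" where
  "ham_const n = cconst (1 / fact (n + 1)) * ceps_inv"

definition Lham :: "nat \<Rightarrow> pdo" where
  "Lham n = pconst (ham_const n) * pLam (int n + 1)"

lemma ham_const_simps [simp]: "cshift c (ham_const n) = ham_const n" "mps_deriv m (ham_const n) = 0"
  by (simp_all add: ham_const_def cshift.mult mps_deriv.mult)

lemma miwa_ham_const: "miwa_coeff n * ham_const n = 1"
proof -
  have "miwa_coeff n * ham_const n = (cconst (fact (n + 1)) * cconst (1 / fact (n + 1))) * (ceps * ceps_inv)"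
    unfolding miwa_coeff_def ham_const_def by (simp only: mult.assoc mult.left_commute)
  then show ?thesis by (simp add: cconst.one flip: cconst.mult del: fact_Suc)
qed

text \<open>The derivative along \<open>q\<^sub>n\<^sub>,\<^sub>1\<close>, conjugated by multiplication with
  \<open>exp (s \<Sum>\<^sub>n \<lambda>\<^sup>n\<^sup>+\<^sup>1 q\<^sub>n\<^sub>,\<^sub>1 / (\<epsilon> (n+1)!))\<close>.\<close>

definition nab :: "complex \<Rightarrow> nat \<Rightarrow> symb \<Rightarrow> symb" where
  "nab s n F = sdiff n F + fls_const (cconst s * ham_const n) * fls_shift (int n + 1) F"

lemma nab_nth: "nab s n F $$ k = mps_deriv n (F $$ k) + cconst s * ham_const n * F $$ (k + int n + 1)"
  by (simp add: nab_def add.assoc)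

lemma opL_nab: "opL (nab s n F) = pdiff n (opL F) + pconst (cconst s) * (opL F * Lham n)"
proof -
  have "opL F * Lham n = pconst (ham_const n) * (opL F * pLam (int n + 1))"
    unfolding Lham_def using pconst_central[of "ham_const n" "opL F"]
    by (simp flip: mult.assoc)
  then show ?thesis
    by (intro pdo_eqI) (simp add: nab_nth add.commute mult.assoc algebra_simps)
qed

lemma opR_nab: "opR (nab s n F) = pdiff n (opR F) + pconst (cconst s) * (Lham n * opR F)"
  unfolding Lham_def
  by (rule pdo_eqI) (simp add: nab_nth cshift.add cshift.mult cshift_deriv mult.assoc algebra_simps)

lemma sshift_nab: "sshift c (nab s n F) = nab s n (sshift c F)"
  by (rule fls_eqI) (simp add: nab_nth cshift.add cshift.mult cshift_deriv)

text \<open>The exponential factors of the two symbols cancel in the product.\<close>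

lemma nab_product:
  "pdiff n (opL F * pLam i * opR G)
   = opL (nab s n F) * pLam i * opR G + opL F * pLam i * opR (nab (- s) n G)"
proof -
  have c: "A * pconst (cconst s) = pconst (cconst s) * A" for A s
    by (rule pconst_central) simp
  have L: "pLam i * Lham n = Lham n * pLam i"
  proof -
    have "pLam i * Lham n = pconst (ham_const n) * (pLam i * pLam (int n + 1))"
      unfolding Lham_def using pconst_central[of "ham_const n" "pLam i"] by (simp add: mult.assoc[symmetric])
    then show ?thesis by (simp add: Lham_def mult.assoc add.commute flip: pLam_add)
  qed
  have "pconst (cconst (- s)) = - pconst (cconst s)"
    by (rule pdo_eqI) (simp add: cconst.uminus)
  then have "opL F * pLam i * (pconst (cconst (- s)) * (Lham n * opR G))
      = - (pconst (cconst s) * (opL F * Lham n)) * pLam i * opR G"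
    by (simp add: mult.assoc[symmetric] c) (simp add: mult.assoc L)
  then show ?thesis
    by (simp add: opL_nab opR_nab pdiff_mult algebra_simps)
qed

section \<open>From the vertex operators to symbols\<close>

subsection \<open>Symbols as power series over Laurent series\<close>

text \<open>A Laurent series in \<open>\<lambda>\<^sup>-\<^sup>1\<close> over power series in the \<open>q\<^sub>n\<^sub>,\<^sub>1\<close>, read as a power series in the \<open>q\<^sub>n\<^sub>,\<^sub>1\<close>
  over Laurent series.  Only series whose order in \<open>\<lambda>\<close> is bounded uniformly in the monomials arise in
  this way; the exponential factor of a vertex operator does not.\<close>

definition symb_series :: "symb \<Rightarrow> (nat, lam) mps" where
  "symb_series f = Abs_mps (\<lambda>M. Abs_fls (\<lambda>j. mcoeff (f $$ j) M))"

lemma symb_series_nth [simp]: "mcoeff (symb_series f) M $$ j = mcoeff (f $$ j) M"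
  unfolding symb_series_def mcoeff_Abs_mps by (rule Abs_fls_nth[of "fls_subdegree f"]) simp

interpretation symb_series: ring_morphism symb_series
proof
  fix f g
  show "symb_series (f + g) = symb_series f + symb_series g"
    by (rule mps_eqI, rule fls_eqI) simp
  show "symb_series 1 = 1"
    by (rule mps_eqI, rule fls_eqI) simp
  show "symb_series (f * g) = symb_series f * symb_series g"
  proof (rule mps_eqI, rule fls_eqI)
    fix M j
    let ?I = "{fls_subdegree f..j - fls_subdegree g}"
    have "mcoeff (symb_series (f * g)) M $$ j
        = (\<Sum>i\<in>?I. \<Sum>A | A \<subseteq># M. mcoeff (f $$ i) A * mcoeff (g $$ (j - i)) (M - A))"
      by (simp add: fls_times_nth(2)[of f g] mcoeff_sum mcoeff_mult)
    also have "\<dots> = (\<Sum>A | A \<subseteq># M. \<Sum>i\<in>?I. mcoeff (f $$ i) A * mcoeff (g $$ (j - i)) (M - A))"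
      by (rule sum.swap)
    also have "\<dots> = (\<Sum>A | A \<subseteq># M. (mcoeff (symb_series f) A * mcoeff (symb_series g) (M - A)) $$ j)"
      by (intro sum.cong refl, subst fls_mult_nth_set[of "fls_subdegree f" _ "fls_subdegree g" _ ?I]) auto
    also have "\<dots> = mcoeff (symb_series f * symb_series g) M $$ j"
      by (simp add: mcoeff_mult fls_nth_sum)
    finally show "mcoeff (symb_series (f * g)) M $$ j = mcoeff (symb_series f * symb_series g) M $$ j" .
  qed
qed

lemma symb_series_deriv: "mps_deriv n (symb_series f) = symb_series (sdiff n f)"
  by (rule mps_eqI, rule fls_eqI) (simp only: mcoeff_deriv fls_of_nat fls_mult_const_nth symb_series_nth sdiff_nth)

lemma lam_series_symb: "lam_series F = symb_series (fps_to_fls (Abs_fps F))"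
proof (rule mps_eqI, rule fls_eqI)
  fix M j
  have "mcoeff (lam_series F) M $$ j = (if j \<ge> 0 then mcoeff (F (nat j)) M else 0)"
    unfolding lam_series_def mcoeff_Abs_mps by (rule Abs_fls_nth[of 0]) simp
  then show "mcoeff (lam_series F) M $$ j = mcoeff (symb_series (fps_to_fls (Abs_fps F))) M $$ j"
    by simp
qed

lemma lam_shift_fls_map: "lam_shift c = fls_map (lshift c)"
  by (simp add: fun_eq_iff lam_shift_def fls_map_def)

interpretation lam_shift: ring_morphism "lam_shift c"
  unfolding lam_shift_fls_map by (rule ring_morphism_fls_map) (rule lshift.ring_morphism_axioms)

lemma lam_shift_symb: "mps_map (lam_shift c) (symb_series f) = symb_series (sshift c f)"
  by (rule mps_eqI, rule fls_eqI, simp add: lam_shift_fls_map fls_map_nth) (simp add: cshift_def)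

interpretation lam_const: ring_morphism lam_const
  by unfold_locales
     (simp_all only: lam_const_def lconst_def smf_const.add smf_const.mult smf_const.one
       fls_const.add fls_const.mult fls_const.one)

subsection \<open>The exponential factor of the vertex operators\<close>

definition vcoeff :: "nat \<Rightarrow> lam" where
  "vcoeff n = lam_const (1 / fact (n + 1)) * fls_const fls_X_inv * fls_X_inv ^ (n + 1)"

lemma vcoeff_mult: "vcoeff n * a = fls_shift (int n + 1) (fls_const (lconst (1 / fact (n + 1)) * fls_X_inv) * a)"
  unfolding vcoeff_def lam_const_def
  by (simp only: fls_const_mult_const mult.assoc fls_X_inv_power_times_conv_shift fls_shifted_times_simps)
     (simp add: add.commute)

lemma lam_shift_vcoeff: "lam_shift c (vcoeff n) = vcoeff n"
proof -
  have 1: "lam_shift c (fls_const a) = fls_const a" if "\<And>k. smf_deriv (a $$ k) = 0" for a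
    by (rule fls_eqI) (simp add: lam_shift_fls_map fls_map_nth lshift_const[OF that])
  have "lam_shift c fls_X_inv = fls_X_inv"
    by (rule fls_eqI) (simp add: lam_shift_fls_map fls_map_nth lshift.one)
  then show ?thesis
    by (simp add: vcoeff_def lam_shift.mult lam_shift.power lam_const_def 1 lconst_def
      del: fls_const_mult_const)
qed

lemma vertex_exponent_coeff: "mcoeff vertex_exponent M = Sum_any (\<lambda>n. if M = {#n#} then vcoeff n else 0)"
  by (simp only: vertex_exponent_def vcoeff_def mcoeff_Abs_mps)

lemma vertex_exponent_deriv: "mps_deriv n vertex_exponent = mps_const (vcoeff n)"
proof (rule mps_eqI)
  fix M
  show "mcoeff (mps_deriv n vertex_exponent) M = mcoeff (mps_const (vcoeff n)) M"
  proof (cases "M = {#}")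
    case True
    have "mcoeff vertex_exponent {#n#} = Sum_any (\<lambda>k. if n = k then vcoeff k else 0)"
      unfolding vertex_exponent_coeff by (rule Sum_any.cong) auto
    also have "\<dots> = vcoeff n" by (rule Sum_any.delta')
    finally show ?thesis using True by simp
  next
    case False
    then have "(\<lambda>k. if M + {#n#} = {#k#} then vcoeff k else 0) = (\<lambda>_. 0)"
      by (auto simp: fun_eq_iff)
    then have "mcoeff vertex_exponent (M + {#n#}) = 0"
      unfolding vertex_exponent_coeff by (simp only: Sum_any.neutral)
    then show ?thesis using False by simp
  qed
qed

lemma vertex_multiplier_empty: "mcoeff (vertex_multiplier s) {#} = 1"
  by (simp add: vertex_multiplier_def lam_const.one)

text \<open>The exponential is handled through its logarithmic derivatives and \<open>mps_ode_unique\<close>.\<close>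

lemma vertex_multiplier_deriv:
  "mps_deriv n (vertex_multiplier s) = mps_const (lam_const s * vcoeff n) * vertex_multiplier s"
proof (rule mps_eqI)
  fix M
  let ?v = vertex_exponent
  have "mcoeff (mps_deriv n (vertex_multiplier s)) M
      = (\<Sum>k\<le>Suc (size M). lam_const (s ^ k / fact k) * mcoeff (mps_deriv n (?v ^ k)) M)"
    by (simp add: vertex_multiplier_def sum_distrib_left algebra_simps del: sum.atMost_Suc)
  also have "\<dots> = (\<Sum>k\<le>size M. lam_const (s ^ Suc k / fact (Suc k)) * mcoeff (mps_deriv n (?v ^ Suc k)) M)"
    by (subst sum.atMost_Suc_shift) simp
  also have "\<dots> = (\<Sum>k\<le>size M. (lam_const s * vcoeff n) * (lam_const (s ^ k / fact k) * mcoeff (?v ^ k) M))"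
  proof (intro sum.cong refl)
    fix k
    have "mps_deriv n (?v ^ Suc k) = mps_const (of_nat (Suc k) * vcoeff n) * ?v ^ k"
      unfolding mps_deriv.power vertex_exponent_deriv mps_const.mult mps_const.of_nat
      by (simp only: ac_simps)
    then have "lam_const (s ^ Suc k / fact (Suc k)) * mcoeff (mps_deriv n (?v ^ Suc k)) M
        = (lam_const (s ^ Suc k / fact (Suc k)) * of_nat (Suc k)) * vcoeff n * mcoeff (?v ^ k) M"
      by (simp only: mcoeff_const_mult mult.assoc)
    also have "lam_const (s ^ Suc k / fact (Suc k)) * of_nat (Suc k) = lam_const s * lam_const (s ^ k / fact k)"
    proof -
      have "s ^ Suc k / fact (Suc k) * of_nat (Suc k) = s * (s ^ k / fact k)"
        using of_nat_neq_0[of k, where 'a = complex] by (simp add: divide_simps del: of_nat_Suc)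
      then show ?thesis by (simp only: lam_const.mult[symmetric] lam_const.of_nat[symmetric])
    qed
    finally show "lam_const (s ^ Suc k / fact (Suc k)) * mcoeff (mps_deriv n (?v ^ Suc k)) M
        = (lam_const s * vcoeff n) * (lam_const (s ^ k / fact k) * mcoeff (?v ^ k) M)"
      by (simp only: ac_simps)
  qed
  also have "\<dots> = mcoeff (mps_const (lam_const s * vcoeff n) * vertex_multiplier s) M"
    by (simp add: vertex_multiplier_def sum_distrib_left)
  finally show "mcoeff (mps_deriv n (vertex_multiplier s)) M
      = mcoeff (mps_const (lam_const s * vcoeff n) * vertex_multiplier s) M" .
qed

lemma vertex_multiplier_inverse: "vertex_multiplier s * vertex_multiplier (- s) = 1"
proof (rule mps_ode_unique[of _ "\<lambda>_. 0"])
  fix n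
  have "lam_const (- s) * vcoeff n = - (lam_const s * vcoeff n)"
    by (simp add: lam_const.uminus)
  then show "mps_deriv n (vertex_multiplier s * vertex_multiplier (- s))
      = mps_const 0 * (vertex_multiplier s * vertex_multiplier (- s))"
    by (simp add: mps_deriv.mult vertex_multiplier_deriv mps_const.uminus)
qed (simp_all add: vertex_multiplier_empty)

lemma vertex_multiplier_shift:
  "mps_map (lam_shift c) (vertex_multiplier s) = vertex_multiplier s"
proof (rule mps_ode_unique[of _ "\<lambda>n. lam_const s * vcoeff n"])
  fix n
  interpret m: ring_morphism "mps_map (lam_shift c) :: (nat, lam) mps \<Rightarrow> _"
    by (rule ring_morphism_mps_map) (rule lam_shift.ring_morphism_axioms)
  have "lam_shift c (lam_const s) = lam_const s"
    by (rule fls_eqI) (simp add: lam_shift_fls_map fls_map_nth lam_const_def lconst_def lshift_const)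
  then show "mps_deriv n (mps_map (lam_shift c) (vertex_multiplier s))
      = mps_const (lam_const s * vcoeff n) * mps_map (lam_shift c) (vertex_multiplier s)"
    unfolding mps_deriv_map[OF lam_shift.ring_morphism_axioms] vertex_multiplier_deriv m.mult
    by (simp only: mps_map_const[of "lam_shift c"] lam_shift.zero lam_shift.mult lam_shift_vcoeff)
qed (simp_all add: vertex_multiplier_empty vertex_multiplier_deriv lam_shift.one)

lemma vertex_factor_deriv:
  "mps_deriv n (vertex_multiplier s * symb_series f) = vertex_multiplier s * symb_series (nab s n f)"
proof -
  have "mps_const (lam_const s * vcoeff n) * symb_series f
      = symb_series (fls_const (cconst s * ham_const n) * fls_shift (int n + 1) f)"
  proof (rule mps_eqI, rule fls_eqI)
    fix M j
    have "mcoeff (mps_const (lam_const s * vcoeff n) * symb_series f) M $$ j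
        = lconst s * (lconst (1 / fact (n + 1)) * fls_X_inv * mcoeff (f $$ (j + int n + 1)) M)"
      by (simp only: mcoeff_const_mult mult.assoc[of "fls_const (lconst s)"] vcoeff_mult lam_const_def fls_mult_const_nth
         fls_shift_nth symb_series_nth add.assoc)
    also have "\<dots> = mcoeff (cconst s * ham_const n * f $$ (j + int n + 1)) M"
      by (simp only: cconst_def ham_const_def ceps_inv_def mcoeff_const_mult mult.assoc)
    finally show "mcoeff (mps_const (lam_const s * vcoeff n) * symb_series f) M $$ j
      = mcoeff (symb_series (fls_const (cconst s * ham_const n) * fls_shift (int n + 1) f)) M $$ j"
      by (simp add: add.assoc)
  qed
  then show ?thesis
    by (simp only: mps_deriv.mult vertex_multiplier_deriv symb_series_deriv nab_def symb_series.add
        distrib_left[of "vertex_multiplier s"] mult.assoc mult.left_commute[of _ "vertex_multiplier s"] add.commute)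
qed

subsection \<open>The change of variables\<close>

text \<open>The coefficient of a monomial \<open>B\<close> in \<open>y\<close>, as a power series in \<open>x\<close>.\<close>

definition ycoeff :: "nat multiset \<Rightarrow> (nat + nat, lam) mps \<Rightarrow> (nat, lam) mps" where
  "ycoeff B E = Abs_mps (\<lambda>A. mcoeff E (image_mset Inl A + image_mset Inr B))"

lemma mcoeff_ycoeff [simp]: "mcoeff (ycoeff B E) A = mcoeff E (image_mset Inl A + image_mset Inr B)"
  by (simp add: ycoeff_def)

lemma ycoeff_diff: "ycoeff B (E - F) = ycoeff B E - ycoeff B F"
  by (rule mps_eqI) simp

lemma count_image_Inr: "count (image_mset Inl A + image_mset Inr B) (Inr n) = count B n"
proof -
  have "Inr n \<notin># image_mset Inl A" by auto
  moreover have "count (image_mset Inr B) (Inr n) = count B n"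
    by (induction B) auto
  ultimately show ?thesis by (simp add: not_in_iff del: set_image_mset)
qed

lemma ycoeff_deriv: "of_nat (Suc (count B n)) * ycoeff (B + {#n#}) E = ycoeff B (mps_deriv (Inr n) E)"
proof (rule mps_eqI)
  fix A
  have "mcoeff (of_nat (Suc (count B n)) * ycoeff (B + {#n#}) E) A
      = of_nat (Suc (count B n)) * mcoeff (ycoeff (B + {#n#}) E) A"
    by (simp only: mcoeff_const_mult flip: mps_const.of_nat)
  then show "mcoeff (of_nat (Suc (count B n)) * ycoeff (B + {#n#}) E) A = mcoeff (ycoeff B (mps_deriv (Inr n) E)) A"
    by (simp only: mcoeff_ycoeff mcoeff_deriv count_image_Inr) simp
qed

lemma ycoeff_empty_mult: "ycoeff {#} (E * F) = ycoeff {#} E * ycoeff {#} F"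
proof (rule mps_eqI)
  fix A :: "nat multiset"
  have s: "{C. C \<subseteq># image_mset (Inl :: nat \<Rightarrow> nat + nat) A} = image_mset Inl ` {A'. A' \<subseteq># A}"
    for A :: "nat multiset"
  proof (intro equalityI subsetI)
    fix C :: "(nat + nat) multiset" assume "C \<in> {C. C \<subseteq># image_mset Inl A}"
    then obtain D where "image_mset Inl A = C + D" by (auto simp: subset_mset.le_iff_add)
    then obtain A' A'' where "A = A' + A''" "C = image_mset Inl A'"
      using image_mset_eq_plusD by metis
    then show "C \<in> image_mset Inl ` {A'. A' \<subseteq># A}" by auto
  qed (auto intro: image_mset_subseteq_mono)
  have inj: "inj_on (image_mset (Inl :: nat \<Rightarrow> nat + nat)) X" for X
    by (rule inj_on_inverseI[of _ "image_mset projl"]) (simp add: multiset.map_comp comp_def)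
  have "mcoeff (ycoeff {#} (E * F)) A = (\<Sum>A' | A' \<subseteq># A.
      mcoeff E (image_mset Inl A') * mcoeff F (image_mset Inl A - image_mset Inl A'))"
    by (simp add: mcoeff_mult s sum.reindex inj)
  also have "\<dots> = mcoeff (ycoeff {#} E * ycoeff {#} F) A"
    by (simp add: mcoeff_mult) (intro sum.cong refl, simp add: image_mset_Diff)
  finally show "mcoeff (ycoeff {#} (E * F)) A = mcoeff (ycoeff {#} E * ycoeff {#} F) A" .
qed

lemma mcoeff_var_mult:
  "mcoeff (mps_var v * F) N = (if v \<in># N then mcoeff (F :: ('v, 'a::comm_ring_1) mps) (N - {#v#}) else 0)"
proof -
  have "mcoeff (mps_var v * F) N = (\<Sum>A | A \<subseteq># N. if A = {#v#} then mcoeff F (N - {#v#}) else 0)"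
    unfolding mcoeff_mult by (intro sum.cong) (auto simp: mps_var_def)
  then show ?thesis by (subst (asm) sum.delta[OF finite_submultisets]) simp
qed

lemma mps_deriv_var: "mps_deriv u (mps_var v) = (if u = v then 1 else 0 :: ('v, 'a::comm_ring_1) mps)"
  by (rule mps_eqI) (auto simp: mps_var_def)

definition subst_mono :: "int \<Rightarrow> nat multiset \<Rightarrow> (nat + nat, lam) mps" where
  "subst_mono s M = (\<Prod>n\<in>#M. mps_var (Inl n) + of_int s * mps_var (Inr n))"

text \<open>Only the monomial \<open>merge N\<close> in \<open>q\<close> contributes to the monomial \<open>N\<close> in \<open>x\<close>, \<open>y\<close> after the
  substitution.\<close>

abbreviation merge :: "(nat + nat) multiset \<Rightarrow> nat multiset" where
  "merge N \<equiv> image_mset (case_sum (\<lambda>n. n) (\<lambda>n. n)) N"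

lemma mps_const_of_int: "mps_const (of_int s) = (of_int s :: ('v, 'a::comm_ring_1) mps)"
  by (cases s) (simp_all add: mps_const.of_nat mps_const.diff mps_const.uminus mps_const.one)

lemma mcoeff_subst_mono_add:
  "mcoeff (subst_mono s (add_mset n M)) N =
     (if Inl n \<in># N then mcoeff (subst_mono s M) (N - {#Inl n#}) else 0) +
     of_int s * (if Inr n \<in># N then mcoeff (subst_mono s M) (N - {#Inr n#}) else 0)"
proof -
  have "subst_mono s (add_mset n M)
      = mps_var (Inl n) * subst_mono s M + mps_const (of_int s) * (mps_var (Inr n) * subst_mono s M)"
    by (simp add: subst_mono_def mps_const_of_int algebra_simps)
  then show ?thesis by (simp only: mcoeff_simps mcoeff_const_mult mcoeff_var_mult)
qed

lemma subst_mono_support: "mcoeff (subst_mono s M) N \<noteq> 0 \<Longrightarrow> M = merge N"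
proof (induction M arbitrary: N)
  case empty
  then show ?case by (simp add: subst_mono_def split: if_splits)
next
  case (add n M)
  have if_D: "c \<and> x \<noteq> 0" if "(if c then x else 0) \<noteq> 0" for c and x :: lam
    using that by (auto split: if_splits)
  have "(if Inl n \<in># N then mcoeff (subst_mono s M) (N - {#Inl n#}) else 0) \<noteq> 0
      \<or> (if Inr n \<in># N then mcoeff (subst_mono s M) (N - {#Inr n#}) else 0) \<noteq> 0"
    (is "?a \<noteq> 0 \<or> ?b \<noteq> 0")
  proof (rule ccontr)
    assume "\<not> (?a \<noteq> 0 \<or> ?b \<noteq> 0)"
    then have "?a = 0" "?b = 0" by blast+
    then show False
      using add.prems by (simp only: mcoeff_subst_mono_add mult_zero_right add_0) blast
  qed
  then consider "Inl n \<in># N" "mcoeff (subst_mono s M) (N - {#Inl n#}) \<noteq> 0"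
    | "Inr n \<in># N" "mcoeff (subst_mono s M) (N - {#Inr n#}) \<noteq> 0"
    using if_D by blast
  then show ?case
  proof cases
    case 1
    then obtain N' where "N = add_mset (Inl n) N'" by (metis insert_DiffM)
    then show ?thesis using add.IH[of N'] 1 by simp
  next
    case 2
    then obtain N' where "N = add_mset (Inr n) N'" by (metis insert_DiffM)
    then show ?thesis using add.IH[of N'] 2 by simp
  qed
qed

lemma subst_mono_deriv:
  "mps_deriv (Inr n) (subst_mono s M) = of_int s * of_nat (count M n) * subst_mono s (M - {#n#})"
proof (induction M)
  case empty
  then show ?case by (simp add: subst_mono_def)
next
  case (add m M)
  let ?x = "\<lambda>m. mps_var (Inl m) + of_int s * mps_var (Inr m) :: (nat + nat, lam) mps"
  have c: "mps_deriv v (of_int s) = 0" for v :: "nat + nat"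
    by (simp flip: mps_const_of_int)
  have a: "subst_mono s (add_mset m M) = ?x m * subst_mono s M" for m M
    by (simp add: subst_mono_def)
  have d: "mps_deriv (Inr n) (?x m) = (if n = m then of_int s else 0)"
    by (simp add: mps_deriv.add mps_deriv.mult c mps_deriv_var)
  have "mps_deriv (Inr n) (subst_mono s (add_mset m M)) = (if n = m then of_int s else 0) * subst_mono s M
      + of_int s * (of_nat (count M n) * (?x m * subst_mono s (M - {#n#})))"
    unfolding a mps_deriv.mult d add.IH by (simp only: ac_simps)
  also have "of_nat (count M n) * (?x m * subst_mono s (M - {#n#}))
      = of_nat (count M n) * subst_mono s (add_mset m M - {#n#})"
  proof (cases "n \<in># M")
    case True
    then have "add_mset m (M - {#n#}) = add_mset m M - {#n#}" by auto
    then show ?thesis by (metis a)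
  next
    case False
    then show ?thesis by (simp add: not_in_iff)
  qed
  finally show ?case by (auto simp: algebra_simps)
qed

lemma mcoeff_subst_xy: "mcoeff (subst_xy s F) N = mcoeff F (merge N) * mcoeff (subst_mono s (merge N)) N"
proof -
  have "mcoeff (subst_xy s F) N = Sum_any (\<lambda>M. mcoeff F M * mcoeff (subst_mono s M) N)"
    by (simp add: subst_xy_def subst_mono_def)
  also have "\<dots> = (\<Sum>M\<in>{merge N}. mcoeff F M * mcoeff (subst_mono s M) N)"
  proof (rule Sum_any.expand_superset)
    show "{M. mcoeff F M * mcoeff (subst_mono s M) N \<noteq> 0} \<subseteq> {merge N}"
    proof
      fix M assume "M \<in> {M. mcoeff F M * mcoeff (subst_mono s M) N \<noteq> 0}"
      then have "mcoeff (subst_mono s M) N \<noteq> 0" by auto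
      then show "M \<in> {merge N}" using subst_mono_support by blast
    qed
  qed simp
  finally show ?thesis by simp
qed

lemma subst_xy_deriv: "mps_deriv (Inr n) (subst_xy s F) = of_int s * subst_xy s (mps_deriv n F)"
proof (rule mps_eqI)
  fix N
  let ?M = "merge N" and ?a = "mcoeff F (merge N + {#n#})"
  have "mcoeff (mps_deriv (Inr n) (subst_xy s F)) N
      = ?a * mcoeff (mps_deriv (Inr n) (subst_mono s (?M + {#n#}))) N"
    by (simp add: mcoeff_subst_xy)
  also have "mcoeff (mps_deriv (Inr n) (subst_mono s (?M + {#n#}))) N
      = of_int s * of_nat (count ?M n + 1) * mcoeff (subst_mono s ?M) N"
    unfolding subst_mono_deriv
    by (simp only: mcoeff_const_mult flip: mps_const_of_int mps_const.of_nat mps_const.mult) simp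
  also have "?a * (of_int s * of_nat (count ?M n + 1) * mcoeff (subst_mono s ?M) N)
      = of_int s * mcoeff (subst_xy s (mps_deriv n F)) N"
    by (simp only: mcoeff_subst_xy mcoeff_deriv ac_simps)
  also have "\<dots> = mcoeff (of_int s * subst_xy s (mps_deriv n F)) N"
    by (simp only: mcoeff_const_mult flip: mps_const_of_int)
  finally show "mcoeff (mps_deriv (Inr n) (subst_xy s F)) N = mcoeff (of_int s * subst_xy s (mps_deriv n F)) N" .
qed

lemma ycoeff_empty_subst_xy: "ycoeff {#} (subst_xy s F) = F"
proof (rule mps_eqI)
  fix A
  have "mcoeff (subst_mono s A) (image_mset Inl A) = 1"
  proof (induction A)
    case empty
    then show ?case by (simp add: subst_mono_def)
  next
    case (add n A)
    have "Inr n \<notin># image_mset Inl (add_mset n A)" by auto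
    then show ?case using add unfolding mcoeff_subst_mono_add by (simp del: set_image_mset)
  qed
  then show "mcoeff (ycoeff {#} (subst_xy s F)) A = mcoeff F A"
    by (simp add: mcoeff_subst_xy multiset.map_comp comp_def)
qed

definition tensor :: "(nat, lam) mps \<Rightarrow> (nat, lam) mps \<Rightarrow> (nat + nat, lam) mps" where
  "tensor F G = subst_xy 1 F * subst_xy (- 1) G"

text \<open>The chain rule for \<open>F(x + y) G(x - y)\<close>; together with \<open>ycoeff_deriv\<close> it reduces all
  coefficients in \<open>y\<close> to values at \<open>y = 0\<close> of products of derivatives.\<close>

lemma tensor_deriv: "mps_deriv (Inr n) (tensor F G) = tensor (mps_deriv n F) G - tensor F (mps_deriv n G)"
  by (simp add: tensor_def mps_deriv.mult subst_xy_deriv)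

lemma ycoeff_empty_tensor: "ycoeff {#} (tensor F G) = F * G"
  by (simp add: tensor_def ycoeff_empty_mult ycoeff_empty_subst_xy)

subsection \<open>The bilinear expression in terms of symbols\<close>

definition symb_power :: "complex \<Rightarrow> int \<Rightarrow> symb" where
  "symb_power r m = fls_const (cconst (r powi (- m))) * fls_X_intpow (- m)"

lemma symb_power_mult_nth: "(symb_power r m * F) $$ i = cconst (r powi (- m)) * F $$ (i + m)"
proof -
  have "symb_power r m * F = fls_const (cconst (r powi (- m))) * fls_shift m F"
    by (simp add: symb_power_def mult.assoc fls_shifted_times_simps)
  then show ?thesis by simp
qed

lemma mps_const_lam_power: "mps_const (lam_power r m) = symb_series (symb_power r m)"
proof (rule mps_eqI, rule fls_eqI)
  fix M j
  have 1: "lam_power r m $$ j = lconst (r powi (- m)) * (1 :: lam) $$ (j + m)"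
    by (simp add: lam_power_def lam_const_def)
  have "symb_power r m $$ j = cconst (r powi (- m)) * (1 :: symb) $$ (j + m)"
    using symb_power_mult_nth[of r m 1 j] by simp
  then show "mcoeff (mps_const (lam_power r m)) M $$ j = mcoeff (symb_series (symb_power r m)) M $$ j"
    by (simp add: 1 cconst_def)
qed

lemma mps_const_fls_X: "mps_const fls_X = symb_series fls_X"
  by (rule mps_eqI, rule fls_eqI) simp

text \<open>The bilinear expression at \<open>y = 0\<close>, where the exponential factors cancel, and then for general
  \<open>y\<close>.  The two terms contain different symbols because differentiation with respect to \<open>y\<close> treats
  them differently.\<close>

definition bilin_symb :: "complex \<Rightarrow> int \<Rightarrow> symb \<Rightarrow> symb \<Rightarrow> symb \<Rightarrow> symb \<Rightarrow> symb" where
  "bilin_symb r m F G F' G' = fls_X *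
     (symb_power r m * (sshift (of_int m / 2) F * sshift (- of_int m / 2) G)
      - symb_power r (- m) * (sshift (of_int m / 2) G' * sshift (- of_int m / 2) F'))"

definition bilin :: "complex \<Rightarrow> int \<Rightarrow> symb \<Rightarrow> symb \<Rightarrow> symb \<Rightarrow> symb \<Rightarrow> (nat + nat, lam) mps" where
  "bilin r m F G F' G' =
     (let V = \<lambda>s F. vertex_multiplier s * symb_series F in
      mps_const fls_X *
     (mps_const (lam_power r m) *
        tensor (V (1/2) (sshift (of_int m / 2) F)) (V (- 1/2) (sshift (- of_int m / 2) G))
      - mps_const (lam_power r (- m)) *
        tensor (V (- 1/2) (sshift (of_int m / 2) G')) (V (1/2) (sshift (- of_int m / 2) F'))))"

text \<open>The symbols of \<open>P\<^sub>L\<close> and \<open>P\<^sub>R\<close>, multiplied by \<open>\<tau>(x - \<epsilon>/2)\<close>.\<close>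

definition miwaL :: "cfun \<Rightarrow> symb" where
  "miwaL \<tau> = fps_to_fls (miwa_series (- 1) (cshift (- 1/2) \<tau>))"

definition miwaR :: "cfun \<Rightarrow> symb" where
  "miwaR \<tau> = fps_to_fls (miwa_series 1 (cshift (1/2) \<tau>))"

lemma hirota_bilin: "hirota r m \<tau> = bilin r m (miwaL \<tau>) (miwaR \<tau>) (miwaL \<tau>) (miwaR \<tau>)"
proof -
  interpret m: ring_morphism "mps_map (lam_shift c) :: (nat, lam) mps \<Rightarrow> _" for c
    by (rule ring_morphism_mps_map) (rule lam_shift.ring_morphism_axioms)
  have v: "vertex 1 \<tau> = vertex_multiplier (1/2) * symb_series (miwaL \<tau>)"
    "vertex (- 1) \<tau> = vertex_multiplier (- 1/2) * symb_series (miwaR \<tau>)"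
    by (simp_all add: vertex_def lam_series_symb miwaL_def miwaR_def miwa_series_def)
  show ?thesis
    unfolding hirota_def bilin_def tensor_at_def tensor_def[symmetric] v m.mult
      vertex_multiplier_shift lam_shift_symb Let_def ..
qed

lemma ycoeff_const_mult: "ycoeff B (mps_const a * E) = mps_const a * ycoeff B E"
  by (rule mps_eqI) simp

lemma bilin_ycoeff_empty: "ycoeff {#} (bilin r m F G F' G') = symb_series (bilin_symb r m F G F' G')"
proof -
  have v: "vertex_multiplier s * a * (vertex_multiplier t * b) = a * b" if "t = - s" for s t a b
  proof -
    have "vertex_multiplier s * a * (vertex_multiplier t * b)
        = (vertex_multiplier s * vertex_multiplier (- s)) * (a * b)"
      unfolding that by (simp only: ac_simps)
    then show ?thesis by (simp add: vertex_multiplier_inverse)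
  qed
  have v1: "vertex_multiplier (1/2) * a * (vertex_multiplier (- 1/2) * b) = a * b"
    and v2: "vertex_multiplier (- 1/2) * a * (vertex_multiplier (1/2) * b) = a * b" for a b
    by (rule v, simp)+
  show ?thesis
    unfolding bilin_def bilin_symb_def Let_def ycoeff_const_mult ycoeff_diff ycoeff_empty_tensor v1 v2
    by (simp only: mps_const_lam_power mps_const_fls_X symb_series.mult symb_series.diff)
qed

lemma bilin_ycoeff_Suc:
  "of_nat (Suc (count B n)) * ycoeff (B + {#n#}) (bilin r m F G F' G') =
     ycoeff B (bilin r m (nab (1/2) n F) G F' (nab (- 1/2) n G'))
     - ycoeff B (bilin r m F (nab (- 1/2) n G) (nab (1/2) n F') G')"
proof -
  have "mps_deriv (Inr n) (bilin r m F G F' G') =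
     bilin r m (nab (1/2) n F) G F' (nab (- 1/2) n G')
     - bilin r m F (nab (- 1/2) n G) (nab (1/2) n F') G'"
    unfolding bilin_def Let_def
    by (simp only: mps_deriv_const_mult mps_deriv.diff tensor_deriv vertex_factor_deriv sshift_nab)
       (simp add: algebra_simps)
  then show ?thesis by (simp only: ycoeff_deriv ycoeff_diff)
qed

text \<open>The powers of \<open>\<lambda>\<close> in a symbol are bounded above, so being a polynomial in \<open>\<lambda>\<close> amounts to this.\<close>

definition symb_regular :: "symb \<Rightarrow> bool" where
  "symb_regular F \<longleftrightarrow> (\<forall>j>0. F $$ j = 0)"

lemma symb_regular_diff: "symb_regular F \<Longrightarrow> symb_regular G \<Longrightarrow> symb_regular (F - G)"
  by (simp add: symb_regular_def)

lemma symb_regular_cconst: "symb_regular F \<Longrightarrow> symb_regular (fls_const a * F)"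
  by (simp add: symb_regular_def)

abbreviation nabs :: "complex \<Rightarrow> nat list \<Rightarrow> symb \<Rightarrow> symb" where
  "nabs s ns F \<equiv> foldr (nab s) ns F"

text \<open>That the coefficients come from symbols \<open>K\<close> provides the bound on the powers of \<open>\<lambda>\<close> which is
  uniform in the monomials in \<open>x\<close>.\<close>

lemma bilin_ycoeff:
  assumes "\<And>ns ks. symb_regular (bilin_symb r m (nabs (1/2) ns F) (nabs (- 1/2) ks G)
     (nabs (1/2) ks F') (nabs (- 1/2) ns G'))"
  shows "\<exists>K. symb_regular K \<and> ycoeff B (bilin r m F G F' G') = symb_series K"
  using assms
proof (induction B arbitrary: F G F' G')
  case empty
  then show ?case using bilin_ycoeff_empty[of r m F G F' G'] empty[of "[]" "[]"] by auto
next
  case (add n B)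
  obtain K1 where K1: "symb_regular K1"
    "ycoeff B (bilin r m (nab (1/2) n F) G F' (nab (- 1/2) n G')) = symb_series K1"
    using add.IH[of "nab (1/2) n F" G F' "nab (- 1/2) n G'"] add.prems[of "_ @ [n]" "_"] by auto
  obtain K2 where K2: "symb_regular K2"
    "ycoeff B (bilin r m F (nab (- 1/2) n G) (nab (1/2) n F') G') = symb_series K2"
    using add.IH[of F "nab (- 1/2) n G" "nab (1/2) n F'" G'] add.prems[of "_" "_ @ [n]"] by auto
  define c where "c = cconst (1 / of_nat (Suc (count B n)))"
  have "of_nat (Suc (count B n)) * c = 1"
    using of_nat_neq_0[of "count B n", where 'a = complex]
    by (simp add: c_def cconst.one del: of_nat_Suc flip: cconst.of_nat cconst.mult)
  then have c: "of_nat (Suc (count B n)) * fls_const c = 1"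
    by (simp add: fls_of_nat del: of_nat_Suc)
  let ?K = "fls_const c * (K1 - K2)"
  have "of_nat (Suc (count B n)) * ycoeff (B + {#n#}) (bilin r m F G F' G') = symb_series (K1 - K2)"
    by (simp only: bilin_ycoeff_Suc K1 K2 symb_series.diff)
  also have "\<dots> = of_nat (Suc (count B n)) * symb_series ?K"
  proof -
    have "K1 - K2 = of_nat (Suc (count B n)) * ?K"
      by (simp only: mult.assoc[symmetric] c mult_1)
    then have "symb_series (K1 - K2) = symb_series (of_nat (Suc (count B n)) * ?K)"
      by (rule arg_cong)
    then show ?thesis by (simp only: symb_series.mult symb_series.of_nat)
  qed
  finally have "ycoeff (B + {#n#}) (bilin r m F G F' G') = symb_series ?K"
    by (rule of_nat_mult_cancel)
  then show ?case using K1 K2 by (auto intro!: exI[of _ ?K] symb_regular_cconst symb_regular_diff)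
qed

text \<open>The derivative with respect to \<open>x\<close>, where the two terms occur with equal signs; in
  \<open>bilin_ycoeff_Suc\<close> the signs are opposite, so that sum and difference isolate each term.\<close>

lemma sdiff_bilin_symb:
  "sdiff n (bilin_symb r m F G F' G') = bilin_symb r m (nab (1/2) n F) G F' (nab (- 1/2) n G')
     + bilin_symb r m F (nab (- 1/2) n G) (nab (1/2) n F') G'"
proof -
  have nab: "sdiff n (F * G) = nab s n F * G + F * nab t n G" if "t = - s" for s t F G
  proof -
    let ?a = "fls_const (cconst s * ham_const n) :: symb"
    have "fls_shift k F * G = F * fls_shift k G" for k
      by (simp add: fls_shifted_times_simps)
    then have "(?a * fls_shift (int n + 1) F) * G = F * (?a * fls_shift (int n + 1) G)"
      by (simp only: mult.assoc mult.left_commute)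
    moreover have "fls_const (cconst (- s) * ham_const n) = - ?a"
      by (simp add: cconst.uminus)
    ultimately show ?thesis
      unfolding that nab_def by (simp only: sdiff.mult distrib_left distrib_right) simp
  qed
  have n1: "sdiff n (F * G) = nab (1/2) n F * G + F * nab (- 1/2) n G"
    and n2: "sdiff n (F * G) = nab (- 1/2) n F * G + F * nab (1/2) n G" for F G
    by (rule nab, simp)+
  have X: "sdiff n fls_X = 0" and P: "sdiff n (symb_power r m) = 0" for m
    by (rule fls_eqI, simp) (rule fls_eqI, use symb_power_mult_nth[of r m 1] in \<open>simp add: mps_deriv.mult\<close>)
  show ?thesis
    unfolding bilin_symb_def
    by (simp only: sdiff.mult[of n fls_X] sdiff.mult[of n "symb_power _ _"] sdiff.diff X P n1[of "sshift (of_int m / 2) F"]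
        n2[of "sshift (of_int m / 2) G'"] sshift_nab) (simp add: algebra_simps)
qed

text \<open>Regularity at all \<open>m\<close> says that two difference operators are adjoint: \<open>m\<close> labels the power
  of \<open>\<Lambda>\<close>, the powers of \<open>\<lambda>\<close> correspond to \<open>\<Lambda>\<^sup>i\<close> in the middle.\<close>

lemma bilin_symb_regular_iff:
  assumes "r \<noteq> 0"
  shows "(\<forall>m. symb_regular (bilin_symb r m F G F' G')) \<longleftrightarrow>
    (\<forall>i::nat. adj (r\<^sup>2) (opL F' * pLam (int i) * opR G') (opL F * pLam (int i) * opR G))"
proof -
  let ?X = "\<lambda>i. pcoef (opL F * pLam (int i) * opR G)"
  let ?Y = "\<lambda>i. pcoef (opL F' * pLam (int i) * opR G')"
  have 1: "(sshift (of_int m / 2) F * sshift (- of_int m / 2) G) $$ (int i + m)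
      = cshift (of_int m / 2) (?X i (- m))" for i m
    using pcoef_opL_pLam_opR[of F "int i" G m]
    by (simp add: add.commute sshift.mult flip: sshift_nth)
  have 2: "(sshift (of_int m / 2) G' * sshift (- of_int m / 2) F') $$ (int i - m)
      = cshift (- of_int m / 2) (?Y i m)" for i m
    using pcoef_opL_pLam_opR[of F' "int i" G' "- m"]
    by (simp add: mult.commute sshift.mult flip: sshift_nth)
  have X: "(fls_X * H) $$ j = H $$ (j - 1)" for H :: symb and j
    by (simp add: fls_X_times_conv_shift)
  have "symb_regular (bilin_symb r m F G F' G') \<longleftrightarrow>
      (\<forall>i. ?X i (- m) = cconst ((r\<^sup>2) powi m) * cshift (- of_int m) (?Y i m))" for m
  proof -
    have "symb_regular (bilin_symb r m F G F' G') \<longleftrightarrow>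
      (\<forall>i::nat. bilin_symb r m F G F' G' $$ (int i + 1) = 0)"
      unfolding symb_regular_def
    proof (intro iffI allI impI)
      fix j :: int assume *: "\<forall>i::nat. bilin_symb r m F G F' G' $$ (int i + 1) = 0" and "j > 0"
      then show "bilin_symb r m F G F' G' $$ j = 0" using *[rule_format, of "nat (j - 1)"] by simp
    qed simp
    also have "\<dots> \<longleftrightarrow> (\<forall>i. ?X i (- m) = cconst ((r\<^sup>2) powi m) * cshift (- of_int m) (?Y i m))"
    proof (rule arg_cong[of _ _ All], rule ext)
      fix i
      have "bilin_symb r m F G F' G' $$ (int i + 1) =
          cconst (r powi (- m)) * cshift (of_int m / 2) (?X i (- m))
          - cconst (r powi m) * cshift (- of_int m / 2) (?Y i m)"
        unfolding bilin_symb_def X fls_minus_nth symb_power_mult_nth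
        by (simp only: add_diff_cancel_right' minus_minus add_uminus_conv_diff 1 2)
      moreover have "cconst (r powi (- m)) * cshift (of_int m / 2) (?X i (- m))
          - cconst (r powi m) * cshift (- of_int m / 2) (?Y i m) = 0 \<longleftrightarrow>
          ?X i (- m) = cconst ((r\<^sup>2) powi m) * cshift (- of_int m) (?Y i m)" (is "?l \<longleftrightarrow> ?r")
      proof
        assume ?l
        then have "cconst (r powi m) * cshift (- of_int m / 2) (cconst (r powi (- m)) * cshift (of_int m / 2) (?X i (- m)))
          = cconst (r powi m) * cshift (- of_int m / 2) (cconst (r powi m) * cshift (- of_int m / 2) (?Y i m))"
          by simp
        moreover have "r powi m * r powi (- m) = 1" "r powi m * r powi m = (r\<^sup>2) powi m"
          using assms by (simp_all add: power_int_minus power_int_mult_distrib power2_eq_square)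
        ultimately show ?r
          by (simp add: cshift.mult cconst.one flip: mult.assoc cconst.mult)
      next
        assume r: ?r
        have "r powi (- m) * (r\<^sup>2) powi m = r powi m"
          using assms by (simp add: power_int_minus power_int_mult_distrib power2_eq_square)
        then show ?l
          unfolding r by (simp add: cshift.mult flip: mult.assoc cconst.mult)
      qed
      ultimately show "(bilin_symb r m F G F' G' $$ (int i + 1) = 0) =
          (?X i (- m) = cconst ((r\<^sup>2) powi m) * cshift (- of_int m) (?Y i m))" by simp
    qed
    finally show ?thesis .
  qed
  then have "(\<forall>m. symb_regular (bilin_symb r m F G F' G')) \<longleftrightarrow>
      (\<forall>i m. ?X i (- m) = cconst ((r\<^sup>2) powi m) * cshift (- of_int m) (?Y i m))" by blast
  also have "\<dots> \<longleftrightarrow> (\<forall>i k. ?X i k = cconst ((r\<^sup>2) powi (- k)) * cshift (of_int k) (?Y i (- k)))"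
  proof (intro iffI allI)
    fix i k
    assume *: "\<forall>i m. ?X i (- m) = cconst ((r\<^sup>2) powi m) * cshift (- of_int m) (?Y i m)"
    show "?X i k = cconst ((r\<^sup>2) powi (- k)) * cshift (of_int k) (?Y i (- k))"
      using *[rule_format, of i "- k"] by simp
  next
    fix i m
    assume *: "\<forall>i k. ?X i k = cconst ((r\<^sup>2) powi (- k)) * cshift (of_int k) (?Y i (- k))"
    show "?X i (- m) = cconst ((r\<^sup>2) powi m) * cshift (- of_int m) (?Y i m)"
      using *[rule_format, of i "- m"] by simp
  qed
  finally show ?thesis unfolding adj_iff .
qed

lemma regular_in_lambda_imp:
  assumes "regular_in_lambda E" "ycoeff B E = symb_series K"
  shows "symb_regular K"
  unfolding symb_regular_def
proof (intro allI impI mps_eqI)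
  fix j :: int and A assume "j > 0"
  then have "mcoeff E (image_mset Inl A + image_mset Inr B) $$ j = 0"
    using assms(1) unfolding regular_in_lambda_def by (metis not_le)
  then show "mcoeff (K $$ j) A = mcoeff 0 A"
    by (metis assms(2) mcoeff_simps(1) mcoeff_ycoeff symb_series_nth)
qed

lemma regular_in_lambdaI:
  assumes "\<And>B. \<exists>K. symb_regular K \<and> ycoeff B E = symb_series K"
  shows "regular_in_lambda E"
  unfolding regular_in_lambda_def
proof
  fix B
  obtain K where K: "symb_regular K" "ycoeff B E = symb_series K" using assms by blast
  show "\<exists>d::nat. \<forall>A j. mcoeff E (image_mset Inl A + image_mset Inr B) $$ j \<noteq> 0 \<longrightarrow> - int d \<le> j \<and> j \<le> 0"
  proof (intro exI allI impI)
    fix A j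
    assume "mcoeff E (image_mset Inl A + image_mset Inr B) $$ j \<noteq> 0"
    then have "K $$ j \<noteq> 0"
      using K(2) by (metis mcoeff_simps(1) mcoeff_ycoeff symb_series_nth)
    then have "fls_subdegree K \<le> j" "j \<le> 0"
      using K(1) by (auto simp: symb_regular_def fls_subdegree_leI not_less[symmetric])
    then show "- int (nat (- fls_subdegree K)) \<le> j \<and> j \<le> 0" by auto
  qed
qed

text \<open>For the way back to the hierarchy only the coefficients of \<open>1\<close> and of \<open>y\<^sub>n\<close> matter.\<close>

lemma hirota_imp_adj:
  assumes r: "r \<noteq> 0" and reg: "\<And>m. regular_in_lambda (hirota r m \<tau>)"
  defines "f \<equiv> miwaL \<tau>" and "g \<equiv> miwaR \<tau>"
  shows "adj (r\<^sup>2) (opL f * pLam (int i) * opR g) (opL f * pLam (int i) * opR g)"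
    and "adj (r\<^sup>2) (opL f * pLam (int i) * opR (nab (- 1/2) n g))
           (opL (nab (1/2) n f) * pLam (int i) * opR g)"
proof -
  have E: "regular_in_lambda (bilin r m f g f g)" for m
    using reg[of m] unfolding hirota_bilin f_def g_def .
  have s: "symb_regular (bilin_symb r m f g f g)" for m
    using regular_in_lambda_imp[OF E bilin_ycoeff_empty] .
  then show "adj (r\<^sup>2) (opL f * pLam (int i) * opR g) (opL f * pLam (int i) * opR g)"
    using bilin_symb_regular_iff[OF r, of f g f g] by blast
  let ?a = "\<lambda>m. bilin_symb r m (nab (1/2) n f) g f (nab (- 1/2) n g)"
  let ?b = "\<lambda>m. bilin_symb r m f (nab (- 1/2) n g) (nab (1/2) n f) g"
  have "symb_regular (?a m)" for m
  proof -
    have "ycoeff ({#} + {#n#}) (bilin r m f g f g) = symb_series (?a m - ?b m)"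
      using bilin_ycoeff_Suc[of "{#}" n r m f g f g] by (simp add: bilin_ycoeff_empty symb_series.diff)
    then have "symb_regular (?a m - ?b m)" using regular_in_lambda_imp[OF E] by blast
    moreover have "symb_regular (?a m + ?b m)"
      unfolding sdiff_bilin_symb[symmetric] using s[of m] by (simp add: symb_regular_def)
    ultimately have "of_nat (Suc 1) * ?a m $$ j = 0" if "j > 0" for j
      using that by (simp add: symb_regular_def)
    then show ?thesis unfolding symb_regular_def using of_nat_mult_eq_0D by blast
  qed
  then show "adj (r\<^sup>2) (opL f * pLam (int i) * opR (nab (- 1/2) n g))
           (opL (nab (1/2) n f) * pLam (int i) * opR g)"
    using bilin_symb_regular_iff[OF r, of "nab (1/2) n f" g f "nab (- 1/2) n g"] by blast
qed

text \<open>The adjointness relations with derivatives on both factors follow from those in the hypothesis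
  by applying \<open>\<partial>\<^sub>n\<^sub>,\<^sub>1\<close>, which distributes over the two factors as \<open>\<nabla>\<^sub>n\<close>.\<close>

lemma adj_imp_hirota:
  fixes \<tau> :: cfun
  assumes r: "r \<noteq> 0"
  defines "f \<equiv> miwaL \<tau>" and "g \<equiv> miwaR \<tau>"
  assumes adj: "\<And>ns i. adj (r\<^sup>2) (opL f * pLam (int i) * opR (nabs (- 1/2) ns g))
           (opL (nabs (1/2) ns f) * pLam (int i) * opR g)"
  shows "regular_in_lambda (hirota r m \<tau>)"
proof -
  let ?L = "\<lambda>ns. opL (nabs (1/2) ns f)" and ?R = "\<lambda>ns. opR (nabs (- 1/2) ns g)"
  have *: "adj (r\<^sup>2) (?L ks * pLam (int i) * ?R ns) (?L ns * pLam (int i) * ?R ks)" for ns ks i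
  proof (induction ks arbitrary: ns)
    case (Cons n ks)
    let ?X = "?L ns * pLam (int i) * ?R ks" and ?Y = "?L ks * pLam (int i) * ?R ns"
    have "?L ns * pLam (int i) * ?R (n # ks) = pdiff n ?X - ?L (n # ns) * pLam (int i) * ?R ks"
      using nab_product[of n "nabs (1/2) ns f" "int i" "nabs (- 1/2) ks g" "1/2"] by simp
    moreover have "?L (n # ks) * pLam (int i) * ?R ns = pdiff n ?Y - ?L ks * pLam (int i) * ?R (n # ns)"
      using nab_product[of n "nabs (1/2) ks f" "int i" "nabs (- 1/2) ns g" "1/2"] by simp
    ultimately show ?case
      using adj_diff[OF adj_pdiff[OF Cons, of n] Cons[of "n # ns"]] by simp
  qed (use adj in simp)
  have "symb_regular (bilin_symb r m (nabs (1/2) ns f) (nabs (- 1/2) ks g)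
     (nabs (1/2) ks f) (nabs (- 1/2) ns g))" for ns ks
    using * bilin_symb_regular_iff[OF r] by blast
  then have "regular_in_lambda (bilin r m f g f g)"
    by (intro regular_in_lambdaI bilin_ycoeff)
  then show ?thesis unfolding hirota_bilin f_def g_def .
qed

section \<open>Tau-functions and the bilinear equations\<close>

lemma opL_const_mult: "opL (fls_const a * F) = pconst a * opL F"
  by (rule pdo_eqI) simp

lemma opR_const_mult: "opR (fls_const a * F) = opR F * pconst a"
  by (rule pdo_eqI) (simp add: cshift.mult mult.commute)

lemma pcoef_mult_nonneg:
  assumes A: "\<And>k. k < 0 \<Longrightarrow> pcoef A k = 0" and B: "\<And>k. k < 0 \<Longrightarrow> pcoef B k = 0"
  shows "k < 0 \<Longrightarrow> pcoef (A * B) k = 0" and "pcoef (A * B) 0 = pcoef A 0 * pcoef B 0"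
proof -
  obtain a where a: "\<And>k. k > a \<Longrightarrow> pcoef A k = 0" using pcoef_bound by blast
  obtain b where b: "\<And>k. k > b \<Longrightarrow> pcoef B k = 0" using pcoef_bound by blast
  have *: "pcoef (A * B) k = (\<Sum>i\<in>insert 0 {k - b..a}. pcoef A i * cshift (of_int i) (pcoef B (k - i)))" for k
    by (rule pcoef_mult_set[of a _ b]) (auto intro: a b)
  show "pcoef (A * B) k = 0" if "k < 0"
    unfolding *
  proof (rule sum.neutral, rule ballI)
    fix i
    show "pcoef A i * cshift (of_int i) (pcoef B (k - i)) = 0"
      using A[of i] B[of "k - i"] that by (cases "i < 0") auto
  qed
  have "pcoef (A * B) 0 = (\<Sum>i\<in>insert 0 {0 - b..a}. if i = 0 then pcoef A 0 * pcoef B 0 else 0)"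
    unfolding *
  proof (rule sum.cong[OF refl])
    fix i
    show "pcoef A i * cshift (of_int i) (pcoef B (0 - i)) = (if i = 0 then pcoef A 0 * pcoef B 0 else 0)"
      using A[of i] B[of "- i"] by (cases "i < 0"; cases "i = 0") auto
  qed
  then show "pcoef (A * B) 0 = pcoef A 0 * pcoef B 0" by (subst (asm) sum.delta) auto
qed

definition pplus :: "pdo \<Rightarrow> pdo" where
  "pplus A = Abs_pdo (dop_plus (pcoef A))"

definition pminus :: "pdo \<Rightarrow> pdo" where
  "pminus A = Abs_pdo (dop_minus (pcoef A))"

lemma pcoef_pplus: "pcoef (pplus A) = dop_plus (pcoef A)"
proof -
  obtain N where "\<And>k. k > N \<Longrightarrow> pcoef A k = 0" using pcoef_bound by blast
  then show ?thesis unfolding pplus_def by (subst pcoef_Abs_pdo[of N]) (auto simp: dop_plus_def)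
qed

lemma pcoef_pminus: "pcoef (pminus A) = dop_minus (pcoef A)"
  unfolding pminus_def by (subst pcoef_Abs_pdo[of 0]) (auto simp: dop_minus_def)

lemma pcoef_pplus_nth [simp]: "pcoef (pplus A) k = (if k \<ge> 0 then pcoef A k else 0)"
  by (simp add: pcoef_pplus dop_plus_def)

lemma pcoef_pminus_nth [simp]: "pcoef (pminus A) k = (if k < 0 then pcoef A k else 0)"
  by (simp add: pcoef_pminus dop_minus_def)

lemma pplus_pminus: "A = pplus A + pminus A"
  by (rule pdo_eqI) auto

lemma dop_deriv_pcoef: "dop_deriv n (pcoef A) = pcoef (pdiff n A)"
  by (simp add: fun_eq_iff dop_deriv_def)

lemma dop_deriv_sharp: "dop_deriv n (dop_sharp Q B) = dop_sharp Q (dop_deriv n B)"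
  by (simp add: fun_eq_iff dop_deriv_def dop_sharp_def mps_deriv.mult cshift_deriv)

locale unit_series =
  fixes Q :: complex and \<tau> \<sigma> :: cfun
  assumes Q: "Q \<noteq> 0" and unit: "\<tau> * \<sigma> = 1"
begin

text \<open>\<open>tm = \<tau>(x - \<epsilon>/2)\<close> and \<open>tp = \<tau>(x + \<epsilon>/2)\<close>; the leading coefficient of \<open>P\<^sub>R\<close> is \<open>w0\<close>.\<close>

definition "tm = cshift (- 1/2) \<tau>"
definition "tmi = cshift (- 1/2) \<sigma>"
definition "tp = cshift (1/2) \<tau>"
definition "w0 = tp * tmi"
definition "w0i = tm * cshift (1/2) \<sigma>"

lemma tm_inv: "tm * tmi = 1" "tmi * tm = 1"
  using unit by (simp_all add: tm_def tmi_def mult.commute cshift.one flip: cshift.mult)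

lemma w0_inv: "w0 * w0i = 1" "w0i * w0 = 1"
proof -
  have "tp * cshift (1/2) \<sigma> = 1"
    using unit by (simp add: tp_def cshift.one flip: cshift.mult)
  then have "(tp * cshift (1/2) \<sigma>) * (tm * tmi) = 1" by (simp add: tm_inv)
  then show "w0 * w0i = 1" "w0i * w0 = 1" by (simp_all only: w0_def w0i_def ac_simps)
qed

definition "PL = opL (fls_const tmi * miwaL \<tau>)"
definition "PR = opR (fls_const tmi * miwaR \<tau>)"

abbreviation "a \<equiv> pconst tm"
abbreviation "ai \<equiv> pconst tmi"
abbreviation "W \<equiv> pconst w0"
abbreviation "Wi \<equiv> pconst w0i"

lemma wL_eq: "wL \<tau> k = tmi * miwa_exp (- 1) tm k"
  using ring_quot_eq[OF tm_inv(1)] by (simp add: wL_def tm_def mult.commute)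

lemma wR_eq: "wR \<tau> k = tmi * miwa_exp 1 tp k"
  using ring_quot_eq[OF tm_inv(1)] by (simp add: wR_def tm_def tp_def mult.commute)

lemma pcoef_PL: "pcoef PL = tau_PL \<tau>"
  by (auto simp: fun_eq_iff PL_def tau_PL_def miwaL_def wL_eq tm_def)

lemma pcoef_PR: "pcoef PR = tau_PR \<tau>"
  by (auto simp: fun_eq_iff PR_def tau_PR_def miwaR_def wR_eq tp_def)

lemma PL_deg: "k > 0 \<Longrightarrow> pcoef PL k = 0" and PL_lead: "pcoef PL 0 = 1"
  by (simp_all add: pcoef_PL tau_PL_def wL_eq tm_inv)

lemma PR_deg: "k > 0 \<Longrightarrow> pcoef PR k = 0" and PR_lead: "pcoef PR 0 = w0"
  by (simp_all add: pcoef_PR tau_PR_def wR_eq w0_def mult.commute)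

definition "PLi = (SOME B. (\<forall>k>0. pcoef B k = 0) \<and> pcoef B 0 = 1 \<and> PL * B = 1 \<and> B * PL = 1)"
definition "PRi = (SOME B. (\<forall>k>0. pcoef B k = 0) \<and> pcoef B 0 = w0i \<and> PR * B = 1 \<and> B * PR = 1)"

lemma PLi_props: "(\<forall>k>0. pcoef PLi k = 0) \<and> pcoef PLi 0 = 1 \<and> PL * PLi = 1 \<and> PLi * PL = 1"
proof -
  have "pcoef PL 0 * 1 = 1" by (simp add: PL_lead)
  then obtain B where "\<And>k. k > 0 \<Longrightarrow> pcoef B k = 0" "pcoef B 0 = 1" "PL * B = 1" "B * PL = 1"
    using pdo_inverse[OF PL_deg] by blast
  then have "\<exists>B. (\<forall>k>0. pcoef B k = 0) \<and> pcoef B 0 = 1 \<and> PL * B = 1 \<and> B * PL = 1" by blast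
  then show ?thesis unfolding PLi_def by (rule someI_ex)
qed

lemma PRi_props: "(\<forall>k>0. pcoef PRi k = 0) \<and> pcoef PRi 0 = w0i \<and> PR * PRi = 1 \<and> PRi * PR = 1"
proof -
  have "pcoef PR 0 * w0i = 1" by (simp add: PR_lead w0_inv)
  then obtain B where "\<And>k. k > 0 \<Longrightarrow> pcoef B k = 0" "pcoef B 0 = w0i" "PR * B = 1" "B * PR = 1"
    using pdo_inverse[OF PR_deg] by blast
  then have "\<exists>B. (\<forall>k>0. pcoef B k = 0) \<and> pcoef B 0 = w0i \<and> PR * B = 1 \<and> B * PR = 1" by blast
  then show ?thesis unfolding PRi_def by (rule someI_ex)
qed

lemma cancel_left: "x * y = 1 \<Longrightarrow> x * (y * z) = (z :: pdo)"
  by (simp flip: mult.assoc)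

lemma const_inv: "a * ai = 1" "ai * a = 1" "W * Wi = 1" "Wi * W = 1"
  by (simp_all add: tm_inv w0_inv pconst_1 flip: pconst_mult)

lemmas inverses = const_inv PLi_props[THEN conjunct2, THEN conjunct2, THEN conjunct1]
  PLi_props[THEN conjunct2, THEN conjunct2, THEN conjunct2]
  PRi_props[THEN conjunct2, THEN conjunct2, THEN conjunct1]
  PRi_props[THEN conjunct2, THEN conjunct2, THEN conjunct2]

lemmas cancels = inverses inverses[THEN cancel_left]

lemma dop_inv_PL: "dop_inv (pcoef PL) = pcoef PLi" and dop_inv_PR: "dop_inv (pcoef PR) = pcoef PRi"
  using PLi_props PRi_props by (auto intro!: dop_inv_pcoef)

lemma opL_miwaL: "opL (miwaL \<tau>) = a * PL"
  by (simp add: PL_def opL_const_mult cancels)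

lemma opR_miwaR: "opR (miwaR \<tau>) = PR * a"
  by (simp add: PR_def opR_const_mult mult.assoc cancels)

text \<open>The operator dressed by \<open>P\<^sub>L\<close> alone, and its Hamiltonians.\<close>

definition "L = PL * pLam 1 * PLi"

definition "H n = pconst (ham_const n) * L ^ (n + 1)"

lemma L_power: "L ^ i = PL * pLam (int i) * PLi"
proof (induction i)
  case (Suc i)
  have "L ^ Suc i = L * (PL * pLam (int i) * PLi)" by (simp add: Suc)
  also have "\<dots> = PL * (pLam 1 * pLam (int i)) * PLi"
    by (simp add: L_def mult.assoc cancels)
  finally show ?case by (simp flip: pLam_add)
qed (simp add: cancels)

lemma ham_central: "A * (pconst (ham_const n) * B) = pconst (ham_const n) * (A * B)"
  using pconst_central[of "ham_const n" A] by (simp flip: mult.assoc)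

lemma PL_Lham: "PL * Lham n = H n * PL"
proof -
  have "H n * PL = pconst (ham_const n) * (PL * pLam (int n + 1))"
    unfolding H_def L_power by (simp add: mult.assoc cancels add.commute)
  then show ?thesis by (simp add: Lham_def ham_central)
qed

lemma Lham_PLi: "Lham n * PLi = PLi * H n"
proof -
  have "PLi * (PL * Lham n) * PLi = PLi * (H n * PL) * PLi" by (simp only: PL_Lham)
  then show ?thesis by (simp add: mult.assoc cancels)
qed

lemma H_W_adjoint:
  assumes "adj Q (L ^ (n + 1) * W) (L ^ (n + 1) * W)"
  shows "adj Q (H n * W) (H n * W)"
proof -
  have "adj Q (pconst (ham_const n) * (L ^ (n + 1) * W)) ((L ^ (n + 1) * W) * pconst (ham_const n))"
    by (rule adj_mult[OF Q adj_pconst assms])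
  then show ?thesis
    using pconst_central[of "ham_const n" "L ^ (n + 1) * W"]
    by (simp only: H_def mult.assoc ham_const_simps simp_thms)
qed

lemma toda_ham_L: "toda_ham (pcoef L) n = pcoef (H n)"
  unfolding toda_ham_def dop_power_pcoef H_def by (simp add: fun_eq_iff ham_const_def)

abbreviation "half \<equiv> pconst (cconst (1/2))"

lemma half_central: "A * half = half * A" "A * (half * B) = half * (A * B)"
proof -
  show "A * half = half * A" by (rule pconst_central) simp
  then show "A * (half * B) = half * (A * B)" by (simp flip: mult.assoc)
qed

lemma half_add: "half * A + half * A = A"
proof -
  have "cconst (1/2) + cconst (1/2) = 1" by (simp add: cconst.one flip: cconst.add)
  then have "half + half = 1" by (simp add: pconst_1 flip: pconst_add)
  then show ?thesis by (simp flip: distrib_right)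
qed

lemma pconst_neg_half: "pconst (cconst (- (1/2))) = - half"
  by (rule pdo_eqI) (simp add: cconst.uminus)

lemma opR_nab_half: "opR (nab (- 1/2) n G) = pdiff n (opR G) - half * (Lham n * opR G)"
  using opR_nab[of "- (1/2)" n G] by (simp add: pconst_neg_half)

text \<open>This will turn out to be \<open>e\<^sup>v\<close>, the lowest coefficient of \<open>L\<close> divided by \<open>Q\<close>.\<close>

definition "E = w0 * cshift (- 1) w0i"

lemma small_E:
  assumes "nonvanishing \<tau>"
  shows "small (E - 1)"
proof -
  have "tp = cshift (- 1/2) (cshift 1 \<tau>)" "cshift (- 1) tm = cshift (- 1/2) (cshift (- 1) \<tau>)"
    "cshift (- 1) (cshift (1/2) \<sigma>) = tmi"
    by (simp_all add: tp_def tm_def tmi_def)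
  then have "E = cshift (- 1/2) ((cshift 1 \<tau> * \<sigma>) * (cshift (- 1) \<tau> * \<sigma>))"
    by (simp only: E_def w0_def w0i_def cshift.mult tmi_def[symmetric] mult.assoc)
  then have "E - 1 = cshift (- 1/2) ((cshift 1 \<tau> * \<sigma>) * (cshift (- 1) \<tau> * \<sigma>) - 1)"
    by (simp only: cshift.diff cshift.one)
  then show ?thesis
    using assms unit by (simp only:) (intro small_cshift small_mult_minus_1 small_shift_quotient)
qed

lemma L_deg: "k > 1 \<Longrightarrow> pcoef L k = 0" and L_lead: "pcoef L 1 = 1"
proof -
  have 1: "pcoef (PL * pLam 1) k = 0" if "k > 1" for k
    using that by (simp add: PL_deg)
  have 2: "pcoef PLi k = 0" if "k > 0" for k
    using that PLi_props by blast
  show "pcoef L k = 0" if "k > 1"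
    unfolding L_def by (rule pcoef_mult_bound[OF 1 2]) (use that in auto)
  have "pcoef L (1 + 0) = pcoef (PL * pLam 1) 1 * cshift (of_int 1) (pcoef PLi 0)"
    unfolding L_def by (rule pcoef_mult_top[OF 1 2])
  then show "pcoef L 1 = 1" using PLi_props by (simp add: cshift.one PL_lead)
qed

subsection \<open>From the bilinear equations to the wave operators\<close>

context
  assumes sym: "\<And>i::nat. adj Q (opL (miwaL \<tau>) * pLam (int i) * opR (miwaR \<tau>))
        (opL (miwaL \<tau>) * pLam (int i) * opR (miwaR \<tau>))"
    and first: "\<And>n. adj Q (opL (miwaL \<tau>) * opR (nab (- 1/2) n (miwaR \<tau>)))
        (opL (nab (1/2) n (miwaL \<tau>)) * opR (miwaR \<tau>))"
begin

text \<open>The factors \<open>\<tau>(x - \<epsilon>/2)\<close> of the symbols can be removed.\<close>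

lemma adj_cancel:
  assumes "adj Q (a * A * a) (a * B * a)"
  shows "adj Q A B"
proof -
  have "adj Q (ai * (a * A * a)) ((a * B * a) * ai)"
    by (rule adj_mult[OF Q adj_pconst assms])
  from adj_mult[OF Q this adj_pconst[of Q tmi]]
  have "adj Q (ai * (a * A * a) * ai) (ai * (a * B * a * ai))" .
  then show ?thesis by (simp add: mult.assoc cancels)
qed

lemma PL_pLam_PR_adj: "adj Q (PL * pLam (int i) * PR) (PL * pLam (int i) * PR)"
  by (rule adj_cancel) (use sym[of i] in \<open>simp add: opL_miwaL opR_miwaR mult.assoc\<close>)

text \<open>The product has no positive powers of \<open>\<Lambda>\<close>, and its adjoint no negative ones.\<close>

lemma PL_PR: "PL * PR = W"
proof (rule pdo_eqI)
  fix k :: int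
  have adj: "adj Q (PL * PR) (PL * PR)" using PL_pLam_PR_adj[of 0] by simp
  have pos: "pcoef (PL * PR) k = 0" if "k > 0" for k
    using that by (intro pcoef_mult_bound[of 0 _ 0] PL_deg PR_deg) auto
  consider "k > 0" | "k = 0" | "k < 0" by linarith
  then show "pcoef (PL * PR) k = pcoef W k"
  proof cases
    case 2
    have "pcoef (PL * PR) (0 + 0) = pcoef PL 0 * cshift (of_int 0) (pcoef PR 0)"
      by (intro pcoef_mult_top PL_deg PR_deg)
    then show ?thesis using 2 by (simp add: PL_lead PR_lead)
  next
    case 3
    then have "pcoef (PL * PR) (- k) = 0" by (intro pos) simp
    then show ?thesis using adj[unfolded adj_iff, rule_format, of k] 3 by simp
  qed (simp add: pos)
qed

lemma PR_eq: "PR = PLi * W"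
  by (simp add: PL_PR[symmetric] cancels)

lemma PRi_eq: "PRi = Wi * PL"
proof -
  have "PRi = Wi * (PL * PR) * PRi" by (simp add: PL_PR cancels)
  then show ?thesis by (simp add: mult.assoc cancels)
qed

lemma L_W_adj: "adj Q (L ^ i * W) (L ^ i * W)"
  using PL_pLam_PR_adj[of i] by (simp add: L_power PR_eq mult.assoc)

lemma L_adj: "adj Q (Wi * L * W) L"
proof -
  have "adj Q (Wi * (L * W)) ((L * W) * Wi)"
    using adj_mult[OF Q adj_pconst[of Q w0i] L_W_adj[of 1]] by simp
  then show ?thesis by (simp add: mult.assoc cancels)
qed

lemma L_low: "k < - 1 \<Longrightarrow> pcoef L k = 0" and L_minus_1: "pcoef L (- 1) = cconst Q * E"
proof -
  have *: "pcoef L k = cconst (Q powi (- k)) * cshift (of_int k) (w0i * pcoef L (- k) * cshift (of_int (- k)) w0)" for k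
    using L_adj[unfolded adj_iff, rule_format, of k] by (simp add: mult.assoc)
  show "pcoef L k = 0" if "k < - 1"
    using *[of k] L_deg[of "- k"] that by simp
  show "pcoef L (- 1) = cconst Q * E"
    using *[of "- 1"] by (simp add: L_lead cshift.mult E_def mult.commute)
qed

lemma lax_L:
  assumes "nonvanishing \<tau>"
  shows "lax_operator Q (pcoef L)"
proof -
  obtain v where v: "small v" "cexp v = E" using exists_log[OF small_E[OF assms]] by blast
  have "pcoef L k = (if k = 1 then 1 else if k = 0 then pcoef L 0
              else if k = -1 then cconst Q * cexp v else 0)" for k
  proof -
    consider "k > 1" | "k = 1" | "k = 0" | "k = - 1" | "k < - 1" by linarith
    then show ?thesis by cases (auto simp: L_deg L_lead L_minus_1 L_low v)
  qed
  then show ?thesis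
    unfolding lax_operator_def using v(1)[unfolded small_def] by blast
qed

lemma dressing_L: "dressing_operators Q (pcoef L) (pcoef PL) (pcoef PR)"
proof -
  have "Wi * L * W = PRi * pLam 1 * PR"
    by (simp add: PRi_eq PR_eq L_def mult.assoc)
  then have "pcoef L = dop_sharp Q (pcoef PRi \<bullet>\<^sub>d pcoef (pLam 1) \<bullet>\<^sub>d pcoef PR)"
    using L_adj by (simp add: adj_def pcoef_mult)
  moreover have "w0 dvd 1" using w0_inv by (metis dvd_triv_left)
  ultimately show ?thesis
    unfolding dressing_operators_def dop_inv_PL dop_inv_PR dop_Lambda_pcoef pcoef_mult
    by (simp add: PL_deg PL_lead PR_deg PR_lead L_def)
qed

text \<open>The derivatives of the factors \<open>\<tau>(x - \<epsilon>/2)\<close> cancel, and the two halves of \<open>H n * W\<close>, which is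
  its own adjoint, add up on one side.\<close>

lemma first_order: "adj Q (PL * pdiff n PR) (pdiff n PL * PR + H n * W)"
proof -
  define a' where "a' = pconst (mps_deriv n tm)"
  let ?h = "half * (a * H n * W * a)"
  have h: "adj Q ?h ?h"
  proof -
    have "adj Q (a * (H n * W)) ((H n * W) * a)" by (rule adj_mult[OF Q adj_pconst H_W_adjoint[OF L_W_adj]])
    from adj_mult[OF Q this adj_pconst[of Q tm]]
    have "adj Q (a * (H n * W) * a) (a * (H n * W * a))" .
    from adj_mult[OF Q adj_pconst[of Q "cconst (1/2)"] this]
    show ?thesis by (simp add: mult.assoc half_central)
  qed
  have c: "adj Q (a * W * a') (a' * W * a)"
  proof -
    have "a * W * a' = a' * W * a"
      unfolding a'_def by (simp flip: pconst_mult) (simp add: ac_simps)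
    then show ?thesis unfolding a'_def by (simp add: adj_pconst flip: pconst_mult)
  qed
  have L: "opL (nab (1/2) n (miwaL \<tau>)) * opR (miwaR \<tau>) = a' * W * a + (a * (pdiff n PL * PR) * a + ?h)"
  proof -
    have "opL (nab (1/2) n (miwaL \<tau>)) = a' * PL + a * pdiff n PL + half * (a * (PL * Lham n))"
      by (simp add: opL_nab opL_miwaL pdiff_mult pdiff_pconst a'_def mult.assoc)
    then show ?thesis
      unfolding opR_miwaR PL_Lham PL_PR[symmetric] by (simp add: distrib_right mult.assoc)
  qed
  have R: "opL (miwaL \<tau>) * opR (nab (- 1/2) n (miwaR \<tau>)) = a * W * a' + (a * (PL * pdiff n PR) * a - ?h)"
  proof -
    have "opR (nab (- 1/2) n (miwaR \<tau>)) = pdiff n PR * a + PR * a' - half * (Lham n * (PR * a))"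
      by (simp only: opR_nab_half opR_miwaR pdiff_mult pdiff_pconst a'_def)
    then have "opL (miwaL \<tau>) * opR (nab (- 1/2) n (miwaR \<tau>)) =
        a * (PL * (pdiff n PR * a)) + a * (PL * PR * a') - half * (a * (PL * Lham n * (PR * a)))"
      by (simp add: opL_miwaL distrib_left right_diff_distrib mult.assoc half_central)
    then show ?thesis
      unfolding PL_Lham PL_PR[symmetric] by (simp add: mult.assoc)
  qed
  have "adj Q (a * (PL * pdiff n PR) * a - ?h) (a * (pdiff n PL * PR) * a + ?h)"
    using adj_diff[OF first[of n] c] by (simp only: L R add_diff_cancel_left')
  from adj_add[OF this h]
  have "adj Q (a * (PL * pdiff n PR) * a) (a * (pdiff n PL * PR) * a + (?h + ?h))"
    by (simp only: diff_add_cancel add.assoc)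
  then have "adj Q (a * (PL * pdiff n PR) * a) (a * (pdiff n PL * PR + H n * W) * a)"
    by (simp only: half_add distrib_left distrib_right mult.assoc)
  then show ?thesis by (rule adj_cancel)
qed

text \<open>The adjoint on the other side of \<open>first_order\<close> has no negative powers of \<open>\<Lambda>\<close>, and
  \<open>\<partial>\<^sub>n\<^sub>,\<^sub>1 P\<^sub>L \<cdot> P\<^sub>R\<close> no nonnegative ones.\<close>

lemma wave_L: "pdiff n PL = - (pminus (H n) * PL)"
proof -
  have "pdiff n PL * PR = - (pminus (H n) * W)"
  proof (rule pdo_eqI)
    fix k
    show "pcoef (pdiff n PL * PR) k = pcoef (- (pminus (H n) * W)) k"
    proof (cases "k < 0")
      case True
      have "pcoef (PL * pdiff n PR) (- k) = 0"
        using True by (intro pcoef_mult_bound[of 0 _ 0]) (auto simp: PL_deg PR_deg)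
      then have "pcoef (pdiff n PL * PR + H n * W) k = 0"
        using first_order[unfolded adj_iff, rule_format, of n k] by simp
      then show ?thesis using True by (simp add: add_eq_0_iff2)
    next
      case False
      have "pcoef (pdiff n PL) k = 0" if "k > - 1" for k
        using that PL_deg[of k] by (cases "k = 0") (auto simp: PL_lead)
      then show ?thesis
        using False by (auto intro!: pcoef_mult_bound[of "- 1" _ 0] simp: PR_deg)
    qed
  qed
  then have "pdiff n PL * PR * PRi = - (pminus (H n) * (W * PRi))" by (simp add: mult.assoc)
  then show ?thesis by (simp add: PRi_eq mult.assoc cancels del: minus_mult_left)
     (simp add: PR_eq PRi_eq mult.assoc cancels)
qed

text \<open>What remains of \<open>first_order\<close> after inserting \<open>wave_L\<close> are the nonnegative powers of \<open>\<Lambda>\<close>.\<close>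

lemma wave_R: "dop_deriv n (dop_sharp Q (pcoef PR)) = dop_plus (toda_ham (pcoef L) n) \<bullet>\<^sub>d dop_sharp Q (pcoef PR)"
proof -
  have "pdiff n PL * PR = - (pminus (H n) * W)"
    by (simp add: wave_L mult.assoc PL_PR)
  then have "pdiff n PL * PR + H n * W = pplus (H n) * W"
    using arg_cong[OF pplus_pminus[of "H n"], of "\<lambda>A. A * W"] by (simp add: distrib_right)
  then have "adj Q (PL * pdiff n PR) (pplus (H n) * W)"
    using first_order[of n] by simp
  from adj_mult[OF Q adj_pconst[of Q w0i] this]
  have M: "adj Q (Wi * (PL * pdiff n PR)) (pplus (H n))" by (simp add: mult.assoc cancels)
  have "pdiff n PR = PR * (Wi * (PL * pdiff n PR))"
    by (simp add: PR_eq mult.assoc cancels)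
  then have "dop_sharp Q (pcoef (pdiff n PR)) = pcoef (pplus (H n)) \<bullet>\<^sub>d dop_sharp Q (pcoef PR)"
    using M dop_sharp_mult[OF Q] unfolding adj_def by metis
  then show ?thesis
    by (simp add: dop_deriv_sharp dop_deriv_pcoef toda_ham_L pcoef_pplus)
qed

lemma wave_operators_L:
  assumes "nonvanishing \<tau>"
  shows "wave_operators Q (pcoef L) (tau_PL \<tau>) (tau_PR \<tau>)"
proof -
  have "dop_deriv n (pcoef PL) = - (dop_minus (toda_ham (pcoef L) n) \<bullet>\<^sub>d pcoef PL)" for n
    unfolding dop_deriv_pcoef wave_L toda_ham_L pcoef_pminus[symmetric] pcoef_mult
    by (simp add: fun_eq_iff)
  then show ?thesis
    unfolding wave_operators_def pcoef_PL[symmetric] pcoef_PR[symmetric]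
    using lax_L[OF assms] dressing_L wave_R by blast
qed

end

end

subsection \<open>From the wave operators to the bilinear equations\<close>

text \<open>The coefficients of the operator \<open>Y = \<Sum>\<^sub>j Y\<^sub>j \<mu>\<^sup>-\<^sup>j\<close> by which the flows with Hamiltonians \<open>H\<close> propagate
  along a Miwa shift.  The differential equation of the shift with respect to \<open>\<mu>\<^sup>-\<^sup>1\<close>, with
  \<open>\<partial>\<^sub>n\<^sub>,\<^sub>1 Y\<close> replaced by \<open>\<partial>\<^sub>n\<^sub>,\<^sub>1 Y + Y H\<^sub>n\<close>, amounts to a recursion.\<close>

fun evolution :: "(nat \<Rightarrow> pdo) \<Rightarrow> nat \<Rightarrow> pdo" where
  "evolution H j = (if j = 0 then 1 else
     pconst (cconst (1 / of_nat j)) * (\<Sum>n\<in>{..<j}. pconst (miwa_coeff n) *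
       (pdiff n (evolution H (j - Suc n)) + evolution H (j - Suc n) * H n)))"

declare evolution.simps [simp del]

lemma of_nat_pdo: "of_nat n = pconst (of_nat n)"
  by (induction n) (auto simp: pconst_add pconst_1, rule pdo_eqI, simp)

lemma evolution_Suc:
  "of_nat (Suc j) * evolution H (Suc j) =
     (\<Sum>n\<le>j. pconst (miwa_coeff n) * (pdiff n (evolution H (j - n)) + evolution H (j - n) * H n))"
proof -
  have "of_nat (Suc j) * pconst (cconst (1 / of_nat (Suc j))) = 1"
  proof -
    have "of_nat (Suc j) * cconst (1 / of_nat (Suc j)) = 1"
      using of_nat_neq_0[of j, where 'a = complex]
      by (simp add: cconst.one del: of_nat_Suc flip: cconst.of_nat cconst.mult)
    then show ?thesis unfolding of_nat_pdo by (simp only: pconst_mult[symmetric] pconst_1)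
  qed
  then show ?thesis
    by (subst evolution.simps) (simp add: lessThan_Suc_atMost del: of_nat_Suc flip: mult.assoc)
qed

context unit_series
begin

context
  fixes L0 :: dop
  assumes wave: "wave_operators Q L0 (tau_PL \<tau>) (tau_PR \<tau>)"
begin

lemma L0_L: "L0 = pcoef L" and L_adjoint: "adj Q (PRi * pLam 1 * PR) L"
proof -
  have d: "dressing_operators Q L0 (pcoef PL) (pcoef PR)"
    using wave unfolding wave_operators_def pcoef_PL pcoef_PR by blast
  then have *: "L0 = pcoef L" "L0 = dop_sharp Q (pcoef (PRi * pLam 1 * PR))"
    unfolding dressing_operators_def dop_inv_PL dop_inv_PR dop_Lambda_pcoef pcoef_mult L_def
    by blast+
  then show "L0 = pcoef L" "adj Q (PRi * pLam 1 * PR) L"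
    by (simp_all add: adj_def)
qed

lemma wave_PL: "pdiff n PL = - (pminus (H n) * PL)"
proof -
  have "dop_deriv n (pcoef PL) = - (dop_minus (toda_ham L0 n) \<bullet>\<^sub>d pcoef PL)"
    using wave unfolding wave_operators_def pcoef_PL by blast
  then have "pcoef (pdiff n PL) = - pcoef (pminus (H n) * PL)"
    by (simp only: dop_deriv_pcoef L0_L toda_ham_L pcoef_pminus[symmetric] pcoef_mult)
  then show ?thesis by (intro pdo_eqI) simp
qed

text \<open>The coefficient of \<open>\<Lambda>\<^sup>0\<close> in the evolution equation of \<open>P\<^sub>R\<^sup>#\<close>.\<close>

lemma wave_w0: "mps_deriv n w0 = pcoef (H n) 0 * w0"
proof -
  let ?S = "dop_sharp Q (pcoef PR)"
  have S: "?S 0 = w0"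
    by (simp add: dop_sharp_def PR_lead cconst.one)
  have "dop_deriv n ?S = dop_plus (toda_ham L0 n) \<bullet>\<^sub>d ?S"
    using wave unfolding wave_operators_def pcoef_PR by blast
  then have "mps_deriv n (?S 0) = (pcoef (pplus (H n)) \<bullet>\<^sub>d ?S) 0"
    by (simp add: dop_deriv_def fun_eq_iff L0_L toda_ham_L pcoef_pplus)
  also have "\<dots> = (\<Sum>i\<in>{0}. pcoef (pplus (H n)) i * cshift (of_int i) (?S (0 - i)))"
    unfolding dop_mult_def
  proof (rule Sum_any.expand_superset)
    show "{i. pcoef (pplus (H n)) i * cshift (of_int i) (?S (0 - i)) \<noteq> 0} \<subseteq> {0}"
    proof
      fix i assume "i \<in> {i. pcoef (pplus (H n)) i * cshift (of_int i) (?S (0 - i)) \<noteq> 0}"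
      then have p: "pcoef (pplus (H n)) i * cshift (of_int i) (?S (0 - i)) \<noteq> 0" by blast
      have "i \<ge> 0"
      proof (rule ccontr)
        assume "\<not> i \<ge> 0"
        then show False using p by simp
      qed
      moreover have "i \<le> 0"
      proof (rule ccontr)
        assume "\<not> i \<le> 0"
        then have "?S (0 - i) = 0" by (simp add: dop_sharp_def PR_deg)
        then show False using p by simp
      qed
      ultimately show "i \<in> {0}" by simp
    qed
  qed simp
  finally show ?thesis by (simp add: S)
qed

text \<open>The operator \<open>L W\<close> is tridiagonal with the two outer coefficients exchanged by the
  antiinvolution, and \<open>L\<^sup>i W\<close> is a palindrome in \<open>L W\<close> and \<open>W\<^sup>-\<^sup>1\<close>.\<close>

lemma LW_adjoint: "adj Q (L * W) (L * W)"
proof -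
  let ?Ls = "PRi * pLam 1 * PR"
  have 1: "pcoef (PRi * pLam 1) k = 0" if "k > 1" for k
    using that PRi_props by simp
  have Ls_deg: "pcoef ?Ls k = 0" if "k > 1" for k
    by (rule pcoef_mult_bound[OF 1 PR_deg]) (use that in auto)
  have "pcoef ?Ls (1 + 0) = pcoef (PRi * pLam 1) 1 * cshift (of_int 1) (pcoef PR 0)"
    by (rule pcoef_mult_top[OF 1 PR_deg])
  then have Ls_lead: "pcoef ?Ls 1 = w0i * cshift 1 w0"
    using PRi_props by (simp add: PR_lead)
  have L: "pcoef L k = cconst (Q powi (- k)) * cshift (of_int k) (pcoef ?Ls (- k))" for k
    using L_adjoint unfolding adj_iff by blast
  have low: "pcoef L k = 0" if "k < - 1" for k
    using L[of k] Ls_deg[of "- k"] that by simp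
  have m1: "pcoef L (- 1) * cshift (- 1) w0 = cconst Q * w0"
  proof -
    have "pcoef L (- 1) * cshift (- 1) w0 = cconst Q * cshift (- 1) (w0i * cshift 1 w0) * cshift (- 1) w0"
      using L[of "- 1"] by (simp add: Ls_lead)
    also have "\<dots> = cconst Q * cshift (- 1) (w0i * w0) * w0"
      by (simp add: cshift.mult ac_simps)
    finally show ?thesis by (simp add: w0_inv cshift.one)
  qed
  show ?thesis
    unfolding adj_iff
  proof
    fix k :: int
    consider "k > 1" | "k = 1" | "k = 0" | "k = - 1" | "k < - 1" by linarith
    then show "pcoef (L * W) k = cconst (Q powi (- k)) * cshift (of_int k) (pcoef (L * W) (- k))"
    proof cases
      case 2
      have "cconst (Q powi (- 1)) * cshift 1 (cconst Q * w0) = cshift 1 w0"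
        using Q by (simp add: cshift.mult power_int_minus cconst.one flip: mult.assoc cconst.mult)
      then show ?thesis using 2 m1 by (simp add: L_lead)
    next
      case 4
      then show ?thesis using m1 by (simp add: L_lead)
    qed (simp_all add: L_deg low cconst.one)
  qed
qed

lemma power_W_adjoint: "adj Q (L ^ i * W) (L ^ i * W)"
proof (induction i)
  case (Suc i)
  have "adj Q ((L * W) * Wi) (Wi * (L * W))"
    by (rule adj_mult[OF Q LW_adjoint adj_pconst])
  from adj_mult[OF Q this Suc]
  have "adj Q (L * W * Wi * (L ^ i * W)) (L ^ i * W * (Wi * (L * W)))" .
  then show ?case
    by (simp add: mult.assoc cancels) (simp add: power_commutes flip: mult.assoc)
qed (simp add: adj_pconst)

text \<open>What \<open>P\<^sub>R\<close> has to be, and its symbol; the equality is proved in \<open>PR_Rt\<close>.\<close>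

definition "Rt = PLi * W"

definition "Wt = Abs_fps (\<lambda>l. cshift (of_nat l) (pcoef Rt (- int l)))"

lemma Rt_opR: "Rt = opR (fps_to_fls Wt)"
proof (rule pdo_eqI)
  fix k
  have "pcoef Rt k = 0" if "k > 0"
    using that PLi_props by (simp add: Rt_def)
  then show "pcoef Rt k = pcoef (opR (fps_to_fls Wt)) k"
    by (cases "k > 0") (auto simp: Wt_def)
qed

abbreviation "Y \<equiv> evolution (\<lambda>n. pplus (H n))"

text \<open>The series \<open>Y P\<^sub>L = M(P\<^sub>L) (1 - \<Lambda>/\<mu>)\<^sup>-\<^sup>1\<close>, with \<open>M\<close> the Miwa shift.\<close>

definition "U j = Y j * PL"

lemma U_0 [simp]: "U 0 = PL"
  by (simp add: U_def evolution.simps)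

lemma miwa_Lham: "pconst (miwa_coeff n) * (A * Lham n) = A * pLam (int n + 1)"
proof -
  have "pconst (miwa_coeff n) * (A * Lham n) = pconst (miwa_coeff n) * pconst (ham_const n) * (A * pLam (int n + 1))"
    by (simp add: Lham_def ham_central mult.assoc)
  then show ?thesis by (simp add: miwa_ham_const pconst_1 flip: pconst_mult)
qed

text \<open>Since \<open>\<partial>\<^sub>n\<^sub>,\<^sub>1 P\<^sub>L + P\<^sub>L \<Lambda>\<^sup>n\<^sup>+\<^sup>1 / (\<epsilon> (n+1)!) = (H\<^sub>n)\<^sub>+ P\<^sub>L\<close>, multiplication by \<open>P\<^sub>L\<close> changes the Hamiltonians
  of the evolution into constant ones.\<close>

lemma U_Suc:
  "of_nat (Suc j) * U (Suc j) =
     (\<Sum>n\<le>j. pconst (miwa_coeff n) * pdiff n (U (j - n))) + (\<Sum>n\<le>j. U (j - n) * pLam (int n + 1))"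
proof -
  have step: "(pdiff n X + X * pplus (H n)) * PL = pdiff n (X * PL) + X * PL * Lham n" for n X
  proof -
    have "X * PL * Lham n = X * (pplus (H n) + pminus (H n)) * PL"
      using PL_Lham[of n] pplus_pminus[of "H n"] by (simp add: mult.assoc)
    then show ?thesis by (simp add: pdiff_mult wave_PL algebra_simps)
  qed
  have "of_nat (Suc j) * U (Suc j) = (\<Sum>n\<le>j. pconst (miwa_coeff n) * (pdiff n (U (j - n)) + U (j - n) * Lham n))"
    unfolding U_def by (simp only: mult.assoc[symmetric] evolution_Suc sum_distrib_right)
      (simp only: mult.assoc[of "pconst _"] step)
  then show ?thesis by (simp only: distrib_left miwa_Lham sum.distrib)
qed

text \<open>Multiplying \<open>Y P\<^sub>L\<close> by \<open>1 - \<Lambda>/\<mu>\<close> removes the constant Hamiltonians, and what remains satisfies the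
  recursion of the Miwa shift of \<open>P\<^sub>L\<close>.\<close>

definition "N j = (case j of 0 \<Rightarrow> PL | Suc i \<Rightarrow> U (Suc i) - U i * pLam 1)"

lemma N_Suc: "of_nat (Suc j) * N (Suc j) = (\<Sum>n\<le>j. pconst (miwa_coeff n) * pdiff n (N (j - n)))"
proof (cases j)
  case 0
  then show ?thesis using U_Suc[of 0] by (simp add: N_def)
next
  case (Suc i)
  let ?c = "\<lambda>n. pconst (miwa_coeff n)"
  have "of_nat (Suc j) * N (Suc j) = of_nat (Suc j) * U (Suc j) - of_nat j * U j * pLam 1 - U j * pLam 1"
    by (simp add: N_def algebra_simps)
  also have "of_nat j * U j * pLam 1 = (\<Sum>n\<le>i. ?c n * pdiff n (U (i - n) * pLam 1))
      + (\<Sum>n\<le>i. U (i - n) * pLam (2 + int n))"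
    unfolding Suc U_Suc by (simp add: distrib_right sum_distrib_right pdiff_mult mult.assoc flip: pLam_add)
  also have "of_nat (Suc j) * U (Suc j) = (\<Sum>n\<le>j. ?c n * pdiff n (U (j - n)))
      + (U j * pLam 1 + (\<Sum>n\<le>i. U (i - n) * pLam (2 + int n)))"
  proof -
    have "(\<Sum>n\<le>j. U (j - n) * pLam (int n + 1)) = U j * pLam 1 + (\<Sum>n\<le>i. U (i - n) * pLam (2 + int n))"
    proof -
      have "pLam (int (Suc n) + 1) = pLam (2 + int n)" for n
        by (rule arg_cong[of _ _ pLam]) simp
      then show ?thesis
        unfolding Suc
        by (subst sum.atMost_Suc_shift) (simp only: diff_Suc_Suc diff_zero of_nat_0 add_0)
    qed
    then show ?thesis unfolding U_Suc by simp
  qed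
  also have "(\<Sum>n\<le>j. ?c n * pdiff n (U (j - n)))
      = (\<Sum>n\<le>i. ?c n * pdiff n (U (j - n))) + ?c j * pdiff j PL"
    by (simp add: Suc)
  finally have "of_nat (Suc j) * N (Suc j) = (\<Sum>n\<le>i. ?c n * pdiff n (U (j - n)))
      - (\<Sum>n\<le>i. ?c n * pdiff n (U (i - n) * pLam 1)) + ?c j * pdiff j PL"
    by (simp add: algebra_simps)
  also have "\<dots> = (\<Sum>n\<le>i. ?c n * pdiff n (N (j - n))) + ?c j * pdiff j (N 0)"
  proof -
    have "N (j - n) = U (j - n) - U (i - n) * pLam 1" if "n \<le> i" for n
      using that by (simp add: N_def Suc Suc_diff_le)
    moreover have "pdiff n (A - B) = pdiff n A - pdiff n B" for n A B
      using pdiff_add[of n A "- B"] by (simp add: pdiff_uminus)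
    ultimately show ?thesis
      by (simp add: right_diff_distrib sum_subtractf[symmetric] N_def[of 0])
  qed
  finally show ?thesis by (simp add: Suc)
qed

lemma pcoef_N: "pcoef (N j) k = miwa_exp 1 (pcoef PL k) j"
proof -
  define F where "F = Abs_fps (\<lambda>j. pcoef (N j) k)"
  have "F = miwa_series 1 (pcoef PL k)"
  proof (rule miwa_series_unique)
    show "fps_deriv F = fps_const (cconst 1) * miwa_diff F"
    proof (rule fps_ext)
      fix j
      have "fps_deriv F $ j = pcoef (of_nat (Suc j) * N (Suc j)) k"
        by (simp add: F_def of_nat_pdo del: of_nat_Suc)
      also have "\<dots> = miwa_diff F $ j"
        unfolding N_Suc by (simp add: pcoef_sum miwa_diff_nth F_def)
      finally show "fps_deriv F $ j = (fps_const (cconst 1) * miwa_diff F) $ j"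
        by (simp add: cconst.one)
    qed
  qed (simp add: F_def N_def)
  then have "F $ j = miwa_series 1 (pcoef PL k) $ j" by simp
  then show ?thesis by (simp add: F_def)
qed

lemma U_N: "U j = (\<Sum>i\<le>j. N i * pLam (int (j - i)))"
proof (induction j)
  case (Suc j)
  have "U (Suc j) = N (Suc j) + U j * pLam 1" by (simp add: N_def)
  also have "U j * pLam 1 = (\<Sum>i\<le>j. N i * pLam (int (Suc j - i)))"
    unfolding Suc sum_distrib_right
    by (intro sum.cong refl) (simp add: mult.assoc Suc_diff_le add.commute flip: pLam_add)
  finally show ?case by simp
qed (simp add: N_def)

lemma Y_nonneg: "k < 0 \<Longrightarrow> pcoef (Y j) k = 0"
proof (induction j arbitrary: k rule: less_induct)
  case (less j)
  show ?case
  proof (cases j)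
    case 0
    then show ?thesis using less by (simp add: evolution.simps)
  next
    case (Suc i)
    have "of_nat (Suc i) * pcoef (Y (Suc i)) k = pcoef (of_nat (Suc i) * Y (Suc i)) k"
      by (simp add: of_nat_pdo del: of_nat_Suc)
    also have "\<dots> = 0"
      unfolding evolution_Suc pcoef_sum
    proof (intro sum.neutral ballI)
      fix n assume "n \<in> {..i}"
      then have "i - n < j" using Suc by simp
      then have "pcoef (Y (i - n) * pplus (H n)) k = 0" "pcoef (Y (i - n)) k = 0"
        using less by (auto intro!: pcoef_mult_nonneg(1))
      then show "pcoef (pconst (miwa_coeff n) * (pdiff n (Y (i - n)) + Y (i - n) * pplus (H n))) k = 0"
        by simp
    qed
    finally show ?thesis using Suc of_nat_mult_eq_0D by blast
  qed
qed

text \<open>On nonnegative powers the coefficient of \<open>\<Lambda>\<^sup>0\<close> is multiplicative.  As \<open>\<partial>\<^sub>n\<^sub>,\<^sub>1 w\<^sub>0\<close> is \<open>w\<^sub>0\<close> times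
  the coefficient of \<open>H\<^sub>n\<close>, multiplication by \<open>w\<^sub>0\<close> turns the recursion of \<open>Y\<close> into that of the Miwa shift.\<close>

lemma Y_zero: "pcoef (Y j) 0 * w0 = miwa_exp 1 w0 j"
proof -
  define F where "F = Abs_fps (\<lambda>j. pcoef (Y j) 0 * w0)"
  have "F = miwa_series 1 w0"
  proof (rule miwa_series_unique)
    show "fps_deriv F = fps_const (cconst 1) * miwa_diff F"
    proof (rule fps_ext)
      fix j
      have "fps_deriv F $ j = pcoef (of_nat (Suc j) * Y (Suc j)) 0 * w0"
        by (simp add: F_def of_nat_pdo del: of_nat_Suc)
      also have "\<dots> = (\<Sum>n\<le>j. miwa_coeff n *
          (mps_deriv n (pcoef (Y (j - n)) 0) + pcoef (Y (j - n)) 0 * pcoef (H n) 0) * w0)"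
        unfolding evolution_Suc pcoef_sum sum_distrib_right
        by (intro sum.cong refl) (simp add: pcoef_mult_nonneg(2) Y_nonneg)
      also have "\<dots> = miwa_diff F $ j"
        unfolding miwa_diff_nth F_def
        by (intro sum.cong refl) (simp add: mps_deriv.mult wave_w0 algebra_simps)
      finally show "fps_deriv F $ j = (fps_const (cconst 1) * miwa_diff F) $ j"
        by (simp add: cconst.one)
    qed
  qed (simp add: F_def evolution.simps)
  then have "F $ j = miwa_series 1 w0 $ j" by simp
  then show ?thesis by (simp add: F_def)
qed

text \<open>Both sides are the coefficient of \<open>\<Lambda>\<^sup>0\<close> in \<open>Y w\<^sub>0 = M(P\<^sub>L) (1 - \<Lambda>/\<mu>)\<^sup>-\<^sup>1 P\<^sub>L\<^sup>-\<^sup>1 w\<^sub>0\<close>.  On the left, a term with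
  \<open>\<Lambda>\<^sup>-\<^sup>k\<close> from \<open>M(P\<^sub>L)\<close> and \<open>\<Lambda>\<^sup>-\<^sup>l\<close> from \<open>P\<^sub>L\<^sup>-\<^sup>1 w\<^sub>0\<close> meets \<open>(\<Lambda>/\<mu>)\<^sup>k\<^sup>+\<^sup>l\<close>.\<close>

lemma miwa_relation: "miwa_total (Abs_fps (wL \<tau>)) * Wt = miwa_series 1 w0"
proof (rule fps_ext)
  fix j
  let ?M = "\<lambda>k i. miwa_exp 1 (wL \<tau> k) i"
  have N_opL: "N i = opL (fps_to_fls (Abs_fps (\<lambda>k. ?M k i)))" for i
  proof (rule pdo_eqI)
    fix k
    have "miwa_exp 1 0 i = 0"
      using miwa_exp_const_mult[of 0 1 0 i] by simp
    then show "pcoef (N i) k = pcoef (opL (fps_to_fls (Abs_fps (\<lambda>k. ?M k i)))) k"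
      by (simp add: pcoef_N pcoef_PL tau_PL_def)
  qed
  have "pcoef (U j * Rt) 0 = (\<Sum>i\<le>j. pcoef (N i * pLam (int (j - i)) * Rt) 0)"
    unfolding U_N by (simp add: sum_distrib_right pcoef_sum)
  also have "\<dots> = (\<Sum>i\<le>j. \<Sum>k\<le>j - i. ?M k i * Wt $ (j - i - k))"
  proof (intro sum.cong refl)
    fix i
    have "pcoef (N i * pLam (int (j - i)) * Rt) 0
        = (fps_to_fls (Abs_fps (\<lambda>k. ?M k i)) * fps_to_fls Wt) $$ int (j - i)"
      using pcoef_opL_pLam_opR[of "fps_to_fls (Abs_fps (\<lambda>k. ?M k i))" "int (j - i)" "fps_to_fls Wt" 0]
      by (simp add: N_opL Rt_opR)
    also have "\<dots> = (Abs_fps (\<lambda>k. ?M k i) * Wt) $ (j - i)"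
      by (simp flip: fls_times_fps_to_fls)
    finally show "pcoef (N i * pLam (int (j - i)) * Rt) 0 = (\<Sum>k\<le>j - i. ?M k i * Wt $ (j - i - k))"
      by (simp add: fps_mult_nth atLeast0AtMost)
  qed
  also have "\<dots> = (\<Sum>k=0..j. \<Sum>i=0..j - k. ?M k i * Wt $ (j - k - i))"
    by (subst sum_triangle_swap) (simp add: atLeast0AtMost add.commute)
  also have "\<dots> = (\<Sum>p=0..j. \<Sum>k=0..p. ?M k (p - k) * Wt $ (j - p))"
    by (rule fps_mult_assoc_lemma[symmetric])
  also have "\<dots> = (miwa_total (Abs_fps (wL \<tau>)) * Wt) $ j"
    by (simp add: fps_mult_nth miwa_total_def sum_distrib_right atLeast0AtMost)
  finally have "(miwa_total (Abs_fps (wL \<tau>)) * Wt) $ j = pcoef (U j * Rt) 0" by simp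
  also have "U j * Rt = Y j * W" by (simp add: U_def Rt_def mult.assoc cancels)
  finally show "(miwa_total (Abs_fps (wL \<tau>)) * Wt) $ j = miwa_series 1 w0 $ j"
    by (simp add: Y_zero)
qed

text \<open>As the symbol of \<open>P\<^sub>L\<close> is \<open>M\<^sup>-\<^sup>1(tm) / tm\<close>, its Miwa shift is \<open>tm / M(tm)\<close>; and \<open>M(w\<^sub>0) = M(tp) / M(tm)\<close>.
  Thus \<open>miwa_relation\<close> gives \<open>M(tp) / tm\<close> for the symbol of \<open>P\<^sub>L\<^sup>-\<^sup>1 w\<^sub>0\<close>.\<close>

lemma PR_Rt: "PR = PLi * W"
proof -
  have "Abs_fps (wL \<tau>) = fps_const tmi * miwa_series (- 1) tm"
    by (rule fps_ext) (simp add: wL_eq)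
  then have "miwa_total (Abs_fps (wL \<tau>)) = miwa_series 1 tmi * fps_const tm"
    by (simp add: miwa_total_const_mult miwa_total_inverse)
  then have *: "miwa_series 1 tmi * fps_const tm * Wt = miwa_series 1 tp * miwa_series 1 tmi"
    using miwa_relation by (simp add: w0_def miwa_series_mult)
  have M: "miwa_series 1 tm * miwa_series 1 tmi = 1"
    by (simp only: miwa_series_mult[symmetric] tm_inv miwa_series.one)
  have T: "fps_const tmi * fps_const tm = 1"
    by (simp add: tm_inv)
  have "Wt = (fps_const tmi * fps_const tm) * (miwa_series 1 tm * miwa_series 1 tmi) * Wt"
    by (simp only: M T mult_1)
  also have "\<dots> = fps_const tmi * miwa_series 1 tm * (miwa_series 1 tmi * fps_const tm * Wt)"
    by (simp only: ac_simps)
  also have "\<dots> = fps_const tmi * (miwa_series 1 tm * miwa_series 1 tmi) * miwa_series 1 tp"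
    unfolding * by (simp only: ac_simps)
  also have "\<dots> = fps_const tmi * miwa_series 1 tp"
    by (simp only: M mult_1_right)
  finally have "fps_to_fls Wt = fls_const tmi * miwaR \<tau>"
    by (simp add: miwaR_def tp_def fls_times_fps_to_fls)
  then show ?thesis using Rt_opR by (simp add: Rt_def PR_def)
qed

text \<open>The adjoints of \<open>(H\<^sub>n)\<^sub>+\<close> and \<open>H\<^sub>n\<close>.  As \<open>H\<^sub>n w\<^sub>0\<close> is its own adjoint, the
  adjoint of the nonnegative part of \<open>H\<^sub>n\<close> is its nonpositive part, conjugated by \<open>w\<^sub>0\<close>.\<close>

definition "Hps n = Wi * (pminus (H n) + pconst (pcoef (H n) 0)) * W"

lemma Hp_adjoint: "adj Q (pplus (H n)) (Hps n)"
proof -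
  have "adj Q (pplus (H n) * W) ((pminus (H n) + pconst (pcoef (H n) 0)) * W)"
    unfolding adj_iff
  proof
    fix k
    show "pcoef ((pminus (H n) + pconst (pcoef (H n) 0)) * W) k
        = cconst (Q powi (- k)) * cshift (of_int k) (pcoef (pplus (H n) * W) (- k))"
      using H_W_adjoint[OF power_W_adjoint, of n, unfolded adj_iff, rule_format, of k] by (cases "k = 0") auto
  qed
  from adj_mult[OF Q this adj_pconst[of Q w0i]] show ?thesis
    by (simp add: Hps_def mult.assoc cancels)
qed

definition "Hs n = Wi * H n * W"

lemma H_adjoint: "adj Q (H n) (Hs n)"
  using adj_mult[OF Q H_W_adjoint[OF power_W_adjoint, of n] adj_pconst[of Q w0i]] by (simp add: Hs_def mult.assoc cancels)

lemma pdiff_PR: "pdiff n PR = PR * Hps n"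
proof -
  have "pdiff n PLi * PL + PLi * pdiff n PL = 0"
    using arg_cong[OF PLi_props[THEN conjunct2, THEN conjunct2, THEN conjunct2], of "pdiff n"]
    by (simp add: pdiff_mult)
  then have "(pdiff n PLi * PL + PLi * pdiff n PL) * PLi = 0" by simp
  then have i: "pdiff n PLi = PLi * pminus (H n)"
    by (simp add: wave_PL left_diff_distrib mult.assoc cancels)
  have "pdiff n PR = PLi * (pminus (H n) + pconst (pcoef (H n) 0)) * W"
  proof -
    have "pconst (mps_deriv n w0) = pconst (pcoef (H n) 0) * W"
      by (simp only: wave_w0 pconst_mult)
    then show ?thesis by (simp add: PR_Rt pdiff_mult i pdiff_pconst algebra_simps)
  qed
  then show ?thesis by (simp add: Hps_def PR_Rt mult.assoc cancels)
qed

lemma Lham_PR: "Lham n * PR = PR * Hs n"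
  using arg_cong[OF Lham_PLi[of n], of "\<lambda>A. A * W"] by (simp add: PR_Rt Hs_def mult.assoc cancels)

text \<open>In the symmetric gauge both wave functions evolve by \<open>A\<^sub>n = (H\<^sub>+ - H\<^sub>-) / 2\<close>, so all their
  derivatives arise from a single operator \<open>Z\<close> and its adjoint.\<close>

lemma nabs_operators:
  "\<exists>Z Zs. adj Q Z Zs \<and> opL (nabs (1/2) ns (miwaL \<tau>)) = Z * PL \<and> opR (nabs (- 1/2) ns (miwaR \<tau>)) = PR * Zs"
proof (induction ns)
  case Nil
  then show ?case using adj_pconst[of Q tm] by (auto simp: opL_miwaL opR_miwaR)
next
  case (Cons n ns)
  then obtain Z Zs where Z: "adj Q Z Zs" "opL (nabs (1/2) ns (miwaL \<tau>)) = Z * PL"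
    "opR (nabs (- 1/2) ns (miwaR \<tau>)) = PR * Zs" by blast
  define A where "A = pplus (H n) - half * H n"
  define As where "As = Hps n - half * Hs n"
  have A: "adj Q A As"
    using adj_diff[OF Hp_adjoint[of n] adj_mult[OF Q adj_pconst[of Q "cconst (1/2)"] H_adjoint[of n]]]
    by (simp add: A_def As_def half_central(1))
  have "pdiff n PL + half * (PL * Lham n) = A * PL"
  proof -
    have m: "pminus (H n) = H n - pplus (H n)"
      using pplus_pminus[of "H n"] by (simp add: eq_diff_eq add.commute)
    have "pdiff n PL + half * (PL * Lham n) = (pplus (H n) - H n + half * H n) * PL"
      unfolding wave_PL PL_Lham m by (simp add: algebra_simps)
    also have "pplus (H n) - H n + half * H n = A"
      using half_add[of "H n"] by (simp add: A_def algebra_simps)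
    finally show ?thesis .
  qed
  then have L: "opL (nabs (1/2) (n # ns) (miwaL \<tau>)) = (pdiff n Z + Z * A) * PL"
    by (simp add: opL_nab Z(2) pdiff_mult distrib_right distrib_left half_central mult.assoc
        flip: add.assoc)
      (simp add: add.assoc half_central(2)[symmetric] flip: distrib_left)
  have "opR (nabs (- 1/2) (n # ns) (miwaR \<tau>)) = pdiff n (PR * Zs) - half * (Lham n * (PR * Zs))"
    by (simp only: foldr_Cons comp_apply opR_nab_half Z(3))
  also have "\<dots> = PR * (pdiff n Zs + As * Zs)"
    using arg_cong[OF Lham_PR[of n], of "\<lambda>A. half * (A * Zs)"]
    by (simp add: pdiff_mult pdiff_PR As_def algebra_simps half_central)
  finally have R: "opR (nabs (- 1/2) (n # ns) (miwaR \<tau>)) = PR * (pdiff n Zs + As * Zs)" .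
  show ?case using L R adj_add[OF adj_pdiff[OF Z(1), of n] adj_mult[OF Q Z(1) A]] by blast
qed

lemma wave_imp_adj:
  "adj Q (opL (miwaL \<tau>) * pLam (int i) * opR (nabs (- 1/2) ns (miwaR \<tau>)))
     (opL (nabs (1/2) ns (miwaL \<tau>)) * pLam (int i) * opR (miwaR \<tau>))"
proof -
  obtain Z Zs where Z: "adj Q Z Zs" "opL (nabs (1/2) ns (miwaL \<tau>)) = Z * PL"
    "opR (nabs (- 1/2) ns (miwaR \<tau>)) = PR * Zs" using nabs_operators by blast
  have m: "PL * pLam (int i) * PR = L ^ i * W" by (simp add: PR_Rt L_power mult.assoc)
  have "adj Q (a * (L ^ i * W)) ((L ^ i * W) * a)"
    by (rule adj_mult[OF Q adj_pconst power_W_adjoint])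
  from adj_mult[OF Q this adj_sym[OF Q Z(1)]]
  have "adj Q (a * (L ^ i * W) * Zs) (Z * (L ^ i * W * a))" .
  then show ?thesis
    unfolding Z opL_miwaL opR_miwaR m[symmetric] by (simp add: mult.assoc)
qed

end

end

theorem corollary1p2:
  fixes Q sqrtQ :: complex and \<tau> :: cfun
  assumes "Q \<noteq> 0" and "sqrtQ ^ 2 = Q" and "nonvanishing \<tau>"
  shows "toda_tau_function Q \<tau> \<longleftrightarrow> (\<forall>m::int. regular_in_lambda (hirota sqrtQ m \<tau>))"
proof -
  obtain \<sigma> where "\<tau> * \<sigma> = 1" using nonvanishing_unit[OF assms(3)] .
  then interpret unit_series Q \<tau> \<sigma> using assms(1) by unfold_locales
  have r: "sqrtQ \<noteq> 0" using assms by auto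
  show ?thesis
  proof
    assume "toda_tau_function Q \<tau>"
    then obtain L0 where "wave_operators Q L0 (tau_PL \<tau>) (tau_PR \<tau>)"
      unfolding toda_tau_function_def by blast
    then show "\<forall>m. regular_in_lambda (hirota sqrtQ m \<tau>)"
      using adj_imp_hirota[OF r] wave_imp_adj unfolding assms(2) by blast
  next
    assume reg: "\<forall>m. regular_in_lambda (hirota sqrtQ m \<tau>)"
    have "wave_operators Q (pcoef L) (tau_PL \<tau>) (tau_PR \<tau>)"
    proof (rule wave_operators_L[OF _ _ assms(3)])
      fix i :: nat
      show "adj Q (opL (miwaL \<tau>) * pLam (int i) * opR (miwaR \<tau>))
        (opL (miwaL \<tau>) * pLam (int i) * opR (miwaR \<tau>))"
        using hirota_imp_adj(1)[OF r, of \<tau>] reg unfolding assms(2) by blast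
    next
      fix n
      have "adj Q (opL (miwaL \<tau>) * pLam (int 0) * opR (nab (- 1/2) n (miwaR \<tau>)))
           (opL (nab (1/2) n (miwaL \<tau>)) * pLam (int 0) * opR (miwaR \<tau>))"
        using hirota_imp_adj(2)[OF r, of \<tau>] reg unfolding assms(2) by blast
      then show "adj Q (opL (miwaL \<tau>) * opR (nab (- 1/2) n (miwaR \<tau>)))
        (opL (nab (1/2) n (miwaL \<tau>)) * opR (miwaR \<tau>))" by simp
    qed
    then show "toda_tau_function Q \<tau>" unfolding toda_tau_function_def by blast
  qed
qed

end
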